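(* Let $\delta\in(0,1]$, $M$ a $d\times d$ dilation matrix, and $\alpha\in\mathcal{A}_M$. Suppose that $\widetilde\varphi\in\mathcal{S}'_{\alpha;M}$ and $\varphi\in\mathcal{L}C$ satisfy the following conditions: \begin{enumerate} \item[1)] $\operatorname{supp}\widehat\varphi\subset\mathbb{T}^d$; \item[2)] $\varphi$ and $\widetilde\varphi$ are strictly compatible with respect to $\delta$, i.e. $\overline{\widehat\varphi}(\xi)\,\widehat{\widetilde\varphi}(\xi)=1$ for a.e. $\xi\in\delta\mathbb{T}^d$. \end{enumerate} Then there is a constant $c$, independent of $f$ and $j$, such that for every $f\in\mathbb{B}_M^{\alpha(\cdot)}$ and every $j\in\mathbb{Z}_+$ $$ \|f-Q_j(f,\varphi,\widetilde\varphi)\|\le c\sum_{\nu=j}^\infty\alpha(M^{\nu-j})\,E_{\delta M^\nu}(f). $$ Moreover, if $\widetilde\varphi\in\mathcal{S}'_{\mathrm{const};M}$, then there is a constant $c$, independent of $f$ and $j$, such that for every $f\in C$ and every $j\in\mathbb{Z}_+$ $$ \|f-Q_j(f,\varphi,\widetilde\varphi)\|\le c\,E_{\delta M^j}(f). $$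
   Context: Basic notation. $\mathbb{Z}_+=\{0,1,2,\dots\}$. $\mathbb{T}^d$, viewed as a subset of $\mathbb{R}^d$, is the unit cube $[-1/2,1/2]^d$. $M^*$ is the conjugate (transpose) of $M$, $m=|\det M|$. A dilation matrix is a real $d\times d$ matrix all of whose eigenvalues are bigger than $1$ in modulus. $C$ is the space of bounded uniformly continuous functions on $\mathbb{R}^d$; $\|\cdot\|$ is the sup norm on $\mathbb{R}^d$. $\widehat f(\xi)=\mathcal{F}f(\xi)=\int_{\mathbb{R}^d}f(x)e^{-2\pi i(x,\xi)}dx$, extended to tempered distributions. For $f\in\mathcal S$ (Schwartz class) and $\psi\in\mathcal S'$, $\langle f,\psi\rangle:=\psi(f)$, where a function $g$ is identified with the functional $f\mapsto\int f\overline g$; $\widehat\psi$ is defined by $\langle\widehat f,\widehat\psi\rangle=\langle f,\psi\rangle$. For a function, $f^-(x)=\overline{f(-x)}$; for $\psi\in\mathcal S'$, $\psi^-$ is defined by $\langle f,\psi^-\rangle=\overline{\langle f^-,\psi\rangle}$, so that $\widehat{\psi^-}=\overline{\widehat\psi}$ when $\widehat\psi$ is a function. $\mathcal{L}C$ is the set of continuous functions $\varphi$ on $\mathbb{R}^d$ such that $\sum_{k\in\mathbb{Z}^d}|\varphi(\cdot+k)|$ converges uniformly on every compact set. Cut-offs: $\eta\in C^\infty(\mathbb{R}^d)$ is a fixed real-valued function with $\eta=1$ on $\mathbb{T}^d$ and $\eta=0$ outside $2\mathbb{T}^d$; for an invertible matrix $A$, $\eta_A=\eta((A^* )^{-1}\cdot)$,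 $\mathcal{N}_A=\mathcal{F}^{-1}\eta_A$. Also $\mathcal{N}_A*\widetilde\varphi^-:=\mathcal{F}^{-1}\big(\eta_A\,\overline{\widehat{\widetilde\varphi}}\big)$. Best approximation and Besov space: $\mathcal{B}_A=\{g\in L_\infty(\mathbb{R}^d):\operatorname{supp}\widehat g\subset A^*\mathbb{T}^d\}$ (elements are identified with their continuous representatives), $E_A(f)=\inf\{\|f-g\|:g\in\mathcal{B}_A\}$. For a positive function $\alpha$ on the set of real $d\times d$ matrices, $\mathbb{B}_M^{\alpha(\cdot)}$ is the set of $f\in C$ with $\|f\|+\sum_{\nu=1}^\infty\alpha(M^\nu)E_{M^\nu}(f)<\infty$. $\mathcal{A}_M$ is the set of positive functions $\alpha$ on $\mathbb{R}^{d\times d}$ with $\alpha(M^{\mu+1})\le c(M)\alpha(M^\mu)$ for all $\mu\in\mathbb{Z}_+$. Class $\mathcal{S}'_{\alpha;M}$: tempered distributions $\widetilde\varphi$ whose Fourier transform is a measurable locally bounded function and such that for all $\nu\in\mathbb{Z}_+$ the function $\mathcal{N}_{M^\nu}*\widetilde\varphi^-$ is in $L_1(\mathbb{R}^d)$ with $\|\mathcal{N}_{M^\nu}*\widetilde\varphi^-\|_1\le c\,\alpha(M^\nu)$, $c$ independent of $\nu$. $\mathcal{S}'_{\mathrm{const};M}$ is this class with $\alpha$ a constant function. Quasi-projection operators: let $\widetilde\varphi\in\mathcal{S}'_{\alpha;M}$, $\alpha\in\mathcal{A}_M$. For $f\in\mathbb{B}_M^{\alpha(\cdot)}$, or for $f\in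 C$ when $\alpha$ is constant, choose any $\delta'\in(0,1]$ and functions $T_\mu\in\mathcal{B}_{\delta'M^\mu}$, $\mu\in\mathbb{Z}_+$, with $\|f-T_\mu\|\le c(d)E_{\delta'M^\mu}(f)$, and set $$\langle f,\widetilde\varphi_{0k}\rangle:=\lim_{\mu\to\infty}\big(T_\mu*(\mathcal{N}_{M^\mu}*\widetilde\varphi^-)\big)(-k),\quad k\in\mathbb{Z}^d,$$ (the limit exists and does not depend on $\delta'$ and the $T_\mu$), and $\langle f,\widetilde\varphi_{jk}\rangle:=m^{-j/2}\langle f(M^{-j}\cdot),\widetilde\varphi_{0k}\rangle$, $j\in\mathbb{Z}_+$. With $\varphi_{jk}(x)=m^{j/2}\varphi(M^jx+k)$, $$Q_j(f,\varphi,\widetilde\varphi)=\sum_{k\in\mathbb{Z}^d}\langle f,\widetilde\varphi_{jk}\rangle\varphi_{jk}.$$ *)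

theory Defs
  imports "HOL-Analysis.Analysis"
begin

text \<open>The powers of a matrix are taken with respect to \<open>**\<close>: the power operation of the type class
  would be the componentwise one on this type.\<close>

definition matpow :: "real^'n^'n \<Rightarrow> nat \<Rightarrow> real^'n^'n" where
  "matpow A n = (((**) A) ^^ n) (mat 1)"

definition complex_eigenvalue :: "real^'n^'n \<Rightarrow> complex \<Rightarrow> bool" where
  "complex_eigenvalue A l \<longleftrightarrow>
     (\<exists>v :: complex^'n. v \<noteq> 0 \<and> map_matrix complex_of_real A *v v = l *s v)"

definition dilation_matrix :: "real^'n^'n \<Rightarrow> bool" where
  "dilation_matrix A \<longleftrightarrow> (\<forall>l. complex_eigenvalue A l \<longrightarrow> norm l > 1)"

definition unit_cube :: "(real^'n) set" where
  "unit_cube = {x. \<forall>i. \<bar>x $ i\<bar> \<le> 1/2}"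

definition int_lattice :: "(real^'n) set" where
  "int_lattice = {k. \<forall>i. k $ i \<in> \<int>}"

text \<open>The sup norm takes values in the extended nonnegative reals, so that it is meaningful for
  unbounded functions as well.\<close>

definition sup_norm :: "(real^'n \<Rightarrow> complex) \<Rightarrow> ennreal" where
  "sup_norm f = (SUP x. ennreal (norm (f x)))"

definition space_C :: "(real^'n \<Rightarrow> complex) set" where
  "space_C = {f. bounded (range f) \<and> uniformly_continuous_on UNIV f}"

text \<open>As the terms are nonnegative, uniform convergence is unconditional and is expressed along the
  net of finite subsets of the lattice.\<close>

definition class_LC :: "(real^'n \<Rightarrow> complex) set" where
  "class_LC = {\<phi>. continuous_on UNIV \<phi> \<and>
     (\<forall>K. compact K \<longrightarrow>
        (\<exists>s. uniform_limit K (\<lambda>F x. \<Sum>k\<in>F. norm (\<phi> (x + k))) s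
               (finite_subsets_at_top int_lattice)))}"

definition partial_deriv ::
  "'n \<Rightarrow> (real^'n \<Rightarrow> 'b::real_normed_vector) \<Rightarrow> real^'n \<Rightarrow> 'b" where
  "partial_deriv i f = (\<lambda>x. frechet_derivative f (at x) (axis i 1))"

definition iter_partial ::
  "'n list \<Rightarrow> (real^'n \<Rightarrow> 'b::real_normed_vector) \<Rightarrow> real^'n \<Rightarrow> 'b" where
  "iter_partial is f = fold partial_deriv is f"

definition smooth :: "(real^'n \<Rightarrow> 'b::real_normed_vector) \<Rightarrow> bool" where
  "smooth f \<longleftrightarrow> (\<forall>is x. iter_partial is f differentiable (at x))"

definition schwartz :: "(real^'n \<Rightarrow> complex) set" where
  "schwartz = {f. smooth f \<and>
     (\<forall>is N. bounded (range (\<lambda>x. (1 + norm x) ^ N *\<^sub>R iter_partial is f x)))}"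

definition schwartz_norm :: "nat \<Rightarrow> (real^'n \<Rightarrow> complex) \<Rightarrow> real" where
  "schwartz_norm N f =
     (SUP (is, x) \<in> {is. length is \<le> N} \<times> UNIV. (1 + norm x) ^ N * norm (iter_partial is f x))"

definition fourier :: "(real^'n \<Rightarrow> complex) \<Rightarrow> real^'n \<Rightarrow> complex" where
  "fourier f \<xi> = (LINT x|lborel. f x * cis (- 2 * pi * (x \<bullet> \<xi>)))"

definition inv_fourier :: "(real^'n \<Rightarrow> complex) \<Rightarrow> real^'n \<Rightarrow> complex" where
  "inv_fourier f x = (LINT \<xi>|lborel. f \<xi> * cis (2 * pi * (x \<bullet> \<xi>)))"

text \<open>A distribution is a complex-linear functional; only its values on Schwartz functions
  matter.\<close>

type_synonym 'n functional = "(real^'n \<Rightarrow> complex) \<Rightarrow> complex"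

definition tempered :: "'n::finite functional \<Rightarrow> bool" where
  "tempered \<psi> \<longleftrightarrow>
     (\<forall>f\<in>schwartz. \<forall>g\<in>schwartz. \<psi> (\<lambda>x. f x + g x) = \<psi> f + \<psi> g) \<and>
     (\<forall>f\<in>schwartz. \<forall>a. \<psi> (\<lambda>x. a * f x) = a * \<psi> f) \<and>
     (\<exists>N B. \<forall>f\<in>schwartz. norm (\<psi> f) \<le> B * schwartz_norm N f)"

definition fun_functional :: "(real^'n \<Rightarrow> complex) \<Rightarrow> 'n functional" where
  "fun_functional g = (\<lambda>f. LINT x|lborel. f x * cnj (g x))"

text \<open>The condition \<open>\<langle>F f, F \<psi>\<rangle> = \<langle>f, \<psi>\<rangle>\<close> for all Schwartz \<open>f\<close> reads
  \<open>(F \<psi>) f = \<psi> (F\<^sup>-\<^sup>1 f)\<close>; with the conjugate in \<open>fun_functional\<close> it is Parseval's identity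
  when \<open>\<psi>\<close> is a function.\<close>

definition fourier_dist :: "'n::finite functional \<Rightarrow> 'n functional" where
  "fourier_dist \<psi> = (\<lambda>f. \<psi> (inv_fourier f))"

definition fun_support :: "(real^'n \<Rightarrow> complex) \<Rightarrow> (real^'n) set" where
  "fun_support f = closure {x. f x \<noteq> 0}"

definition dist_support :: "'n::finite functional \<Rightarrow> (real^'n) set" where
  "dist_support \<psi> = - \<Union>{U. open U \<and>
     (\<forall>f\<in>schwartz. compact (fun_support f) \<and> fun_support f \<subseteq> U \<longrightarrow> \<psi> f = 0)}"

definition has_fourier_fun :: "'n::finite functional \<Rightarrow> (real^'n \<Rightarrow> complex) \<Rightarrow> bool" where
  "has_fourier_fun \<psi> h \<longleftrightarrow>
     h \<in> borel_measurable borel \<and>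
     (\<forall>K. compact K \<longrightarrow> bounded (h ` K)) \<and>
     (\<forall>f\<in>schwartz. integrable lborel (\<lambda>x. f x * cnj (h x)) \<and>
                   fourier_dist \<psi> f = fun_functional h f)"

text \<open>Such a function is determined up to a null set.\<close>

definition fourier_fun :: "'n::finite functional \<Rightarrow> real^'n \<Rightarrow> complex" where
  "fourier_fun \<psi> = (SOME h. has_fourier_fun \<psi> h)"

text \<open>Each class of essentially bounded functions with compact spectrum is represented by its
  continuous member.\<close>

definition bandlimited :: "real^'n^'n \<Rightarrow> (real^'n \<Rightarrow> complex) set" where
  "bandlimited A = {g. continuous_on UNIV g \<and> bounded (range g) \<and>
     dist_support (fourier_dist (fun_functional g)) \<subseteq> (*v) (transpose A) ` unit_cube}"

definition best_approx :: "real^'n^'n \<Rightarrow> (real^'n \<Rightarrow> complex) \<Rightarrow> ennreal" where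
  "best_approx A f = (INF g \<in> bandlimited A. sup_norm (\<lambda>x. f x - g x))"

definition besov :: "(real^'n^'n \<Rightarrow> real) \<Rightarrow> real^'n^'n \<Rightarrow> (real^'n \<Rightarrow> complex) set" where
  "besov \<alpha> M = {f \<in> space_C.
     sup_norm f + (\<Sum>\<^sub>\<infinity>\<nu>\<in>{1..}. ennreal (\<alpha> (matpow M \<nu>)) * best_approx (matpow M \<nu>) f) < \<infinity>}"

definition class_A :: "real^'n^'n \<Rightarrow> (real^'n^'n \<Rightarrow> real) set" where
  "class_A M = {\<alpha>. (\<forall>A. \<alpha> A > 0) \<and>
     (\<exists>c. \<forall>\<mu>. \<alpha> (matpow M (\<mu> + 1)) \<le> c * \<alpha> (matpow M \<mu>))}"

definition cutoff :: "(real^'n \<Rightarrow> real) \<Rightarrow> bool" where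
  "cutoff \<eta> \<longleftrightarrow> smooth \<eta> \<and> (\<forall>x\<in>unit_cube. \<eta> x = 1) \<and>
     (\<forall>x. x \<notin> (*\<^sub>R) 2 ` unit_cube \<longrightarrow> \<eta> x = 0)"

definition cutoff_mat :: "(real^'n \<Rightarrow> real) \<Rightarrow> real^'n^'n \<Rightarrow> real^'n \<Rightarrow> real" where
  "cutoff_mat \<eta> A \<xi> = \<eta> (matrix_inv (transpose A) *v \<xi>)"

definition mollified ::
  "(real^'n \<Rightarrow> real) \<Rightarrow> real^'n^'n \<Rightarrow> 'n::finite functional \<Rightarrow> real^'n \<Rightarrow> complex" where
  "mollified \<eta> A \<psi> =
     inv_fourier (\<lambda>\<xi>. complex_of_real (cutoff_mat \<eta> A \<xi>) * cnj (fourier_fun \<psi> \<xi>))"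

definition class_S ::
  "(real^'n \<Rightarrow> real) \<Rightarrow> (real^'n^'n \<Rightarrow> real) \<Rightarrow> real^'n^'n \<Rightarrow> 'n::finite functional set" where
  "class_S \<eta> \<alpha> M = {\<psi>. tempered \<psi> \<and> (\<exists>h. has_fourier_fun \<psi> h) \<and>
     (\<exists>c. \<forall>\<nu>. integrable lborel (mollified \<eta> (matpow M \<nu>) \<psi>) \<and>
            (LINT x|lborel. norm (mollified \<eta> (matpow M \<nu>) \<psi> x)) \<le> c * \<alpha> (matpow M \<nu>))}"

definition class_S_const ::
  "(real^'n \<Rightarrow> real) \<Rightarrow> real^'n^'n \<Rightarrow> 'n::finite functional set" where
  "class_S_const \<eta> M = (\<Union>a\<in>{0<..}. class_S \<eta> (\<lambda>A. a) M)"

definition strictly_compatible ::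
  "(real^'n \<Rightarrow> complex) \<Rightarrow> 'n::finite functional \<Rightarrow> real \<Rightarrow> bool" where
  "strictly_compatible \<phi> \<psi> \<delta> \<longleftrightarrow>
     (AE \<xi> in lborel. \<xi> \<in> (*\<^sub>R) \<delta> ` unit_cube \<longrightarrow> cnj (fourier \<phi> \<xi>) * fourier_fun \<psi> \<xi> = 1)"

definition convolve ::
  "(real^'n \<Rightarrow> complex) \<Rightarrow> (real^'n \<Rightarrow> complex) \<Rightarrow> real^'n \<Rightarrow> complex" where
  "convolve f g x = (LINT t|lborel. f (x - t) * g t)"

definition near_best ::
  "real^'n^'n \<Rightarrow> (real^'n \<Rightarrow> complex) \<Rightarrow> real \<Rightarrow> (nat \<Rightarrow> real^'n \<Rightarrow> complex) \<Rightarrow> bool" where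
  "near_best M f \<delta> T \<longleftrightarrow>
     (\<forall>\<mu>. T \<mu> \<in> bandlimited (\<delta> *\<^sub>R matpow M \<mu>)) \<and>
     (\<exists>c::real. \<forall>\<mu>. sup_norm (\<lambda>x. f x - T \<mu> x) \<le> ennreal c * best_approx (\<delta> *\<^sub>R matpow M \<mu>) f)"

text \<open>The pairing is the common limit over all admissible choices of the dilation factor and of the
  approximants.\<close>

definition pairing0 ::
  "(real^'n \<Rightarrow> real) \<Rightarrow> real^'n^'n \<Rightarrow> (real^'n \<Rightarrow> complex) \<Rightarrow> 'n::finite functional \<Rightarrow> real^'n \<Rightarrow> complex"
  where
  "pairing0 \<eta> M f \<psi> k = (THE L. \<forall>\<delta> T. 0 < \<delta> \<and> \<delta> \<le> 1 \<and> near_best M f \<delta> T \<longrightarrow>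
     (\<lambda>\<mu>. convolve (T \<mu>) (mollified \<eta> (matpow M \<mu>) \<psi>) (- k)) \<longlonglongrightarrow> L)"

definition pairing ::
  "(real^'n \<Rightarrow> real) \<Rightarrow> real^'n^'n \<Rightarrow> (real^'n \<Rightarrow> complex) \<Rightarrow> 'n::finite functional \<Rightarrow> nat \<Rightarrow> real^'n \<Rightarrow> complex"
  where
  "pairing \<eta> M f \<psi> j k = of_real (\<bar>det M\<bar> powr (- (real j / 2))) *
     pairing0 \<eta> M (\<lambda>x. f (matrix_inv (matpow M j) *v x)) \<psi> k"

definition dil_shift ::
  "real^'n^'n \<Rightarrow> (real^'n \<Rightarrow> complex) \<Rightarrow> nat \<Rightarrow> real^'n \<Rightarrow> real^'n \<Rightarrow> complex" where
  "dil_shift M \<phi> j k x = of_real (\<bar>det M\<bar> powr (real j / 2)) * \<phi> (matpow M j *v x + k)"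

definition quasi_proj ::
  "(real^'n \<Rightarrow> real) \<Rightarrow> real^'n^'n \<Rightarrow> nat \<Rightarrow> (real^'n \<Rightarrow> complex) \<Rightarrow> (real^'n \<Rightarrow> complex) \<Rightarrow>
   'n::finite functional \<Rightarrow> real^'n \<Rightarrow> complex" where
  "quasi_proj \<eta> M j f \<phi> \<psi> x =
     (\<Sum>\<^sub>\<infinity>k\<in>int_lattice. pairing \<eta> M f \<psi> j k * dil_shift M \<phi> j k x)"

end

theory Submission
  imports Defs "HOL-Probability.Characteristic_Functions" "HOL-Probability.Sinc_Integral"
    "HOL-Computational_Algebra.Fundamental_Theorem_Algebra"
begin

text \<open>Dilating by \<open>M\<^sup>j\<close> reduces everything to \<open>j = 0\<close>. Let \<open>T\<^sub>\<mu>\<close> be near-best approximants of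
  \<open>f\<close> from the band of \<open>\<delta> M\<^sup>\<mu>\<close>. On a band-limited function, convolution with an integrable
  kernel depends only on the transform of the kernel on the band, so mollifying with \<open>M\<^sup>n\<close> or
  \<open>M\<^sup>\<mu>\<close> gives the same functional of \<open>T\<^sub>\<mu>\<close> once \<open>n - \<mu>\<close> is large. (The cells of \<open>M\<^sup>n\<close> need not be
  nested for consecutive \<open>n\<close>, but the powers of the inverse of a dilation matrix tend to zero.) Hence the
  functionals differ from those of \<open>T\<^sub>0\<close> by at most a constant times the sum on the right-hand side, and
  as \<open>\<phi>\<close> has uniformly bounded periodized absolute sums, it remains to see that the operator reproduces \<open>T\<^sub>0\<close>.
  By Poisson summation on the unit cube, it acts on \<open>T\<^sub>0\<close> as the Fourier multiplier
  that equals one on the band by strict compatibility.\<close>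

section \<open>Change of variables and the Gaussian\<close>

text \<open>Elements of \<open>bandlimited A\<close> are merely bounded, so their transforms are
  distributions, and the closed cell lets the spectrum reach its boundary. Fourier integrals are
  therefore never written for them: each is a bounded pointwise limit of integrable functions with
  transforms in the same cell, identities are proved for those, and dominated convergence carries
  them over. The given cut-off is the raw material for the bumps that this takes.

  \<open>pairing0\<close> is a definite description over all scales and all near-best sequences. A
  limit along one sequence is its value once \<alpha>(M^\<mu>) times the error at every scale
  \<delta>' tends to zero, and errors at different scales are compared by shifting \<mu>. With a
  general weight this decay comes from a finite right-hand sum (an infinite one bounds anything),
  and the limit is reached by telescoping. With a constant weight the errors need not be summable:
  their decay is a separate density statement, and each functional is compared in one step with
  indices far ahead, so that a single error survives.\<close>

lemma lborel_translate: "distr lborel borel (\<lambda>x. x + t) = (lborel :: 'a::euclidean_space measure)"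
  using lborel_distr_plus[of t] by (simp add: add.commute[of t] cong: distr_cong)

lemma lborel_integral_affine:
  fixes f :: "'a::euclidean_space \<Rightarrow> 'b :: {banach, second_countable_topology}"
  assumes c: "c \<noteq> 0"
  shows lborel_integrable_affine_iff: "integrable lborel (\<lambda>x. f (t + c *\<^sub>R x)) \<longleftrightarrow> integrable lborel f" (is ?A)
    and "(LINT x|lborel. f x) = \<bar>c\<bar>^DIM('a) *\<^sub>R (LINT x|lborel. f (t + c *\<^sub>R x))" (is ?B)
proof -
  have imp: "integrable lborel (\<lambda>x. f (t + c *\<^sub>R x))" if f: "integrable lborel f" and c: "c \<noteq> 0"
    for f :: "'a \<Rightarrow> 'b" and c t
  proof -
    have m[measurable]: "f \<in> borel_measurable borel" using f by simp
    have "integrable (density (distr lborel borel (\<lambda>x. t + c *\<^sub>R x)) (\<lambda>_. \<bar>c\<bar>^DIM('a))) f"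
      using f lborel_affine[OF c, of t] by simp
    then have "integrable (distr lborel borel (\<lambda>x. t + c *\<^sub>R x)) (\<lambda>x. \<bar>c\<bar>^DIM('a) *\<^sub>R f x)"
      by (subst (asm) integrable_density) auto
    then have "integrable lborel (\<lambda>x. \<bar>c\<bar>^DIM('a) *\<^sub>R f (t + c *\<^sub>R x))"
      by (subst (asm) integrable_distr_eq) auto
    then have "integrable lborel (\<lambda>x. (1 / \<bar>c\<bar>^DIM('a)) *\<^sub>R \<bar>c\<bar>^DIM('a) *\<^sub>R f (t + c *\<^sub>R x))"
      by (rule integrable_scaleR_right)
    then show ?thesis using c by simp
  qed
  show A: ?A
    using imp[of f c t] imp[of "\<lambda>x. f (t + c *\<^sub>R x)" "1/c" "- (1/c) *\<^sub>R t"] c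
    by (auto simp: scaleR_right_diff_distrib)
  show ?B
  proof (cases "integrable lborel f")
    case True
    then have m[measurable]: "f \<in> borel_measurable borel" by simp
    have "(LINT x|lborel. f x) = (LINT x|density (distr lborel borel (\<lambda>x. t + c *\<^sub>R x)) (\<lambda>_. \<bar>c\<bar>^DIM('a)). f x)"
      using lborel_affine[OF c, of t] by simp
    also have "\<dots> = (LINT x|distr lborel borel (\<lambda>x. t + c *\<^sub>R x). \<bar>c\<bar>^DIM('a) *\<^sub>R f x)"
      by (subst integral_density) auto
    also have "\<dots> = (LINT x|lborel. \<bar>c\<bar>^DIM('a) *\<^sub>R f (t + c *\<^sub>R x))"
      by (subst integral_distr) auto
    finally show ?thesis using True A by simp
  next
    \<comment> \<open>Both integrals take the default value 0, so the identity holds for every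
      \<open>f\<close>.\<close>
    case False then show ?thesis using A by (simp add: not_integrable_integral_eq)
  qed
qed

lemma nn_integral_translate:
  fixes f :: "'a::euclidean_space \<Rightarrow> ennreal"
  assumes [measurable]: "f \<in> borel_measurable borel"
  shows "(\<integral>\<^sup>+x. f (x + t) \<partial>lborel) = (\<integral>\<^sup>+x. f x \<partial>lborel)"
proof -
  have "(\<integral>\<^sup>+x. f x \<partial>lborel) = (\<integral>\<^sup>+x. f x \<partial>distr lborel borel (\<lambda>x. x + t))"
    by (simp add: lborel_translate)
  also have "\<dots> = (\<integral>\<^sup>+x. f (x + t) \<partial>lborel)" by (subst nn_integral_distr) auto
  finally show ?thesis ..
qed

text \<open>Uniqueness of Haar measure; this avoids the library's change of variables for linear maps, whose
  index type must be well-ordered.\<close>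

lemma translation_invariant_unique:
  fixes \<mu> :: "'a::euclidean_space measure"
  assumes sets[simp]: "sets \<mu> = sets borel" and sf: "sigma_finite_measure \<mu>"
    and inv: "\<And>f t. f \<in> borel_measurable borel \<Longrightarrow> (\<integral>\<^sup>+x. f (x + t) \<partial>\<mu>) = (\<integral>\<^sup>+x. f x \<partial>\<mu>)"
    and g[measurable]: "(g :: 'a \<Rightarrow> ennreal) \<in> borel_measurable borel"
    and f[measurable]: "(f :: 'a \<Rightarrow> ennreal) \<in> borel_measurable borel"
  shows "(\<integral>\<^sup>+x. f x \<partial>\<mu>) * (\<integral>\<^sup>+x. g x \<partial>lborel) = (\<integral>\<^sup>+x. f x \<partial>lborel) * (\<integral>\<^sup>+x. g (- x) \<partial>\<mu>)"
proof -
  interpret \<mu>: sigma_finite_measure \<mu> by fact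
  interpret P: pair_sigma_finite \<mu> lborel ..
  have [measurable_cong]: "sets \<mu> = sets borel" by simp
  have m: "(\<lambda>x. h x) \<in> borel_measurable \<mu>" if "h \<in> borel_measurable borel" for h :: "'a \<Rightarrow> ennreal"
    using that by simp
  \<comment> \<open>The double integral of f(x+y) g(y) is evaluated in both orders: the invariance
    of \<mu> splits it as written here, and the invariance of Lebesgue measure turns it into that of
    f(y) g(y-x), where \<mu> can be shifted once more.\<close>
  have "(\<integral>\<^sup>+x. f x \<partial>\<mu>) * (\<integral>\<^sup>+y. g y \<partial>lborel) = (\<integral>\<^sup>+y. (\<integral>\<^sup>+x. f (x + y) \<partial>\<mu>) * g y \<partial>lborel)"
    by (simp add: inv nn_integral_cmult)
  also have "\<dots> = (\<integral>\<^sup>+y. (\<integral>\<^sup>+x. f (x + y) * g y \<partial>\<mu>) \<partial>lborel)"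
    by (intro nn_integral_cong nn_integral_multc[symmetric]) simp
  also have "\<dots> = (\<integral>\<^sup>+x. (\<integral>\<^sup>+y. f (x + y) * g y \<partial>lborel) \<partial>\<mu>)"
    by (rule P.Fubini') simp
  also have "\<dots> = (\<integral>\<^sup>+x. (\<integral>\<^sup>+y. f y * g (y - x) \<partial>lborel) \<partial>\<mu>)"
  proof (rule nn_integral_cong)
    fix x
    have "(\<integral>\<^sup>+y. f y * g (y - x) \<partial>lborel) = (\<integral>\<^sup>+y. f (y + x) * g (y + x - x) \<partial>lborel)"
      by (rule nn_integral_translate[symmetric]) simp
    then show "(\<integral>\<^sup>+y. f (x + y) * g y \<partial>lborel) = (\<integral>\<^sup>+y. f y * g (y - x) \<partial>lborel)"
      by (simp add: add.commute)
  qed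
  also have "\<dots> = (\<integral>\<^sup>+y. (\<integral>\<^sup>+x. f y * g (y - x) \<partial>\<mu>) \<partial>lborel)"
    by (rule P.Fubini'[symmetric]) simp
  also have "\<dots> = (\<integral>\<^sup>+y. f y * (\<integral>\<^sup>+x. g (- x) \<partial>\<mu>) \<partial>lborel)"
  proof (rule nn_integral_cong)
    fix y
    have "(\<integral>\<^sup>+x. g (y - x) \<partial>\<mu>) = (\<integral>\<^sup>+x. g (y - (x + y)) \<partial>\<mu>)"
      by (rule inv[of "\<lambda>x. g (y - x)", symmetric]) simp
    then show "(\<integral>\<^sup>+x. f y * g (y - x) \<partial>\<mu>) = f y * (\<integral>\<^sup>+x. g (- x) \<partial>\<mu>)"
      by (simp add: nn_integral_cmult)
  qed
  also have "\<dots> = (\<integral>\<^sup>+x. f x \<partial>lborel) * (\<integral>\<^sup>+x. g (- x) \<partial>\<mu>)"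
    by (simp add: nn_integral_multc)
  finally show ?thesis .
qed

lemma matrix_vector_borel_measurable [measurable]:
  "(\<lambda>x. A *v x) \<in> borel_measurable (borel :: (real^'n) measure)"
  for A :: "real^'n^'m"
  by (intro borel_measurable_continuous_onI) (simp add: matrix_vector_mult_linear_continuous_on)

lemma matrix_inv_cancel:
  fixes A :: "real^'n^'n"
  assumes "invertible A"
  shows "A *v (matrix_inv A *v x) = x" "matrix_inv A *v (A *v x) = x"
  using someI_ex[OF assms[unfolded invertible_def]]
  by (simp_all add: matrix_inv_def matrix_vector_mul_assoc)

text \<open>The image measure is translation invariant and finite on bounded sets, hence a multiple
  of Lebesgue measure. Testing uniqueness with the indicator of \<open>cbox 0 One\<close> shows that
  the multiple is the mass of the reflected box; it is nonzero because the whole space has positive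
  mass. Its value 1/|det A| stays anonymous: later arguments read off only its sign.\<close>

lemma distr_lborel_linear:
  fixes A :: "real^'n^'n"
  assumes A: "invertible A"
  obtains c where "c > 0" "distr lborel borel ((*v) A) = density lborel (\<lambda>_. ennreal c)"
proof -
  let ?B = "matrix_inv A"
  let ?\<mu> = "distr lborel borel ((*v) A)"
  let ?c = "emeasure ?\<mu> (cbox (-One) 0)"
  have bl: "bounded_linear ((*v) ?B)" "bounded_linear ((*v) A)"
    by (simp_all add: matrix_vector_mul_bounded_linear)
  have vim: "(*v) A -` X = (*v) ?B ` X" for X
    using matrix_inv_cancel[OF A] by (auto simp: image_iff) metis
  have fin: "emeasure ?\<mu> X < \<infinity>" if "X \<in> sets borel" "bounded X" for X
    using that emeasure_bounded_finite[OF bounded_linear_image[OF that(2) bl(1)]]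
    by (subst emeasure_distr) (auto simp: vim)
  have inv: "(\<integral>\<^sup>+x. f (x + t) \<partial>?\<mu>) = (\<integral>\<^sup>+x. f x \<partial>?\<mu>)" if [measurable]: "f \<in> borel_measurable borel"
    for f :: "real^'n \<Rightarrow> ennreal" and t
  proof -
    have "(\<integral>\<^sup>+x. f (x + t) \<partial>?\<mu>) = (\<integral>\<^sup>+x. f (A *v (x + ?B *v t)) \<partial>lborel)"
      by (subst nn_integral_distr) (auto simp: matrix_vector_right_distrib matrix_inv_cancel[OF A])
    also have "\<dots> = (\<integral>\<^sup>+x. f (A *v x) \<partial>lborel)"
      by (rule nn_integral_translate) simp
    finally show ?thesis by (simp add: nn_integral_distr)
  qed
  have sf: "sigma_finite_measure ?\<mu>"
  proof
    show "\<exists>F. countable F \<and> F \<subseteq> sets ?\<mu> \<and> \<Union>F = space ?\<mu> \<and> (\<forall>a\<in>F. emeasure ?\<mu> a \<noteq> \<infinity>)"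
    proof (intro exI[of _ "range (\<lambda>n::nat. cball 0 (real n))"] conjI ballI)
      show "\<Union>(range (\<lambda>n. cball 0 (real n))) = space ?\<mu>"
        by (auto simp: real_arch_simple)
      show "emeasure ?\<mu> a \<noteq> \<infinity>" if "a \<in> range (\<lambda>n::nat. cball 0 (real n))" for a
      proof -
        have "a \<in> sets borel" "bounded a" using that by auto
        then show ?thesis using fin[of a] by simp
      qed
    qed auto
  qed
  have eq: "(\<integral>\<^sup>+x. f x \<partial>?\<mu>) = ?c * (\<integral>\<^sup>+x. f x \<partial>lborel)" if [measurable]: "f \<in> borel_measurable borel"
    for f :: "real^'n \<Rightarrow> ennreal"
  proof -
    have 1: "(\<integral>\<^sup>+x. indicator (cbox 0 One) x \<partial>(lborel :: (real^'n) measure)) = 1"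
      by (simp add: emeasure_lborel_cbox_eq)
    have 2: "(\<integral>\<^sup>+x. indicator (cbox 0 (One::real^'n)) (- x) \<partial>?\<mu>) = ?c"
    proof -
      have "indicator (cbox 0 (One::real^'n)) (- x) = (indicator (cbox (-One) 0) x :: ennreal)" for x
        by (auto simp: mem_box indicator_def minus_le_iff)
      then show ?thesis by simp
    qed
    show ?thesis
      using translation_invariant_unique[of ?\<mu> "indicator (cbox 0 One)" f, OF _ sf inv]
      by (simp add: 1 2 mult.commute)
  qed
  have c: "?c < \<infinity>" by (rule fin) auto
  have "?c \<noteq> 0"
  proof
    assume "?c = 0"
    then have "emeasure ?\<mu> UNIV = 0"
      using eq[of "indicator UNIV"] by simp
    then show False by (simp add: emeasure_distr)
  qed
  show thesis
  proof
    show "enn2real ?c > 0" using c \<open>?c \<noteq> 0\<close> by (simp add: enn2real_positive_iff zero_less_iff_neq_zero)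
    show "?\<mu> = density lborel (\<lambda>_. ennreal (enn2real ?c))"
    proof (rule measure_eqI)
      fix X assume "X \<in> sets ?\<mu>"
      then have [measurable]: "X \<in> sets borel" by simp
      show "emeasure ?\<mu> X = emeasure (density lborel (\<lambda>_. ennreal (enn2real ?c))) X"
        using eq[of "indicator X"] c by (simp add: emeasure_density nn_integral_cmult)
    qed simp
  qed
qed

lemma lborel_integral_linear:
  fixes A :: "real^'n^'n"
  assumes A: "invertible A"
  obtains c where "c > 0"
    "\<And>f :: real^'n \<Rightarrow> complex. integrable lborel f \<Longrightarrow> integrable lborel (\<lambda>x. f (A *v x))"
    "\<And>f :: real^'n \<Rightarrow> complex. integrable lborel f \<Longrightarrow> (LINT x|lborel. f (A *v x)) = c *\<^sub>R (LINT x|lborel. f x)"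
proof -
  obtain c where c: "c > 0" "distr lborel borel ((*v) A) = density lborel (\<lambda>_. ennreal c)"
    using distr_lborel_linear[OF A] by blast
  show thesis
  proof (rule that[OF c(1)])
    fix f :: "real^'n \<Rightarrow> complex" assume f: "integrable lborel f"
    then have [measurable]: "f \<in> borel_measurable borel" by simp
    have "integrable (distr lborel borel ((*v) A)) f"
      unfolding c(2) using f c(1) by (subst integrable_density) auto
    then show "integrable lborel (\<lambda>x. f (A *v x))"
      by (subst (asm) integrable_distr_eq) auto
    have "(LINT x|lborel. f (A *v x)) = (LINT x|distr lborel borel ((*v) A). f x)"
      by (subst integral_distr) auto
    also have "\<dots> = c *\<^sub>R (LINT x|lborel. f x)"
      unfolding c(2) using c(1) by (subst integral_density) auto
    finally show "(LINT x|lborel. f (A *v x)) = c *\<^sub>R (LINT x|lborel. f x)" .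
  qed
qed

text \<open>Fubini over the coordinates. \<open>lborel_eq\<close> presents Lebesgue measure as the
  image of a product indexed by basis vectors, whereas the factors are indexed by \<open>'n\<close>;
  the choice in \<open>?g\<close> inverts \<open>axis i 1\<close>.\<close>

lemma lborel_integral_prod:
  fixes f :: "'n::finite \<Rightarrow> real \<Rightarrow> complex"
  assumes f: "\<And>i. integrable lborel (f i)"
  shows "integrable lborel (\<lambda>x::real^'n. \<Prod>i\<in>UNIV. f i (x $ i))" (is ?A)
    and "(LINT x|lborel. (\<Prod>i\<in>UNIV. f i ((x::real^'n) $ i))) = (\<Prod>i\<in>UNIV. LINT x|lborel. f i x)" (is ?B)
proof -
  interpret product_sigma_finite "\<lambda>_. lborel :: real measure" ..
  let ?ax = "\<lambda>i::'n. axis i (1::real)"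
  let ?g = "\<lambda>b::real^'n. f (SOME i. b = ?ax i)"
  have B: "(Basis :: (real^'n) set) = range ?ax" by (auto simp: Basis_vec_def)
  have inj: "inj ?ax" by (auto simp: inj_on_def axis_eq_axis)
  have g: "?g (?ax i) = f i" for i
  proof -
    have "(SOME j. ?ax i = ?ax j) = i" by (rule some_equality) (auto simp: axis_eq_axis)
    then show ?thesis by simp
  qed
  let ?T = "\<lambda>h. \<Sum>b\<in>(Basis :: (real^'n) set). h b *\<^sub>R b"
  have [measurable]: "f i \<in> borel_measurable borel" for i using f[of i] by simp
  have cm: "?T h $ i = h (?ax i)" for h i
    unfolding B by (subst sum.reindex[OF inj]) (simp add: axis_def if_distrib cong: if_cong)
  have eq: "(\<Prod>i\<in>UNIV. f i (?T h $ i)) = (\<Prod>b\<in>Basis. ?g b (h b))" for h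
    by (simp only: cm) (simp add: B prod.reindex[OF inj] g)
  have gi: "integrable lborel (?g b)" if "b \<in> Basis" for b
    using that f by auto
  have mT: "?T \<in> measurable (Pi\<^sub>M Basis (\<lambda>_. lborel)) borel" by simp
  have mf: "(\<lambda>x::real^'n. \<Prod>i\<in>UNIV. f i (x $ i)) \<in> borel_measurable borel" by simp
  show ?A
    by (subst lborel_eq, subst integrable_distr_eq[OF mT mf], subst eq)
      (rule product_integrable_prod[OF _ gi], auto)
  have "(LINT x|lborel. (\<Prod>i\<in>UNIV. f i ((x::real^'n) $ i))) =
      (\<Prod>b\<in>Basis. LINT x|lborel. ?g b x)"
    by (subst lborel_eq, subst integral_distr[OF mT mf], subst eq)
      (rule product_integral_prod[OF _ gi], auto)
  also have "\<dots> = (\<Prod>i\<in>UNIV. LINT x|lborel. f i x)"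
    unfolding B by (simp add: prod.reindex[OF inj] g)
  finally show ?B .
qed

text \<open>The characteristic function of the standard normal law, rescaled: y = sqrt(2 pi) x turns
  exp(-y^2/2) into exp(-pi x^2) and absorbs the factor 1/sqrt(2 pi).\<close>

lemma gaussian_fourier_real:
  fixes u :: real
  shows "integrable lborel (\<lambda>x. complex_of_real (exp (- pi * x^2)) * cis (2 * pi * (x * u)))" (is ?A)
    and "(LINT x|lborel. complex_of_real (exp (- pi * x^2)) * cis (2 * pi * (x * u))) = exp (- pi * u^2)" (is ?B)
proof -
  let ?s = "sqrt (2 * pi)"
  let ?f = "\<lambda>y. std_normal_density y *\<^sub>R cis (?s * u * y)"
  have s: "?s > 0" by simp
  have "char std_normal_distribution (?s * u) = complex_of_real (exp (- ((?s * u)^2) / 2))"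
    by (simp add: char_std_normal_distribution)
  also have "char std_normal_distribution (?s * u) = (LINT y|lborel. ?f y)"
    unfolding char_def by (subst integral_density) (auto simp: normal_density_nonneg cis_conv_exp)
  finally have 1: "(LINT y|lborel. ?f y) = exp (- pi * u^2)"
    by (simp add: power_mult_distrib mult.commute)
  have eq: "?f (0 + ?s * x) = (1 / ?s) *\<^sub>R (complex_of_real (exp (- pi * x^2)) * cis (2 * pi * (x * u)))" for x
  proof -
    have "?s * u * (?s * x) = (?s * ?s) * u * x" by (simp add: mult_ac del: real_sqrt_mult_self)
    then have "?s * u * (?s * x) = 2 * pi * (x * u)" by simp
    then show ?thesis
      by (simp add: std_normal_density_def power_mult_distrib scaleR_conv_of_real mult_ac)
  qed
  have [measurable]: "cis \<in> borel_measurable borel"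
    by (intro borel_measurable_continuous_onI continuous_on_cis continuous_on_id)
  have i: "integrable lborel ?f"
  proof (rule Bochner_Integration.integrable_bound)
    show "integrable lborel std_normal_density" by simp
  qed (auto simp: normal_density_nonneg)
  have "integrable lborel (\<lambda>x. ?f (0 + ?s * x))"
    by (rule lborel_integrable_real_affine[OF i]) simp
  then have i2: "integrable lborel (\<lambda>x. (1 / ?s) *\<^sub>R (complex_of_real (exp (- pi * x^2)) * cis (2 * pi * (x * u))))"
    unfolding eq .
  then show ?A using integrable_scaleR_right[OF i2, of ?s] by simp
  have "(LINT y|lborel. ?f y) = \<bar>?s\<bar> *\<^sub>R (LINT x|lborel. ?f (0 + ?s * x))"
    by (rule lborel_integral_real_affine) simp
  also have "\<dots> = (LINT x|lborel. complex_of_real (exp (- pi * x^2)) * cis (2 * pi * (x * u)))"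
    unfolding eq by simp
  finally show ?B using 1 by simp
qed

text \<open>This is exp(-pi |x|^2), written as a product so that its transform factorizes over the
  coordinates.\<close>

definition gaussian :: "real^'n \<Rightarrow> real" where
  "gaussian x = (\<Prod>i\<in>UNIV. exp (- pi * (x $ i)^2))"

lemma cis_inner: "cis (2 * pi * (x \<bullet> y)) = (\<Prod>i\<in>UNIV. cis (2 * pi * (x $ i * y $ i)))"
  for x y :: "real^'n"
  by (simp add: inner_vec_def cis_conv_exp sum_distrib_left exp_sum)

lemma gaussian_self_dual:
  fixes u :: "real^'n"
  shows "integrable lborel (\<lambda>x::real^'n. complex_of_real (gaussian x) * cis (2 * pi * (x \<bullet> u)))" (is ?A)
    and "(LINT x|lborel. complex_of_real (gaussian x) * cis (2 * pi * (x \<bullet> u))) = gaussian u" (is ?B)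
proof -
  have eq: "complex_of_real (gaussian x) * cis (2 * pi * (x \<bullet> u)) =
    (\<Prod>i\<in>UNIV. complex_of_real (exp (- pi * (x $ i)^2)) * cis (2 * pi * (x $ i * u $ i)))" for x :: "real^'n"
    by (simp add: gaussian_def cis_inner prod.distrib)
  note * = lborel_integral_prod[where f="\<lambda>i y. complex_of_real (exp (- pi * y^2)) * cis (2 * pi * (y * u $ i))",
      OF gaussian_fourier_real(1)]
  show ?A unfolding eq by (rule *)
  show ?B unfolding eq *(2) gaussian_fourier_real(2) by (simp add: gaussian_def)
qed

section \<open>Fourier inversion\<close>

lemma cis_borel_measurable [measurable]:
  "f \<in> borel_measurable M \<Longrightarrow> (\<lambda>x. cis (f x)) \<in> borel_measurable M"
  by (rule measurable_compose[where g=cis and N=borel])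
    (auto intro!: borel_measurable_continuous_onI continuous_on_cis continuous_on_id)

lemma integrable_mult_bounded:
  fixes f g :: "'a \<Rightarrow> complex"
  assumes f: "integrable M f" and g: "g \<in> borel_measurable M" and b: "\<And>x. norm (g x) \<le> B"
  shows "integrable M (\<lambda>x. f x * g x)" "integrable M (\<lambda>x. g x * f x)"
proof -
  show 1: "integrable M (\<lambda>x. f x * g x)"
  proof (rule Bochner_Integration.integrable_bound)
    show "integrable M (\<lambda>x. B *\<^sub>R norm (f x))" using f by simp
    show "(\<lambda>x. f x * g x) \<in> borel_measurable M" using f g by simp
    show "AE x in M. norm (f x * g x) \<le> norm (B *\<^sub>R norm (f x))"
    proof (rule AE_I2)
      fix x show "norm (f x * g x) \<le> norm (B *\<^sub>R norm (f x))"
        using mult_left_mono[OF b[of x] norm_ge_zero[of "f x"]] b[of x] norm_ge_zero[of "g x"]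
        by (simp add: norm_mult mult.commute)
    qed
  qed
  then show "integrable M (\<lambda>x. g x * f x)" by (simp add: mult.commute)
qed

lemma integrable_mult_cis [simp, intro]:
  fixes f :: "real^'n \<Rightarrow> complex"
  assumes f: "integrable lborel f"
  shows "integrable lborel (\<lambda>x. f x * cis (a * (x \<bullet> u)))" "integrable lborel (\<lambda>x. f x * cis (a * (u \<bullet> x)))"
  by (rule integrable_mult_bounded[OF f, where B=1], simp_all)+

lemma fourier_eq_inv: "fourier f \<xi> = inv_fourier f (- \<xi>)"
  by (simp add: fourier_def inv_fourier_def inner_commute)

lemma norm_inv_fourier_le:
  fixes f :: "real^'n \<Rightarrow> complex"
  shows "norm (inv_fourier f x) \<le> (LINT \<xi>|lborel. norm (f \<xi>))"
  unfolding inv_fourier_def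
  by (rule integral_norm_bound[THEN order_trans]) (simp add: norm_mult)

lemma tendsto_inv_fourier:
  fixes f :: "real^'n \<Rightarrow> complex"
  assumes f: "integrable lborel f" and u: "u \<longlonglongrightarrow> x"
  shows "(\<lambda>n. inv_fourier f (u n)) \<longlonglongrightarrow> inv_fourier f x"
  unfolding inv_fourier_def
proof (rule integral_dominated_convergence[where w="\<lambda>\<xi>. norm (f \<xi>)"])
  have m[measurable]: "f \<in> borel_measurable borel" using f by simp
  show "(\<lambda>\<xi>. f \<xi> * cis (2 * pi * (u n \<bullet> \<xi>))) \<in> borel_measurable lborel" for n by simp
  show "AE \<xi> in lborel. (\<lambda>n. f \<xi> * cis (2 * pi * (u n \<bullet> \<xi>))) \<longlonglongrightarrow> f \<xi> * cis (2 * pi * (x \<bullet> \<xi>))"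
    using u by (intro AE_I2 tendsto_intros)
qed (use f in \<open>auto simp: norm_mult\<close>)

lemma continuous_inv_fourier:
  fixes f :: "real^'n \<Rightarrow> complex"
  assumes f: "integrable lborel f"
  shows "continuous_on S (inv_fourier f)"
  unfolding continuous_on_sequentially comp_def using tendsto_inv_fourier[OF f] by blast

lemma continuous_fourier:
  fixes f :: "real^'n \<Rightarrow> complex"
  assumes f: "integrable lborel f"
  shows "continuous_on S (fourier f)"
  unfolding fourier_eq_inv
  by (rule continuous_on_compose2[OF continuous_inv_fourier[OF f, of UNIV]]) (auto intro: continuous_intros)

text \<open>Fubini, as the kernel has modulus one. Every later passage between the space side and
  the frequency side goes through this formula.\<close>

lemma fourier_multiplication_formula:
  fixes f g :: "real^'n \<Rightarrow> complex"
  assumes f: "integrable lborel f" and g: "integrable lborel g"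
  shows "(LINT x|lborel. inv_fourier f x * g x) = (LINT \<xi>|lborel. f \<xi> * inv_fourier g \<xi>)"
proof -
  have [measurable]: "f \<in> borel_measurable borel" "g \<in> borel_measurable borel" using f g by auto
  have int: "integrable (lborel \<Otimes>\<^sub>M lborel) (\<lambda>(\<xi>, x). f \<xi> * g x * cis (2 * pi * (x \<bullet> \<xi>)))"
  proof (rule lborel_pair.Fubini_integrable)
    show "AE \<xi> in lborel. integrable lborel (\<lambda>x. case (\<xi>, x) of (\<xi>, x) \<Rightarrow> f \<xi> * g x * cis (2 * pi * (x \<bullet> \<xi>)))"
      using integrable_mult_cis(1)[OF g, of "2 * pi"]
      by (intro AE_I2) (simp add: mult.assoc[of "f _"])
    have "(\<lambda>\<xi>. LINT x|lborel. norm (f \<xi> * g x * cis (2 * pi * (x \<bullet> \<xi>)))) =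
      (\<lambda>\<xi>. norm (f \<xi>) * (LINT x|lborel. norm (g x)))"
      by (simp add: norm_mult)
    then show "integrable lborel (\<lambda>\<xi>. LINT x|lborel. norm (case (\<xi>, x) of (\<xi>, x) \<Rightarrow> f \<xi> * g x * cis (2 * pi * (x \<bullet> \<xi>))))"
      using f by simp
  qed simp
  have "(LINT x|lborel. inv_fourier f x * g x) =
    (LINT x|lborel. LINT \<xi>|lborel. f \<xi> * g x * cis (2 * pi * (x \<bullet> \<xi>)))"
    unfolding inv_fourier_def
    by (subst integral_mult_left_zero[symmetric]) (simp add: mult.assoc mult.commute[of "g _"])
  also have "\<dots> = (LINT \<xi>|lborel. LINT x|lborel. f \<xi> * g x * cis (2 * pi * (x \<bullet> \<xi>)))"
    by (rule lborel_pair.Fubini_integral[OF int])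
  also have "\<dots> = (LINT \<xi>|lborel. f \<xi> * inv_fourier g \<xi>)"
    unfolding inv_fourier_def by (simp add: mult.assoc inner_commute)
  finally show ?thesis .
qed

lemma gaussian_bounds: "0 \<le> gaussian x" "gaussian x \<le> 1"
  unfolding gaussian_def by (auto intro!: prod_nonneg prod_le_1)

lemma gaussian_0: "gaussian 0 = 1"
  by (simp add: gaussian_def)

lemma continuous_gaussian: "continuous_on S gaussian"
  unfolding gaussian_def[abs_def] by (intro continuous_intros)

lemma gaussian_measurable [measurable]: "gaussian \<in> borel_measurable borel"
  by (intro borel_measurable_continuous_onI continuous_gaussian)

lemma gaussian_integral:
  "integrable lborel (\<lambda>x::real^'n. complex_of_real (gaussian x))"
  "(LINT x|lborel. complex_of_real (gaussian (x::real^'n))) = 1"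
  using gaussian_self_dual[of "0::real^'n"] by (simp_all add: gaussian_0)

text \<open>Gaussian summability. \<open>A n\<close> damps the inversion integral by a wide
  Gaussian. As the damping disappears, dominated convergence gives the left side; the multiplication
  formula rewrites \<open>A n\<close> as an average of \<open>v\<close> over a Gaussian shrinking to
  \<xi>, which tends to \<open>v \<xi>\<close> by continuity.\<close>

lemma fourier_inversion:
  fixes v :: "real^'n \<Rightarrow> complex"
  assumes v: "integrable lborel v" and c: "continuous_on UNIV v" and b: "\<And>x. norm (v x) \<le> B"
    and V: "integrable lborel (inv_fourier v)"
  shows "fourier (inv_fourier v) \<xi> = v \<xi>"
proof -
  have [measurable]: "v \<in> borel_measurable borel" "inv_fourier v \<in> borel_measurable borel"
    using v V by auto
  define \<epsilon> where "\<epsilon> n = 1 / real (Suc n)" for n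
  have e: "\<epsilon> n > 0" for n by (simp add: \<epsilon>_def)
  have e0: "\<epsilon> \<longlonglongrightarrow> 0" unfolding \<epsilon>_def[abs_def] by (rule LIMSEQ_Suc, rule lim_1_over_n)
  define g where "g n x = complex_of_real (gaussian (\<epsilon> n *\<^sub>R x)) * cis (2 * pi * (x \<bullet> (-\<xi>)))" for n and x :: "real^'n"
  define A where "A n = (LINT x|lborel. inv_fourier v x * g n x)" for n
  have gi: "integrable lborel (g n)" for n
  proof -
    have "integrable lborel (\<lambda>x::real^'n. complex_of_real (gaussian (0 + \<epsilon> n *\<^sub>R x)))"
      using gaussian_integral(1) e[of n] by (subst lborel_integrable_affine_iff) auto
    then show ?thesis unfolding g_def by (intro integrable_mult_cis) simp
  qed
  have g_inv: "inv_fourier (g n) t = (1 / \<epsilon> n)^CARD('n) *\<^sub>R complex_of_real (gaussian ((1 / \<epsilon> n) *\<^sub>R (t - \<xi>)))" for n t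
  proof -
    let ?u = "(1 / \<epsilon> n) *\<^sub>R (t - \<xi>)"
    have 1: "g n x * cis (2 * pi * (t \<bullet> x)) =
        complex_of_real (gaussian (0 + \<epsilon> n *\<^sub>R x)) * cis (2 * pi * ((0 + \<epsilon> n *\<^sub>R x) \<bullet> ?u))" for x
      using e[of n] by (simp add: g_def cis_mult inner_diff_right inner_commute algebra_simps)
    have "gaussian ?u = (LINT x|lborel. complex_of_real (gaussian x) * cis (2 * pi * (x \<bullet> ?u)))"
      by (rule gaussian_self_dual(2)[symmetric])
    also have "\<dots> = \<bar>\<epsilon> n\<bar>^CARD('n) *\<^sub>R inv_fourier (g n) t"
      unfolding inv_fourier_def 1
      using lborel_integral_affine(2)[of "\<epsilon> n" "\<lambda>x::real^'n. complex_of_real (gaussian x) * cis (2 * pi * (x \<bullet> ?u))" 0] e[of n]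
      by simp
    finally show ?thesis using e[of n] by (simp add: power_one_over)
  qed
  have "A \<longlonglongrightarrow> (LINT x|lborel. inv_fourier v x * cis (2 * pi * (x \<bullet> (-\<xi>))))"
    unfolding A_def[abs_def]
  proof (rule integral_dominated_convergence[where w="\<lambda>x. norm (inv_fourier v x)"])
    show "AE x in lborel. (\<lambda>n. inv_fourier v x * g n x) \<longlonglongrightarrow> inv_fourier v x * cis (2 * pi * (x \<bullet> - \<xi>))"
    proof (rule AE_I2)
      fix x :: "real^'n"
      have "(\<lambda>n. \<epsilon> n *\<^sub>R x) \<longlonglongrightarrow> 0 *\<^sub>R x" using e0 by (intro tendsto_intros)
      then have "(\<lambda>n. gaussian (\<epsilon> n *\<^sub>R x)) \<longlonglongrightarrow> gaussian (0 *\<^sub>R x)"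
        by (intro continuous_on_tendsto_compose[OF continuous_gaussian[of UNIV]]) auto
      then have "(\<lambda>n. inv_fourier v x * g n x) \<longlonglongrightarrow> inv_fourier v x * (complex_of_real 1 * cis (2 * pi * (x \<bullet> - \<xi>)))"
        unfolding g_def by (intro tendsto_intros) (simp add: gaussian_0)
      then show "(\<lambda>n. inv_fourier v x * g n x) \<longlonglongrightarrow> inv_fourier v x * cis (2 * pi * (x \<bullet> - \<xi>))" by simp
    qed
    show "AE x in lborel. norm (inv_fourier v x * g n x) \<le> norm (inv_fourier v x)" for n
      by (intro AE_I2) (simp add: norm_mult g_def abs_of_nonneg mult_left_le gaussian_bounds)
    show "integrable lborel (\<lambda>x. norm (inv_fourier v x))" using V by simp
    show "(\<lambda>x. inv_fourier v x * g n x) \<in> borel_measurable lborel" for n unfolding g_def by simp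
  qed simp
  then have 1: "A \<longlonglongrightarrow> fourier (inv_fourier v) \<xi>"
    by (simp add: fourier_def)
  have A: "A n = (LINT s|lborel. v (\<xi> + \<epsilon> n *\<^sub>R s) * complex_of_real (gaussian s))" for n
  proof -
    have "A n = (LINT t|lborel. v t * inv_fourier (g n) t)"
      unfolding A_def by (rule fourier_multiplication_formula[OF v gi])
    also have "\<dots> = \<bar>\<epsilon> n\<bar>^CARD('n) *\<^sub>R (LINT s|lborel. v (\<xi> + \<epsilon> n *\<^sub>R s) * inv_fourier (g n) (\<xi> + \<epsilon> n *\<^sub>R s))"
      using e[of n] lborel_integral_affine(2)[of "\<epsilon> n" "\<lambda>t. v t * inv_fourier (g n) t" \<xi>] by simp
    also have "\<dots> = (LINT s|lborel. v (\<xi> + \<epsilon> n *\<^sub>R s) * complex_of_real (gaussian s))"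
      unfolding g_inv using e[of n] by (simp add: power_one_over)
    finally show ?thesis .
  qed
  have "A \<longlonglongrightarrow> (LINT s|lborel. v \<xi> * complex_of_real (gaussian (s::real^'n)))"
    unfolding A
  proof (rule integral_dominated_convergence[where w="\<lambda>s::real^'n. B * norm (complex_of_real (gaussian s))"])
    show "AE s in lborel. (\<lambda>n. v (\<xi> + \<epsilon> n *\<^sub>R s) * complex_of_real (gaussian s)) \<longlonglongrightarrow> v \<xi> * complex_of_real (gaussian s)"
    proof (rule AE_I2)
      fix s :: "real^'n"
      have "(\<lambda>n. \<xi> + \<epsilon> n *\<^sub>R s) \<longlonglongrightarrow> \<xi> + 0 *\<^sub>R s" using e0 by (intro tendsto_intros)
      then have "(\<lambda>n. v (\<xi> + \<epsilon> n *\<^sub>R s)) \<longlonglongrightarrow> v (\<xi> + 0 *\<^sub>R s)"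
        by (intro continuous_on_tendsto_compose[OF c]) auto
      then show "(\<lambda>n. v (\<xi> + \<epsilon> n *\<^sub>R s) * complex_of_real (gaussian s)) \<longlonglongrightarrow> v \<xi> * complex_of_real (gaussian s)"
        by (intro tendsto_intros) simp
    qed
    show "integrable lborel (\<lambda>s::real^'n. B * norm (complex_of_real (gaussian s)))"
      using integrable_norm[OF gaussian_integral(1)] by (intro integrable_mult_right)
    show "AE x in lborel. norm (v (\<xi> + \<epsilon> n *\<^sub>R x) * complex_of_real (gaussian x)) \<le> B * norm (complex_of_real (gaussian x))" for n
      by (intro AE_I2) (simp only: norm_mult, intro mult_right_mono b norm_ge_zero)
  qed simp_all
  then have "A \<longlonglongrightarrow> v \<xi>"
    by (simp only: integral_mult_right_zero gaussian_integral(2) mult_1_right)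
  with 1 show ?thesis by (rule LIMSEQ_unique)
qed

text \<open>Reflection of the frequency variable exchanges the two transforms.\<close>

lemma inv_fourier_fourier:
  fixes v :: "real^'n \<Rightarrow> complex"
  assumes v: "integrable lborel v" and c: "continuous_on UNIV v" and b: "\<And>x. norm (v x) \<le> B"
    and V: "integrable lborel (fourier v)"
  shows "inv_fourier (fourier v) x = v x"
proof -
  have refl: "integrable lborel (\<lambda>\<xi>. f (- \<xi>)) = integrable lborel f"
    "(LINT \<xi>|lborel. f \<xi>) = (LINT \<xi>|lborel. f (- \<xi>))" for f :: "real^'n \<Rightarrow> complex"
    using lborel_integrable_affine_iff[of "-1" f 0] lborel_integral_affine(2)[of "-1" f 0] by simp_all
  have V': "integrable lborel (inv_fourier v)"
    using V refl(1)[of "inv_fourier v"] by (simp add: fourier_eq_inv[abs_def])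
  have "inv_fourier (fourier v) x = fourier (inv_fourier v) x"
    unfolding inv_fourier_def[of "fourier v"] fourier_eq_inv[of v] fourier_def[of "inv_fourier v"]
    by (subst refl(2)) (simp add: inner_commute)
  then show ?thesis using fourier_inversion[OF v c b V'] by simp
qed

section \<open>Test functions\<close>

lemma cnj_borel_measurable [measurable]:
  "f \<in> borel_measurable M \<Longrightarrow> (\<lambda>x. cnj (f x)) \<in> borel_measurable M"
  by (rule measurable_compose[where g=cnj and N=borel])
    (auto intro!: borel_measurable_continuous_onI continuous_on_cnj continuous_on_id)

lemma partial_derivI:
  "(f has_derivative f') (at x) \<Longrightarrow> partial_deriv i f x = f' (axis i 1)"
  by (simp add: partial_deriv_def frechet_derivative_at[symmetric])

lemma iter_partial_Nil [simp]: "iter_partial [] f = f"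
  and iter_partial_Cons [simp]: "iter_partial (i # is) f = iter_partial is (partial_deriv i f)"
  by (simp_all add: iter_partial_def)

lemma smooth_differentiable: "smooth f \<Longrightarrow> f differentiable (at x)"
  unfolding smooth_def by (metis iter_partial_Nil)

lemma smooth_has_derivative: "smooth f \<Longrightarrow> (f has_derivative frechet_derivative f (at x)) (at x)"
  using smooth_differentiable frechet_derivative_works by blast

lemma smooth_partial_deriv: "smooth f \<Longrightarrow> smooth (partial_deriv i f)"
  unfolding smooth_def by (metis iter_partial_Cons)

lemma smooth_continuous: "smooth f \<Longrightarrow> continuous_on S f"
  by (meson smooth_differentiable differentiable_imp_continuous_within continuous_at_imp_continuous_on)

section \<open>Smoothness of rescaled products\<close>

lemma smooth_coinduct:
  assumes "P f" and "\<And>g x. P g \<Longrightarrow> g differentiable (at x)" and "\<And>g i. P g \<Longrightarrow> P (partial_deriv i g)"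
  shows "smooth f"
proof -
  have "P (iter_partial is f)" for "is"
    using assms(1) by (induction "is" arbitrary: f) (auto intro: assms(3))
  then show ?thesis unfolding smooth_def using assms(2) by blast
qed

text \<open>A class that contains the rescaled cut-off and its powers and is stable under partial
  derivatives: the chain rule calls for scalar multiples, the product rule for sums and products. By
  \<open>smooth_coinduct\<close> such a class consists of smooth functions.\<close>

inductive smooth_algebra :: "(real^'n \<Rightarrow> complex) \<Rightarrow> bool" where
  base: "smooth f \<Longrightarrow> smooth_algebra (\<lambda>x. complex_of_real (f (b + a *\<^sub>R x)))"
| cmult: "smooth_algebra f \<Longrightarrow> smooth_algebra (\<lambda>x. c * f x)"
| add: "smooth_algebra f \<Longrightarrow> smooth_algebra g \<Longrightarrow> smooth_algebra (\<lambda>x. f x + g x)"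
| mult: "smooth_algebra f \<Longrightarrow> smooth_algebra g \<Longrightarrow> smooth_algebra (\<lambda>x. f x * g x)"

lemma smooth_algebra_step:
  "smooth_algebra f \<Longrightarrow> (\<forall>x. f differentiable (at x)) \<and> (\<forall>i. smooth_algebra (partial_deriv i f))"
proof (induction rule: smooth_algebra.induct)
  case (base f b a)
  let ?g = "\<lambda>x. complex_of_real (f (b + a *\<^sub>R x))"
  have d: "(?g has_derivative (\<lambda>h. complex_of_real (frechet_derivative f (at (b + a *\<^sub>R x)) (a *\<^sub>R h)))) (at x)" for x
    by (intro has_derivative_of_real has_derivative_compose[OF _ smooth_has_derivative[OF base]])
      (auto intro!: derivative_eq_intros)
  have "partial_deriv i ?g = (\<lambda>x. complex_of_real a * complex_of_real (partial_deriv i f (b + a *\<^sub>R x)))" for i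
  proof
    fix x
    have "linear (frechet_derivative f (at (b + a *\<^sub>R x)))"
      using smooth_has_derivative[OF base] has_derivative_linear by blast
    then show "partial_deriv i ?g x = complex_of_real a * complex_of_real (partial_deriv i f (b + a *\<^sub>R x))"
      by (simp add: partial_derivI[OF d] linear_scale) (simp add: partial_deriv_def)
  qed
  then show ?case
    using d smooth_algebra.cmult[OF smooth_algebra.base[OF smooth_partial_deriv[OF base]]]
    by (auto simp: differentiable_def)
next
  case (cmult f c)
  have d: "(f has_derivative frechet_derivative f (at x)) (at x)" for x
    using cmult frechet_derivative_works by blast
  have d': "((\<lambda>x. c * f x) has_derivative (\<lambda>h. c * frechet_derivative f (at x) h)) (at x)" for x
    by (intro has_derivative_mult_right d)
  have "partial_deriv i (\<lambda>x. c * f x) = (\<lambda>x. c * partial_deriv i f x)" for i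
    by (rule ext) (simp add: partial_derivI[OF d'], simp add: partial_deriv_def)
  then show ?case using d' cmult by (auto simp: differentiable_def intro: smooth_algebra.cmult)
next
  case (add f g)
  have d: "(f has_derivative frechet_derivative f (at x)) (at x)" "(g has_derivative frechet_derivative g (at x)) (at x)" for x
    using add frechet_derivative_works by blast+
  have d': "((\<lambda>x. f x + g x) has_derivative (\<lambda>h. frechet_derivative f (at x) h + frechet_derivative g (at x) h)) (at x)" for x
    by (intro has_derivative_add d)
  have "partial_deriv i (\<lambda>x. f x + g x) = (\<lambda>x. partial_deriv i f x + partial_deriv i g x)" for i
    by (rule ext) (simp add: partial_derivI[OF d'], simp add: partial_deriv_def)
  then show ?case using d' add by (auto simp: differentiable_def intro: smooth_algebra.add)
next
  case (mult f g)
  have d: "(f has_derivative frechet_derivative f (at x)) (at x)" "(g has_derivative frechet_derivative g (at x)) (at x)" for x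
    using mult frechet_derivative_works by blast+
  have d': "((\<lambda>x. f x * g x) has_derivative (\<lambda>h. f x * frechet_derivative g (at x) h + frechet_derivative f (at x) h * g x)) (at x)" for x
    by (intro has_derivative_mult d)
  have "partial_deriv i (\<lambda>x. f x * g x) = (\<lambda>x. f x * partial_deriv i g x + partial_deriv i f x * g x)" for i
    by (rule ext) (simp add: partial_derivI[OF d'], simp add: partial_deriv_def)
  then have "smooth_algebra (partial_deriv i (\<lambda>x. f x * g x))" for i
    using smooth_algebra.add[OF smooth_algebra.mult smooth_algebra.mult] mult by metis
  then show ?case using d' by (auto simp: differentiable_def)
qed

lemma smooth_algebra_smooth: "smooth_algebra f \<Longrightarrow> smooth f"
  by (rule smooth_coinduct[where P=smooth_algebra]) (use smooth_algebra_step in auto)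

section \<open>Compactly supported smooth functions\<close>

definition test_function :: "(real^'n \<Rightarrow> complex) \<Rightarrow> bool" where
  "test_function f \<longleftrightarrow> smooth f \<and> compact (fun_support f)"

lemma fun_support_zero: "x \<notin> fun_support f \<Longrightarrow> f x = 0"
  using closure_subset[of "{x. f x \<noteq> 0}"] by (auto simp: fun_support_def)

lemma closed_fun_support: "closed (fun_support f)"
  by (simp add: fun_support_def)

lemma fun_support_subset: "closed K \<Longrightarrow> (\<And>x. x \<notin> K \<Longrightarrow> f x = 0) \<Longrightarrow> fun_support f \<subseteq> K"
  unfolding fun_support_def by (rule closure_minimal) auto

lemma compact_fun_support_subset:
  "compact K \<Longrightarrow> fun_support f \<subseteq> K \<Longrightarrow> compact (fun_support f)"
  using compact_Int_closed[of K "fun_support f"] closed_fun_support[of f] by (simp add: Int_absorb1)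

lemma partial_deriv_support: "fun_support (partial_deriv i f) \<subseteq> fun_support f"
proof (rule fun_support_subset[OF closed_fun_support])
  fix x assume x: "x \<notin> fun_support f"
  have "(f has_derivative (\<lambda>h. 0)) (at x)"
  proof (rule has_derivative_transform_within_open)
    show "((\<lambda>_. 0) has_derivative (\<lambda>h. 0)) (at x)" by simp
    show "open (- fun_support f)" by (simp add: closed_fun_support open_Compl)
  qed (use x in \<open>auto simp: fun_support_zero\<close>)
  then show "partial_deriv i f x = 0" by (simp add: partial_derivI)
qed

lemma test_function_partial_deriv: "test_function f \<Longrightarrow> test_function (partial_deriv i f)"
  unfolding test_function_def
  using compact_fun_support_subset[OF _ partial_deriv_support[of _ f]] smooth_partial_deriv[of f] by simp

lemma test_function_iter_partial: "test_function f \<Longrightarrow> test_function (iter_partial is f)"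
  by (induction "is" arbitrary: f) (auto intro: test_function_partial_deriv)

lemma continuous_compact_support_bounded:
  assumes "continuous_on UNIV f" "compact (fun_support f)"
  obtains B where "\<And>x. norm (f x) \<le> B" "B \<ge> 0"
proof -
  have "bounded (f ` fun_support f)"
    using assms by (meson compact_continuous_image compact_imp_bounded continuous_on_subset top_greatest)
  then obtain B where B: "\<And>x. x \<in> fun_support f \<Longrightarrow> norm (f x) \<le> B"
    unfolding bounded_iff by auto
  show thesis
  proof (rule that[of "max B 0"])
    fix x show "norm (f x) \<le> max B 0"
      by (cases "x \<in> fun_support f") (use B[of x] in \<open>auto simp: fun_support_zero\<close>)
  qed simp
qed

lemma test_function_schwartz:
  fixes f :: "real^'n \<Rightarrow> complex"
  assumes f: "test_function f"
  shows "f \<in> schwartz"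
proof -
  have "bounded (range (\<lambda>x. (1 + norm x) ^ N *\<^sub>R iter_partial is f x))" for N "is"
  proof -
    let ?g = "iter_partial is f" let ?h = "\<lambda>x. (1 + norm x) ^ N *\<^sub>R ?g x"
    have g: "test_function ?g" by (rule test_function_iter_partial[OF f])
    then have c: "continuous_on UNIV ?h"
      by (intro continuous_intros smooth_continuous) (simp add: test_function_def)
    have "fun_support ?h \<subseteq> fun_support ?g"
      by (rule fun_support_subset[OF closed_fun_support]) (simp add: fun_support_zero)
    then have "compact (fun_support ?h)"
      using g compact_fun_support_subset by (auto simp: test_function_def)
    then obtain B where "\<And>x. norm (?h x) \<le> B" using continuous_compact_support_bounded[OF c] by blast
    then show ?thesis unfolding bounded_iff by auto
  qed
  then show ?thesis using f by (simp add: schwartz_def test_function_def)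
qed

lemma continuous_compact_support_integrable:
  fixes f :: "real^'n \<Rightarrow> complex"
  assumes c: "continuous_on UNIV f" and s: "compact (fun_support f)"
  shows "integrable lborel f"
proof -
  obtain B where B: "\<And>x. norm (f x) \<le> B" "B \<ge> 0" using continuous_compact_support_bounded[OF assms] by blast
  have [measurable]: "f \<in> borel_measurable borel" using c by (rule borel_measurable_continuous_onI)
  have m[measurable]: "fun_support f \<in> sets borel" by (simp add: closed_fun_support)
  show ?thesis
  proof (rule Bochner_Integration.integrable_bound)
    show "integrable lborel (\<lambda>x. B * indicator (fun_support f) x)"
      using emeasure_compact_finite[OF s] by (simp add: integrable_indicator_iff)
    show "AE x in lborel. norm (f x) \<le> norm (B * indicator (fun_support f) x :: real)"
      using B by (auto simp: indicator_def fun_support_zero)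
  qed simp
qed

lemma test_function_integrable: "test_function f \<Longrightarrow> integrable lborel f"
  unfolding test_function_def by (blast intro: continuous_compact_support_integrable smooth_continuous)

text \<open>The difference quotients in direction i have integral zero by translation invariance and
  converge to the partial derivative. The mean value inequality bounds them by \<open>B\<close> on a
  fixed compact set, so the limit may be taken under the integral.\<close>

lemma integral_partial_deriv_zero:
  fixes g :: "real^'n \<Rightarrow> complex"
  assumes d: "\<And>x. g differentiable (at x)" and s: "compact (fun_support g)"
    and c: "continuous_on UNIV (partial_deriv i g)"
  shows "(LINT x|lborel. partial_deriv i g x) = 0"
proof -
  let ?e = "axis i 1 :: real^'n"
  \<comment> \<open>The support thickened by 1: since \<open>h n\<close> is at most 1, it contains
    the supports of all difference quotients.\<close>
  let ?K = "(\<lambda>(x, y). x + y) ` (fun_support g \<times> cball 0 1)"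
  have cg: "continuous_on UNIV g"
    using d by (simp add: continuous_at_imp_continuous_on differentiable_imp_continuous_within)
  have gi: "integrable lborel g" by (rule continuous_compact_support_integrable[OF cg s])
  have [measurable]: "g \<in> borel_measurable borel" "partial_deriv i g \<in> borel_measurable borel"
    using cg c by (auto intro: borel_measurable_continuous_onI)
  have "compact (fun_support (partial_deriv i g))"
    using partial_deriv_support s compact_fun_support_subset by blast
  then obtain B where B: "\<And>x. norm (partial_deriv i g x) \<le> B" "B \<ge> 0"
    using continuous_compact_support_bounded[OF c] by blast
  define h where "h n = 1 / real (Suc n)" for n
  have h: "h n > 0" "h n \<le> 1" for n by (auto simp: h_def)
  have h0: "h \<longlonglongrightarrow> 0" unfolding h_def[abs_def] by (rule LIMSEQ_Suc, rule lim_1_over_n)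
  define q where "q n x = (1 / h n) *\<^sub>R (g (x + h n *\<^sub>R ?e) - g x)" for n x
  have line: "((\<lambda>t. g (x + t *\<^sub>R ?e)) has_derivative (\<lambda>s. s *\<^sub>R partial_deriv i g (x + t *\<^sub>R ?e))) (at t)" for x t
  proof -
    have gd: "(g has_derivative frechet_derivative g (at (x + t *\<^sub>R ?e))) (at (x + t *\<^sub>R ?e))"
      using d frechet_derivative_works by blast
    have "((\<lambda>t. g (x + t *\<^sub>R ?e)) has_derivative (\<lambda>s. frechet_derivative g (at (x + t *\<^sub>R ?e)) (s *\<^sub>R ?e))) (at t)"
      by (rule has_derivative_compose[where f="\<lambda>t. x + t *\<^sub>R ?e" and f'="\<lambda>s. s *\<^sub>R ?e", OF _ gd])
        (auto intro!: derivative_eq_intros)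
    then show ?thesis
      using has_derivative_linear[OF gd] by (simp add: linear_scale partial_deriv_def)
  qed
  have bound: "norm (q n x) \<le> B * indicator ?K x" for n x
  proof (cases "x \<in> ?K")
    case False
    have K: "y + z \<in> ?K" if "y \<in> fun_support g" "norm z \<le> 1" for y z
      using that by (intro image_eqI[of _ _ "(y, z)"]) auto
    have "x \<notin> fun_support g" "x + h n *\<^sub>R ?e \<notin> fun_support g"
      using False K[of x 0] K[of "x + h n *\<^sub>R ?e" "- (h n *\<^sub>R ?e)"] h[of n] by auto
    then show ?thesis using B(2) by (simp add: q_def fun_support_zero)
  next
    case True
    have "norm (g (x + h n *\<^sub>R ?e) - g (x + 0 *\<^sub>R ?e)) \<le> B * norm (h n - 0)"
    proof (rule differentiable_bound[where S=UNIV and f="\<lambda>t. g (x + t *\<^sub>R ?e)"])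
      show "((\<lambda>t. g (x + t *\<^sub>R ?e)) has_derivative (\<lambda>s. s *\<^sub>R partial_deriv i g (x + t *\<^sub>R ?e))) (at t within UNIV)" for t
        using line by simp
      show "onorm (\<lambda>s. s *\<^sub>R partial_deriv i g (x + t *\<^sub>R ?e)) \<le> B" for t
        by (rule onorm_le) (simp add: mult.commute[of B] mult_left_mono B(1))
    qed auto
    then show ?thesis using True h[of n] by (simp add: q_def divide_le_eq)
  qed
  have K: "compact ?K"
    by (rule compact_continuous_image) (auto intro!: continuous_intros compact_Times s simp: case_prod_beta)
  have "(\<lambda>n. LINT x|lborel. q n x) \<longlonglongrightarrow> (LINT x|lborel. partial_deriv i g x)"
  proof (rule integral_dominated_convergence[where w="\<lambda>x. B * indicator ?K x"])
    show "integrable lborel (\<lambda>x. B * indicator ?K x :: real)"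
      using emeasure_compact_finite[OF K] K by (simp add: integrable_indicator_iff borel_compact)
    show "AE x in lborel. (\<lambda>n. q n x) \<longlonglongrightarrow> partial_deriv i g x"
    proof (rule AE_I2)
      fix x
      have "((\<lambda>t. norm (g (x + (0 + t) *\<^sub>R ?e) - g (x + 0 *\<^sub>R ?e) - t *\<^sub>R partial_deriv i g (x + 0 *\<^sub>R ?e)) / norm t) \<longlongrightarrow> 0) (at 0)"
        using line[of x 0] unfolding has_derivative_at by blast
      moreover have "filterlim h (at 0) sequentially"
        using h0 h by (auto simp: filterlim_at intro!: always_eventually less_imp_neq[symmetric])
      ultimately have "(\<lambda>n. norm (g (x + (0 + h n) *\<^sub>R ?e) - g (x + 0 *\<^sub>R ?e) - h n *\<^sub>R partial_deriv i g (x + 0 *\<^sub>R ?e)) / norm (h n)) \<longlonglongrightarrow> 0"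
        by (rule filterlim_compose)
      moreover have "norm (g (x + (0 + h n) *\<^sub>R ?e) - g (x + 0 *\<^sub>R ?e) - h n *\<^sub>R partial_deriv i g (x + 0 *\<^sub>R ?e)) / norm (h n)
          = norm (q n x - partial_deriv i g x)" for n
      proof -
        have "q n x - partial_deriv i g x = (1 / h n) *\<^sub>R (g (x + h n *\<^sub>R ?e) - g x - h n *\<^sub>R partial_deriv i g x)"
          using h(1)[of n] by (simp add: q_def scaleR_right_diff_distrib)
        then show ?thesis using h(1)[of n] by simp
      qed
      ultimately have "(\<lambda>n. norm (q n x - partial_deriv i g x)) \<longlonglongrightarrow> 0" by simp
      then show "(\<lambda>n. q n x) \<longlonglongrightarrow> partial_deriv i g x"
        by (simp add: tendsto_norm_zero_iff LIM_zero_iff)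
    qed
  qed (use bound in \<open>auto simp: q_def\<close>)
  moreover have "(LINT x|lborel. q n x) = 0" for n
    using lborel_integrable_affine_iff[of 1 g "h n *\<^sub>R ?e"] lborel_integral_affine(2)[of 1 g "h n *\<^sub>R ?e"] gi
    by (simp add: q_def add.commute)
  ultimately show ?thesis by (simp add: LIMSEQ_const_iff)
qed

text \<open>Integration by parts: the previous lemma is applied to \<open>g\<close> times the
  character, and the product rule produces the two terms.\<close>

lemma inv_fourier_partial_deriv:
  fixes g :: "real^'n \<Rightarrow> complex"
  assumes g: "test_function g"
  shows "inv_fourier (partial_deriv i g) x = - (2 * pi * x $ i) * \<i> * inv_fourier g x"
proof -
  let ?G = "\<lambda>\<xi>. g \<xi> * cis (2 * pi * (x \<bullet> \<xi>))"
  have gd: "(g has_derivative frechet_derivative g (at \<xi>)) (at \<xi>)" for \<xi>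
    using g smooth_has_derivative by (auto simp: test_function_def)
  have d: "(?G has_derivative (\<lambda>h. g \<xi> * ((2 * pi * (x \<bullet> h)) *\<^sub>R (\<i> * cis (2 * pi * (x \<bullet> \<xi>)))) +
     frechet_derivative g (at \<xi>) h * cis (2 * pi * (x \<bullet> \<xi>)))) (at \<xi>)" for \<xi>
    by (rule has_derivative_mult[OF gd]) (auto intro!: derivative_eq_intros)
  have p: "partial_deriv i ?G = (\<lambda>\<xi>. partial_deriv i g \<xi> * cis (2 * pi * (x \<bullet> \<xi>)) +
      (2 * pi * x $ i) * \<i> * (g \<xi> * cis (2 * pi * (x \<bullet> \<xi>))))"
    by (rule ext) (simp add: partial_derivI[OF d] inner_axis scaleR_conv_of_real, simp add: partial_deriv_def)
  have gi: "integrable lborel g" "integrable lborel (partial_deriv i g)"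
    using g test_function_partial_deriv test_function_integrable by blast+
  have "0 = (LINT \<xi>|lborel. partial_deriv i ?G \<xi>)"
  proof (rule integral_partial_deriv_zero[symmetric])
    show "?G differentiable at \<xi>" for \<xi> using d by (auto simp: differentiable_def)
    have "fun_support ?G \<subseteq> fun_support g"
      by (rule fun_support_subset[OF closed_fun_support]) (simp add: fun_support_zero)
    then show "compact (fun_support ?G)"
      using g compact_fun_support_subset by (auto simp: test_function_def)
    show "continuous_on UNIV (partial_deriv i ?G)"
      unfolding p using g test_function_partial_deriv[OF g]
      by (intro continuous_intros smooth_continuous) (auto simp: test_function_def)
  qed
  also have "\<dots> = inv_fourier (partial_deriv i g) x + (2 * pi * x $ i) * \<i> * inv_fourier g x"
    unfolding p inv_fourier_def using integrable_mult_cis(2)[OF gi(1)] integrable_mult_cis(2)[OF gi(2)]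
    by simp
  finally show ?thesis by (simp add: eq_neg_iff_add_eq_0)
qed

text \<open>Each coordinate is gained by two derivatives: the transform of the second partial in
  direction i is that of \<open>g\<close> times -(2 pi x_i)^2, and 2 pi is at least 1. The induction
  hypothesis serves both \<open>g\<close> and this second partial, hence the generalization over
  \<open>g\<close>. With all coordinates the majorant is a product of one-dimensional Cauchy
  densities, which is integrable by Fubini.\<close>

lemma inv_fourier_decay:
  fixes g :: "real^'n \<Rightarrow> complex"
  assumes "finite I" "test_function g"
  shows "\<exists>C. \<forall>x. norm (inv_fourier g x) * (\<Prod>i\<in>I. 1 + (x $ i)^2) \<le> C"
  using assms
proof (induction I arbitrary: g rule: finite_induct)
  case empty
  then show ?case using norm_inv_fourier_le by auto
next
  case (insert i I)
  let ?g = "partial_deriv i (partial_deriv i g)"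
  have t: "test_function (partial_deriv i g)" "test_function ?g"
    using insert.prems test_function_partial_deriv by blast+
  obtain C1 where C1: "\<And>x. norm (inv_fourier g x) * (\<Prod>i\<in>I. 1 + (x $ i)^2) \<le> C1"
    using insert.IH insert.prems by blast
  obtain C2 where C2: "\<And>x. norm (inv_fourier ?g x) * (\<Prod>i\<in>I. 1 + (x $ i)^2) \<le> C2"
    using insert.IH t by blast
  have "norm (inv_fourier g x) * (\<Prod>i\<in>insert i I. 1 + (x $ i)^2) \<le> C1 + C2" for x
  proof -
    have n: "norm (inv_fourier ?g x) = (2 * pi)^2 * (x $ i)^2 * norm (inv_fourier g x)"
      by (simp add: inv_fourier_partial_deriv[OF t(1)] inv_fourier_partial_deriv[OF insert.prems] norm_mult power2_eq_square
          flip: abs_mult)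
    have "(1::real) \<le> 2 * pi" using pi_gt3 by simp
    then have "(1::real) \<le> (2 * pi)^2" by (rule one_le_power)
    then have "(x $ i)^2 * norm (inv_fourier g x) \<le> norm (inv_fourier ?g x)"
      unfolding n mult.assoc using mult_right_mono[of 1 "(2 * pi)^2" "(x $ i)^2 * norm (inv_fourier g x)"] by simp
    then have "norm (inv_fourier g x) * (1 + (x $ i)^2) \<le> norm (inv_fourier g x) + norm (inv_fourier ?g x)"
      by (simp add: algebra_simps)
    then have "norm (inv_fourier g x) * (1 + (x $ i)^2) * (\<Prod>i\<in>I. 1 + (x $ i)^2) \<le>
       (norm (inv_fourier g x) + norm (inv_fourier ?g x)) * (\<Prod>i\<in>I. 1 + (x $ i)^2)"
      by (intro mult_right_mono prod_nonneg) auto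
    also have "\<dots> \<le> C1 + C2" using C1[of x] C2[of x] by (simp add: algebra_simps)
    finally show ?thesis using insert by (simp add: mult.assoc)
  qed
  then show ?case by blast
qed

lemma integrable_cauchy_density: "integrable lborel (\<lambda>x::real. 1 / (1 + x^2))"
  using integrable_inverse_1_plus_square by (simp add: set_integrable_def inverse_eq_divide)

lemma test_function_inv_fourier_integrable:
  fixes g :: "real^'n \<Rightarrow> complex"
  assumes g: "test_function g"
  shows "integrable lborel (inv_fourier g)"
proof -
  have gi: "integrable lborel g" by (rule test_function_integrable[OF g])
  obtain C where C: "\<And>x. norm (inv_fourier g x) * (\<Prod>i\<in>UNIV. 1 + (x $ i)^2) \<le> C"
    using inv_fourier_decay[OF finite g] by blast
  have pos: "(\<Prod>i\<in>UNIV. 1 + (x $ i)^2) > 0" for x :: "real^'n"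
    by (intro prod_pos ballI add_pos_nonneg) auto
  have 1: "integrable lborel (\<lambda>x::real^'n. \<Prod>i\<in>UNIV. complex_of_real (1 / (1 + (x $ i)^2)))"
    by (rule lborel_integral_prod) (simp only: integrable_of_real integrable_cauchy_density)
  show ?thesis
  proof (rule Bochner_Integration.integrable_bound)
    show "integrable lborel (\<lambda>x::real^'n. C * norm (\<Prod>i\<in>UNIV. complex_of_real (1 / (1 + (x $ i)^2))))"
      using integrable_norm[OF 1] by (rule integrable_mult_right)
    show "inv_fourier g \<in> borel_measurable lborel"
      by (simp add: borel_measurable_continuous_onI continuous_inv_fourier[OF gi])
    show "AE x in lborel. norm (inv_fourier g x) \<le> norm (C * norm (\<Prod>i\<in>UNIV. complex_of_real (1 / (1 + (x $ i)^2))))"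
    proof (rule AE_I2)
      fix x :: "real^'n"
      have "norm (\<Prod>i\<in>UNIV. complex_of_real (1 / (1 + (x $ i)^2))) = 1 / (\<Prod>i\<in>UNIV. 1 + (x $ i)^2)"
        by (simp only: of_real_prod[symmetric] norm_of_real) (simp add: prod_dividef prod_nonneg)
      then show "norm (inv_fourier g x) \<le> norm (C * norm (\<Prod>i\<in>UNIV. complex_of_real (1 / (1 + (x $ i)^2))))"
        using C[of x] pos[of x] by (simp add: pos_le_divide_eq abs_mult)
    qed
  qed
qed

section \<open>The unit cube and a bump supported in it\<close>

lemma unit_cube_cbox: "unit_cube = cbox (\<chi> i. - 1/2) (\<chi> i. 1/2)"
proof (rule set_eqI)
  fix x :: "real^'a"
  have "\<bar>x $ i\<bar> \<le> 1/2 \<longleftrightarrow> - 1/2 \<le> x $ i \<and> x $ i \<le> 1/2" for i by linarith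
  then show "x \<in> unit_cube \<longleftrightarrow> x \<in> cbox (\<chi> i. - 1/2) (\<chi> i. 1/2)"
    by (simp add: unit_cube_def mem_box_cart)
qed

lemma compact_unit_cube: "compact unit_cube"
  by (simp add: unit_cube_cbox compact_cbox)

lemma closed_unit_cube: "closed unit_cube"
  by (simp add: compact_imp_closed compact_unit_cube)

lemma convex_unit_cube: "convex unit_cube"
  by (simp add: unit_cube_cbox convex_box)

text \<open>Halving the argument of \<eta> brings the support from twice the cube into the cube. The
  square makes the function nonnegative, and it equals 1 on the cube of side 1/2, so its integral
  \<open>I\<close> is positive and can be divided out.\<close>

lemma cutoff_bump:
  fixes \<eta> :: "real^'n \<Rightarrow> real"
  assumes "cutoff \<eta>"
  obtains \<rho> :: "real^'n \<Rightarrow> complex" where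
    "\<And>a b. a \<noteq> 0 \<Longrightarrow> test_function (\<lambda>x. \<rho> (b + a *\<^sub>R x))"
    "\<And>x. x \<notin> unit_cube \<Longrightarrow> \<rho> x = 0" "(LINT x|lborel. \<rho> x) = 1" "\<rho> 0 \<noteq> 0"
proof -
  define r where "r x = (\<eta> (2 *\<^sub>R x))^2" for x
  have sm: "smooth \<eta>" and one: "\<And>x. x \<in> unit_cube \<Longrightarrow> \<eta> x = 1"
    and zero: "\<And>x. x \<notin> (*\<^sub>R) 2 ` unit_cube \<Longrightarrow> \<eta> x = 0"
    using assms by (auto simp: cutoff_def)
  have r0: "r x = 0" if "x \<notin> unit_cube" for x
    using that zero[of "2 *\<^sub>R x"] by (simp add: r_def image_iff)
  have aff: "test_function (\<lambda>x. c * complex_of_real (r (b + a *\<^sub>R x)))" if a: "a \<noteq> 0" for a b c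
    unfolding test_function_def
  proof
    have "smooth_algebra (\<lambda>x. complex_of_real (\<eta> (2 *\<^sub>R b + (2 * a) *\<^sub>R x)))"
      by (rule smooth_algebra.base[OF sm])
    from smooth_algebra.cmult[OF smooth_algebra.mult[OF this this], of c]
    show "smooth (\<lambda>x. c * complex_of_real (r (b + a *\<^sub>R x)))"
      by (intro smooth_algebra_smooth) (simp add: r_def power2_eq_square scaleR_right_distrib)
    have K: "compact ((\<lambda>y. (1 / a) *\<^sub>R (y - b)) ` unit_cube)"
      by (intro compact_continuous_image compact_unit_cube continuous_intros)
    have "fun_support (\<lambda>x. c * complex_of_real (r (b + a *\<^sub>R x))) \<subseteq> (\<lambda>y. (1 / a) *\<^sub>R (y - b)) ` unit_cube"
    proof (rule fun_support_subset[OF compact_imp_closed[OF K]])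
      fix x assume "x \<notin> (\<lambda>y. (1 / a) *\<^sub>R (y - b)) ` unit_cube"
      moreover have "x = (1 / a) *\<^sub>R (b + a *\<^sub>R x - b)" using a by simp
      ultimately have "b + a *\<^sub>R x \<notin> unit_cube" by blast
      then show "c * complex_of_real (r (b + a *\<^sub>R x)) = 0" by (simp add: r0)
    qed
    then show "compact (fun_support (\<lambda>x. c * complex_of_real (r (b + a *\<^sub>R x))))"
      using K compact_fun_support_subset by blast
  qed
  define I where "I = (LINT x|lborel. r x)"
  have ri: "integrable lborel (\<lambda>x. complex_of_real (r x))"
    using test_function_integrable[OF aff[of 1 1 0]] by simp
  have "I > 0"
  proof -
    have "0 < measure lborel (cbox (\<chi> i. - 1/4) (\<chi> i. 1/4) :: (real^'n) set)"
      by (auto simp: content_pos_lt_eq Basis_vec_def inner_axis)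
    also have "\<dots> = (LINT x|lborel. indicator (cbox (\<chi> i. - 1/4) (\<chi> i. 1/4)) (x::real^'n))"
      by simp
    also have "\<dots> \<le> I"
      unfolding I_def
    proof (rule integral_mono)
      show "indicator (cbox (\<chi> i. - 1/4) (\<chi> i. 1/4)) x \<le> r x" for x :: "real^'n"
      proof (cases "x \<in> cbox (\<chi> i. - 1/4) (\<chi> i. 1/4)")
        case True
        then have "\<bar>(2 *\<^sub>R x) $ i\<bar> \<le> 1/2" for i
          using spec[OF True[unfolded mem_box_cart], of i] by simp linarith
        then have "2 *\<^sub>R x \<in> unit_cube" by (simp add: unit_cube_def)
        then show ?thesis using one by (simp add: r_def)
      qed (simp add: r_def)
    next
      show "integrable lborel r" using integrable_Re[OF ri] by simp
      show "integrable lborel (indicator (cbox (\<chi> i. - 1/4) (\<chi> i. 1/4) :: (real^'n) set) :: _ \<Rightarrow> real)"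
        by (rule integrable_real_indicator, simp, rule emeasure_compact_finite[OF compact_cbox])
    qed
    finally show ?thesis .
  qed
  show thesis
  proof (rule that[of "\<lambda>x. complex_of_real (1 / I) * complex_of_real (r x)"])
    show "(LINT x|lborel. complex_of_real (1 / I) * complex_of_real (r x)) = 1"
      using \<open>I > 0\<close> by (simp add: I_def)
    show "test_function (\<lambda>x. complex_of_real (1 / I) * complex_of_real (r (b + a *\<^sub>R x)))" if "a \<noteq> 0" for a b
      by (rule aff[OF that])
    have "(0::real^'n) \<in> unit_cube" by (simp add: unit_cube_def)
    then show "complex_of_real (1 / I) * complex_of_real (r 0) \<noteq> 0"
      using \<open>I > 0\<close> one by (simp add: r_def)
  qed (simp add: r0)
qed

section \<open>Band-limited functions\<close>

declare transpose_matrix_vector [simp del]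

lemma inner_transpose: "x \<bullet> (transpose A *v y) = (A *v x) \<bullet> y"
  for A :: "real^'n^'m"
  by (simp add: transpose_matrix_vector dot_lmul_matrix inner_commute[of x] inner_commute[of y])

abbreviation freq_cell :: "real^'n^'n \<Rightarrow> (real^'n) set" where
  "freq_cell A \<equiv> (*v) (transpose A) ` unit_cube"

lemma compact_freq_cell: "compact (freq_cell A)"
  by (intro compact_continuous_image compact_unit_cube matrix_vector_mult_linear_continuous_on)

lemma outside_dist_support:
  assumes "p \<notin> dist_support \<psi>"
  obtains U where "open U" "p \<in> U"
    "\<And>f. test_function f \<Longrightarrow> fun_support f \<subseteq> U \<Longrightarrow> \<psi> f = 0"
  using assms test_function_schwartz unfolding dist_support_def test_function_def by blast

lemma fourier_dist_fun_functional:
  "fourier_dist (fun_functional T) f = (LINT x|lborel. inv_fourier f x * cnj (T x))"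
  by (simp add: fourier_dist_def fun_functional_def)

text \<open>The inverse transform \<open>w\<close> of the bump serves both as an approximate unit (\<open>w 0 = 1\<close>) and, as
  its integral \<open>\<rho> 0\<close> does not vanish, as a summability kernel.\<close>

locale bump =
  fixes \<rho> :: "real^'n \<Rightarrow> complex"
  assumes test: "a \<noteq> 0 \<Longrightarrow> test_function (\<lambda>x. \<rho> (b + a *\<^sub>R x))"
    and support: "x \<notin> unit_cube \<Longrightarrow> \<rho> x = 0"
    and integral_one: "(LINT x|lborel. \<rho> x) = 1"
    and at_0: "\<rho> 0 \<noteq> 0"
begin

definition w :: "real^'n \<Rightarrow> complex" where "w = inv_fourier \<rho>"

lemma test0: "test_function \<rho>" using test[of 1 0] by simp

lemma integrable_rho: "integrable lborel \<rho>" by (rule test_function_integrable[OF test0])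

lemma w_integrable: "integrable lborel w"
  unfolding w_def by (rule test_function_inv_fourier_integrable[OF test0])

lemma w_continuous: "continuous_on S w"
  unfolding w_def by (rule continuous_inv_fourier[OF integrable_rho])

lemma w_bound: "norm (w x) \<le> (LINT \<xi>|lborel. norm (\<rho> \<xi>))"
  unfolding w_def by (rule norm_inv_fourier_le)

lemma w_0: "w 0 = 1"
  by (simp add: w_def inv_fourier_def integral_one)

lemma w_measurable [measurable]: "w \<in> borel_measurable borel"
  using w_continuous by (rule borel_measurable_continuous_onI)

text \<open>Substitution \<xi> = t + \<epsilon> u: a bump of scale \<epsilon> at t corresponds to a
  modulated and stretched \<open>w\<close>. Read backwards, a transform of
  \<open>w (\<epsilon> x)\<close> times a function, taken at t, is a pairing with a test function
  located near t.\<close>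

lemma inv_fourier_bump:
  assumes e: "\<epsilon> > 0"
  shows "inv_fourier (\<lambda>\<xi>. \<rho> (- (1/\<epsilon>) *\<^sub>R t + (1/\<epsilon>) *\<^sub>R \<xi>)) x = \<epsilon>^CARD('n) *\<^sub>R (cis (2 * pi * (t \<bullet> x)) * w (\<epsilon> *\<^sub>R x))"
proof -
  let ?f = "\<lambda>\<xi>. \<rho> (- (1/\<epsilon>) *\<^sub>R t + (1/\<epsilon>) *\<^sub>R \<xi>) * cis (2 * pi * (x \<bullet> \<xi>))"
  have f: "?f (t + \<epsilon> *\<^sub>R u) = cis (2 * pi * (t \<bullet> x)) * (\<rho> u * cis (2 * pi * ((\<epsilon> *\<^sub>R x) \<bullet> u)))" for u
    using e by (simp add: scaleR_right_distrib inner_add_right distrib_left inner_commute mult_ac flip: cis_mult)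
  have "(LINT \<xi>|lborel. ?f \<xi>) = \<bar>\<epsilon>\<bar>^CARD('n) *\<^sub>R (LINT u|lborel. ?f (t + \<epsilon> *\<^sub>R u))"
    using lborel_integral_affine(2)[of \<epsilon> ?f t] e by simp
  then show ?thesis
    unfolding f using e by (simp add: inv_fourier_def w_def)
qed

lemma bump_support:
  fixes D :: real
  assumes D: "\<And>u::real^'n. u \<in> unit_cube \<Longrightarrow> norm u \<le> D" and e: "\<epsilon> > 0"
  shows "fun_support (\<lambda>\<xi>. \<rho> (- (1/\<epsilon>) *\<^sub>R t + (1/\<epsilon>) *\<^sub>R \<xi>)) \<subseteq> cball t (\<epsilon> * D)"
proof (rule fun_support_subset)
  fix \<xi> :: "real^'n" assume x: "\<xi> \<notin> cball t (\<epsilon> * D)"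
  have "norm (- (1/\<epsilon>) *\<^sub>R t + (1/\<epsilon>) *\<^sub>R \<xi>) > D"
  proof -
    have "- (1/\<epsilon>) *\<^sub>R t + (1/\<epsilon>) *\<^sub>R \<xi> = (1/\<epsilon>) *\<^sub>R (\<xi> - t)" by (simp add: scaleR_right_diff_distrib)
    then show ?thesis
      using x e by (simp add: dist_norm norm_minus_commute pos_less_divide_eq mult.commute)
  qed
  then show "\<rho> (- (1/\<epsilon>) *\<^sub>R t + (1/\<epsilon>) *\<^sub>R \<xi>) = 0" using D support by (meson not_le)
qed simp

text \<open>The test function in the definition of the spectrum must be supported in one of the open sets on
  which the distribution vanishes. Multiplying \<open>inv_fourier g\<close> by \<open>w (\<epsilon> x)\<close> convolves
  \<open>g\<close> with a bump of radius of order \<open>\<epsilon>\<close>, so that the pairing becomes a superposition of pairings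
  with such test functions; this replaces a partition of unity.\<close>

lemma spectrum_pairing_zero:
  fixes T g :: "real^'n \<Rightarrow> complex"
  assumes T: "continuous_on UNIV T" "\<And>x. norm (T x) \<le> C"
    and g: "integrable lborel g" "integrable lborel (inv_fourier g)"
    and K: "compact K" "\<And>x. x \<notin> K \<Longrightarrow> g x = 0"
    and disj: "K \<inter> dist_support (fourier_dist (fun_functional T)) = {}"
  shows "(LINT x|lborel. inv_fourier g x * cnj (T x)) = 0"
proof -
  have [measurable]: "T \<in> borel_measurable borel" "g \<in> borel_measurable borel" "inv_fourier g \<in> borel_measurable borel"
    using T g borel_measurable_continuous_onI by auto
  let ?W = "LINT \<xi>|lborel. norm (\<rho> \<xi>)"
  let ?\<psi> = "fourier_dist (fun_functional T)"
  have C0: "C \<ge> 0" using T(2)[of 0] norm_ge_zero order_trans by blast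
  define \<epsilon> where "\<epsilon> n = 1 / real (Suc n)" for n
  have e: "\<epsilon> n > 0" for n by (simp add: \<epsilon>_def)
  have e0: "\<epsilon> \<longlonglongrightarrow> 0" unfolding \<epsilon>_def[abs_def] by (rule LIMSEQ_Suc, rule lim_1_over_n)
  define G where "G n x = w (\<epsilon> n *\<^sub>R x) * cnj (T x)" for n x
  have Gm[measurable]: "G n \<in> borel_measurable borel" for n unfolding G_def by measurable
  have Gi: "integrable lborel (G n)" for n
    unfolding G_def
  proof (rule integrable_mult_bounded[where B=C])
    show "integrable lborel (\<lambda>x. w (\<epsilon> n *\<^sub>R x))"
      using lborel_integrable_affine_iff[of "\<epsilon> n" w 0] w_integrable e[of n] by simp
    show "(\<lambda>x. cnj (T x)) \<in> borel_measurable lborel" by simp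
  qed (use T in auto)
  obtain D where D: "\<And>u::real^'n. u \<in> unit_cube \<Longrightarrow> norm u \<le> D" "D > 0"
    using compact_imp_bounded[OF compact_unit_cube] unfolding bounded_pos by blast
  let ?\<U> = "{U. open U \<and> (\<forall>f. test_function f \<longrightarrow> fun_support f \<subseteq> U \<longrightarrow> ?\<psi> f = 0)}"
  have "K \<subseteq> \<Union>?\<U>"
  proof
    fix p assume "p \<in> K"
    then have "p \<notin> dist_support ?\<psi>" using disj by blast
    then show "p \<in> \<Union>?\<U>" by (rule outside_dist_support) blast
  qed
  \<comment> \<open>A Lebesgue number of the cover: a bump of radius less than \<open>r\<close>
    centred in \<open>K\<close> fits into a single open set on which the distribution
    vanishes.\<close>
  then obtain r where r: "r > 0" "\<And>x. x \<in> K \<Longrightarrow> \<exists>U\<in>?\<U>. ball x r \<subseteq> U"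
    using Heine_Borel_lemma[OF K(1), of ?\<U>] by blast
  have ev: "\<forall>\<^sub>F n in sequentially. \<epsilon> n < r / D"
    using order_tendstoD(2)[OF e0, of "r / D"] r D by simp
  have zero: "(LINT x|lborel. inv_fourier g x * G n x) = 0" if n: "\<epsilon> n < r / D" for n
  proof -
    \<comment> \<open>The multiplication formula moves the transform from \<open>g\<close> to
      \<open>G n\<close>. Its integrand vanishes everywhere: off \<open>K\<close> because of
      \<open>g\<close>, on \<open>K\<close> because the transform of \<open>G n\<close> at t is a
      multiple of the pairing with a small bump at t.\<close>
    have "g t * inv_fourier (G n) t = 0" for t
    proof (cases "t \<in> K")
      case True
      then obtain U where U: "ball t r \<subseteq> U" "\<And>f. test_function f \<Longrightarrow> fun_support f \<subseteq> U \<Longrightarrow> ?\<psi> f = 0"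
        using r(2) by blast
      let ?f = "\<lambda>\<xi>. \<rho> (- (1/\<epsilon> n) *\<^sub>R t + (1/\<epsilon> n) *\<^sub>R \<xi>)"
      have "cball t (\<epsilon> n * D) \<subseteq> ball t r"
        using n D by (simp add: subset_eq pos_less_divide_eq)
      then have "fun_support ?f \<subseteq> U"
        using bump_support[OF D(1) e, of n t] U(1) by blast
      moreover have "test_function ?f" using test[of "1 / \<epsilon> n" "- (1/\<epsilon> n) *\<^sub>R t"] e[of n] by simp
      ultimately have "0 = ?\<psi> ?f" using U(2) by simp
      also have "\<dots> = (LINT x|lborel. inv_fourier ?f x * cnj (T x))"
        by (rule fourier_dist_fun_functional)
      also have "\<dots> = \<epsilon> n^CARD('n) *\<^sub>R inv_fourier (G n) t"
        unfolding inv_fourier_bump[OF e] inv_fourier_def[of "G n"] by (simp add: G_def mult_ac)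
      finally show ?thesis using e[of n] by simp
    qed (simp add: K(2))
    then have "(\<lambda>t. g t * inv_fourier (G n) t) = (\<lambda>t. 0)" by (rule ext)
    then show ?thesis
      by (simp only: fourier_multiplication_formula[OF g(1) Gi] integral_zero)
  qed
  have "(\<lambda>n. LINT x|lborel. inv_fourier g x * G n x) \<longlonglongrightarrow> (LINT x|lborel. inv_fourier g x * cnj (T x))"
  proof (rule integral_dominated_convergence[where w="\<lambda>x. norm (inv_fourier g x) * (?W * C)"])
    show "AE x in lborel. (\<lambda>n. inv_fourier g x * G n x) \<longlonglongrightarrow> inv_fourier g x * cnj (T x)"
    proof (rule AE_I2)
      fix x :: "real^'n"
      have "(\<lambda>n. \<epsilon> n *\<^sub>R x) \<longlonglongrightarrow> 0 *\<^sub>R x" using e0 by (intro tendsto_intros)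
      then have "(\<lambda>n. w (\<epsilon> n *\<^sub>R x)) \<longlonglongrightarrow> w (0 *\<^sub>R x)"
        by (intro continuous_on_tendsto_compose[OF w_continuous[of UNIV]]) auto
      then have "(\<lambda>n. inv_fourier g x * G n x) \<longlonglongrightarrow> inv_fourier g x * (1 * cnj (T x))"
        unfolding G_def by (intro tendsto_intros) (simp add: w_0)
      then show "(\<lambda>n. inv_fourier g x * G n x) \<longlonglongrightarrow> inv_fourier g x * cnj (T x)" by simp
    qed
    show "AE x in lborel. norm (inv_fourier g x * G n x) \<le> norm (inv_fourier g x) * (?W * C)" for n
      unfolding G_def norm_mult
      by (intro AE_I2 mult_left_mono mult_mono w_bound) (use T(2) in \<open>auto intro!: integral_nonneg_AE\<close>)
  qed (use g(2) in simp_all)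
  moreover have "(\<lambda>n. LINT x|lborel. inv_fourier g x * G n x) \<longlonglongrightarrow> 0"
    by (rule tendsto_eventually) (use ev zero in \<open>auto elim: eventually_mono\<close>)
  ultimately show ?thesis by (rule LIMSEQ_unique)
qed

lemma bandlimited_pairing_zero:
  fixes T g :: "real^'n \<Rightarrow> complex"
  assumes T: "T \<in> bandlimited A"
    and g: "integrable lborel g" "integrable lborel (inv_fourier g)"
    and K: "compact K" "\<And>x. x \<notin> K \<Longrightarrow> g x = 0" "K \<inter> freq_cell A = {}"
  shows "(LINT x|lborel. inv_fourier g x * cnj (T x)) = 0"
proof -
  obtain C where "\<And>x. norm (T x) \<le> C" using T unfolding bandlimited_def bounded_iff by auto
  then show ?thesis
    using spectrum_pairing_zero[of T C g K] assms unfolding bandlimited_def by blast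
qed

text \<open>A global form of the spectral condition, with test functions anywhere off the cell
  instead of inside one of the open sets that define the support. The forward direction is the
  passage from local to global above; conversely, the complement of the compact cell is itself one
  of those open sets.\<close>

lemma bandlimited_iff:
  fixes T :: "real^'n \<Rightarrow> complex"
  shows "T \<in> bandlimited A \<longleftrightarrow> continuous_on UNIV T \<and> bounded (range T) \<and>
    (\<forall>f. test_function f \<longrightarrow> fun_support f \<inter> freq_cell A = {} \<longrightarrow> (LINT x|lborel. inv_fourier f x * cnj (T x)) = 0)"
proof (intro iffI conjI allI impI)
  fix f assume T: "T \<in> bandlimited A" and f: "test_function f" "fun_support f \<inter> freq_cell A = {}"
  show "(LINT x|lborel. inv_fourier f x * cnj (T x)) = 0"
    using bandlimited_pairing_zero[OF T test_function_integrable[OF f(1)]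
        test_function_inv_fourier_integrable[OF f(1)], of "fun_support f"] f fun_support_zero
    by (auto simp: test_function_def)
next
  assume *: "continuous_on UNIV T \<and> bounded (range T) \<and>
    (\<forall>f. test_function f \<longrightarrow> fun_support f \<inter> freq_cell A = {} \<longrightarrow> (LINT x|lborel. inv_fourier f x * cnj (T x)) = 0)"
  have "open (- freq_cell A)" using compact_freq_cell[of A] by (simp add: compact_imp_closed open_Compl)
  moreover have "test_function f" if "f \<in> schwartz" "compact (fun_support f)" for f
    using that by (simp add: schwartz_def test_function_def)
  ultimately have "- freq_cell A \<subseteq> \<Union>{U. open U \<and> (\<forall>f\<in>schwartz. compact (fun_support f) \<and> fun_support f \<subseteq> U \<longrightarrow>
     fourier_dist (fun_functional T) f = 0)}"
    using * by (intro Union_upper) (auto simp: fourier_dist_fun_functional)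
  then show "T \<in> bandlimited A" using * unfolding bandlimited_def dist_support_def by blast
qed (auto simp: bandlimited_def)

text \<open>\<open>inv_fourier h\<close> is integrable, so the pairing is continuous in the sup
  norm. Closedness matters when the approximation error is zero: the approximant then has to be the
  function itself.\<close>

lemma bandlimited_closed:
  fixes f :: "real^'n \<Rightarrow> complex"
  assumes f: "continuous_on UNIV f" "bounded (range f)"
    and approx: "\<And>\<epsilon>. \<epsilon> > 0 \<Longrightarrow> \<exists>g\<in>bandlimited A. \<forall>x. norm (f x - g x) \<le> \<epsilon>"
  shows "f \<in> bandlimited A"
  unfolding bandlimited_iff
proof (intro conjI allI impI f)
  fix h assume h: "test_function h" "fun_support h \<inter> freq_cell A = {}"
  let ?N = "LINT x|lborel. norm (inv_fourier h x)"
  have hi: "integrable lborel (inv_fourier h)" by (rule test_function_inv_fourier_integrable[OF h(1)])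
  have int: "integrable lborel (\<lambda>x. inv_fourier h x * cnj (g x))" if g: "continuous_on UNIV g" "bounded (range g)" for g
  proof -
    obtain B where "\<And>x. norm (g x) \<le> B" using g(2) unfolding bounded_iff by auto
    then show ?thesis
      using g(1) by (intro integrable_mult_bounded[OF hi, of _ B]) (auto intro!: borel_measurable_continuous_onI continuous_on_cnj)
  qed
  have "norm (LINT x|lborel. inv_fourier h x * cnj (f x)) \<le> \<epsilon> * ?N" if e: "\<epsilon> > 0" for \<epsilon>
  proof -
    obtain g where g: "g \<in> bandlimited A" "\<And>x. norm (f x - g x) \<le> \<epsilon>" using approx[OF e] by blast
    have i: "integrable lborel (\<lambda>x. inv_fourier h x * cnj (g x))" "integrable lborel (\<lambda>x. inv_fourier h x * cnj (f x))"
      using int g(1) f by (auto simp: bandlimited_def)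
    have "(LINT x|lborel. inv_fourier h x * cnj (g x)) = 0"
      using g(1) h by (simp add: bandlimited_iff)
    then have "(LINT x|lborel. inv_fourier h x * cnj (f x)) = (LINT x|lborel. inv_fourier h x * cnj (f x) - inv_fourier h x * cnj (g x))"
      using i by simp
    also have "norm \<dots> \<le> (LINT x|lborel. norm (inv_fourier h x * cnj (f x) - inv_fourier h x * cnj (g x)))"
      by (rule integral_norm_bound)
    also have "\<dots> \<le> (LINT x|lborel. \<epsilon> * norm (inv_fourier h x))"
    proof (rule integral_mono)
      show "norm (inv_fourier h x * cnj (f x) - inv_fourier h x * cnj (g x)) \<le> \<epsilon> * norm (inv_fourier h x)" for x
      proof -
        have "inv_fourier h x * cnj (f x) - inv_fourier h x * cnj (g x) = inv_fourier h x * cnj (f x - g x)"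
          by (simp add: algebra_simps)
        then show ?thesis
          using mult_left_mono[OF g(2)[of x] norm_ge_zero[of "inv_fourier h x"]]
          by (simp only: norm_mult complex_mod_cnj) (simp add: mult.commute)
      qed
    qed (use i hi in auto)
    finally show ?thesis by simp
  qed
  then have "norm (LINT x|lborel. inv_fourier h x * cnj (f x)) \<le> 0 + \<epsilon>" if "\<epsilon> > 0" for \<epsilon>
  proof -
    have N: "?N \<ge> 0" by simp
    have "\<epsilon> / (?N + 1) * ?N = \<epsilon> * (?N / (?N + 1))" by simp
    also have "\<dots> \<le> \<epsilon> * 1"
      using that by (intro mult_left_mono) (simp_all add: divide_le_eq_1 add_nonneg_pos[OF N])
    finally have "\<epsilon> / (?N + 1) * ?N \<le> \<epsilon>" by simp
    moreover have "norm (LINT x|lborel. inv_fourier h x * cnj (f x)) \<le> \<epsilon> / (?N + 1) * ?N"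
      using that by (intro \<open>\<And>\<epsilon>. \<epsilon> > 0 \<Longrightarrow> norm (LINT x|lborel. inv_fourier h x * cnj (f x)) \<le> \<epsilon> * ?N\<close>
          divide_pos_pos add_nonneg_pos N) simp_all
    ultimately show ?thesis by simp
  qed
  then have "norm (LINT x|lborel. inv_fourier h x * cnj (f x)) \<le> 0" by (rule field_le_epsilon)
  then show "(LINT x|lborel. inv_fourier h x * cnj (f x)) = 0" by simp
qed

text \<open>A linear substitution in the pairing turns \<open>f\<close> into \<open>f\<close>
  composed with the transpose of \<open>L\<close>, which carries a support off the cell of
  \<open>A ** L\<close> to one off the cell of \<open>A\<close>.\<close>

lemma bandlimited_compose:
  fixes T :: "real^'n \<Rightarrow> complex"
  assumes T: "T \<in> bandlimited A" and L: "invertible L"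
  shows "(\<lambda>x. T (L *v x)) \<in> bandlimited (A ** L)"
  unfolding bandlimited_iff
proof (intro conjI allI impI)
  have Tc: "continuous_on UNIV T" "bounded (range T)" using T by (auto simp: bandlimited_def)
  show "continuous_on UNIV (\<lambda>x. T (L *v x))"
    by (rule continuous_on_compose2[OF Tc(1) matrix_vector_mult_linear_continuous_on]) simp
  show "bounded (range (\<lambda>x. T (L *v x)))" by (rule bounded_subset[OF Tc(2)]) auto
  fix f assume f: "test_function f" "fun_support f \<inter> freq_cell (A ** L) = {}"
  let ?B = "matrix_inv L" and ?LT = "transpose L"
  have LT: "invertible ?LT" by (rule transpose_invertible[OF L])
  have fi: "integrable lborel f" "integrable lborel (inv_fourier f)"
    using f(1) test_function_integrable test_function_inv_fourier_integrable by auto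
  obtain c where c: "c > 0" "\<And>f :: real^'n \<Rightarrow> complex. integrable lborel f \<Longrightarrow> integrable lborel (\<lambda>x. f (L *v x))"
    "\<And>f :: real^'n \<Rightarrow> complex. integrable lborel f \<Longrightarrow> (LINT x|lborel. f (L *v x)) = c *\<^sub>R (LINT x|lborel. f x)"
    using lborel_integral_linear[OF L] by blast
  obtain c1 where c1: "c1 > 0" "\<And>f :: real^'n \<Rightarrow> complex. integrable lborel f \<Longrightarrow> integrable lborel (\<lambda>x. f (?LT *v x))"
    "\<And>f :: real^'n \<Rightarrow> complex. integrable lborel f \<Longrightarrow> (LINT x|lborel. f (?LT *v x)) = c1 *\<^sub>R (LINT x|lborel. f x)"
    using lborel_integral_linear[OF LT] by blast
  have B: "invertible ?B"
    using L unfolding invertible_def by (metis invertible_def matrix_inv_cancel matrix_eq matrix_vector_mul_assoc matrix_vector_mul_lid L)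
  obtain c2 where c2: "\<And>f :: real^'n \<Rightarrow> complex. integrable lborel f \<Longrightarrow> integrable lborel (\<lambda>x. f (?B *v x))"
    using lborel_integral_linear[OF B] by blast
  \<comment> \<open>This function enters \<open>bandlimited_pairing_zero\<close>, which asks for
    integrability of it and of its transform; both come from the change of variables, and no
    smoothness of the composition has to be established.\<close>
  let ?g = "\<lambda>\<zeta>. f (?LT *v \<zeta>)"
  have g: "inv_fourier ?g y = c1 *\<^sub>R inv_fourier f (?B *v y)" for y
  proof -
    have "(?B *v y) \<bullet> (?LT *v \<zeta>) = y \<bullet> \<zeta>" for \<zeta>
      by (simp only: inner_transpose matrix_inv_cancel[OF L])
    then show ?thesis
      unfolding inv_fourier_def
      using c1(3)[of "\<lambda>\<xi>. f \<xi> * cis (2 * pi * ((?B *v y) \<bullet> \<xi>))"] fi(1) by simp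
  qed
  have gi: "integrable lborel ?g" by (rule c1(2)[OF fi(1)])
  have gi': "integrable lborel (inv_fourier ?g)"
    unfolding g[abs_def] using c2[OF fi(2)] by simp
  let ?K = "(*v) (matrix_inv ?LT) ` fun_support f"
  have K: "compact ?K"
    using f(1) by (intro compact_continuous_image matrix_vector_mult_linear_continuous_on) (simp add: test_function_def)
  have "?g x = 0" if "x \<notin> ?K" for x
  proof -
    have "?LT *v x \<notin> fun_support f" using that matrix_inv_cancel(2)[OF LT, of x] by (metis image_eqI)
    then show ?thesis by (rule fun_support_zero)
  qed
  moreover have "?K \<inter> freq_cell A = {}"
  proof -
    have False if "y \<in> unit_cube" "matrix_inv ?LT *v z = transpose A *v y" "z \<in> fun_support f" for y z
    proof -
      have "z = ?LT *v (transpose A *v y)" using matrix_inv_cancel(1)[OF LT, of z] that(2) by simp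
      also have "\<dots> = transpose (A ** L) *v y"
        by (simp only: matrix_transpose_mul matrix_vector_mul_assoc)
      finally show False using f(2) that by blast
    qed
    then show ?thesis by (auto simp: image_iff)
  qed
  ultimately have z: "(LINT y|lborel. inv_fourier ?g y * cnj (T y)) = 0"
    by (intro bandlimited_pairing_zero[OF T gi gi' K]) auto
  obtain Bd where "\<And>x. norm (T x) \<le> Bd" using Tc(2) unfolding bounded_iff by auto
  then have "integrable lborel (\<lambda>y. inv_fourier ?g y * cnj (T y))"
    using Tc(1) by (intro integrable_mult_bounded(1)[OF gi', of _ Bd]) (auto intro!: borel_measurable_continuous_onI continuous_on_cnj)
  from c(3)[OF this] z have "(LINT x|lborel. inv_fourier ?g (L *v x) * cnj (T (L *v x))) = 0" by simp
  then show "(LINT x|lborel. inv_fourier f x * cnj (T (L *v x))) = 0"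
    unfolding g using c1(1) by (simp add: matrix_inv_cancel[OF L] )
qed

end

section \<open>Dilations and convolutions on the Fourier side\<close>

lemma freq_cell_one: "freq_cell (mat 1) = unit_cube"
  by (simp add: transpose_mat)

lemma matrix_inv_mult:
  fixes A :: "real^'n^'n"
  assumes "invertible A"
  shows "A ** matrix_inv A = mat 1" "matrix_inv A ** A = mat 1"
  using someI_ex[OF assms[unfolded invertible_def]] by (simp_all add: matrix_inv_def)

lemma invertible_matrix_inv: "invertible A \<Longrightarrow> invertible (matrix_inv A)" for A :: "real^'n^'n"
  using matrix_inv_mult[of A] by (auto simp: invertible_def)

lemma fourier_compose:
  fixes A :: "real^'n^'n" and h :: "real^'n \<Rightarrow> complex"
  assumes A: "invertible A" and h: "integrable lborel h"
  obtains c where "c > 0" "integrable lborel (\<lambda>x. h (A *v x))"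
    "\<And>\<zeta>. fourier (\<lambda>x. h (A *v x)) (transpose A *v \<zeta>) = c *\<^sub>R fourier h \<zeta>"
proof -
  obtain c where c: "c > 0" "\<And>f :: real^'n \<Rightarrow> complex. integrable lborel f \<Longrightarrow> integrable lborel (\<lambda>x. f (A *v x))"
    "\<And>f :: real^'n \<Rightarrow> complex. integrable lborel f \<Longrightarrow> (LINT x|lborel. f (A *v x)) = c *\<^sub>R (LINT x|lborel. f x)"
    using lborel_integral_linear[OF A] by blast
  have "fourier (\<lambda>x. h (A *v x)) (transpose A *v \<zeta>) = c *\<^sub>R fourier h \<zeta>" for \<zeta>
    unfolding fourier_def inner_transpose
    using c(3)[OF integrable_mult_cis(1)[OF h, of "- 2 * pi" \<zeta>]] .
  then show thesis using that c h by blast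
qed

lemma norm_convolve_le:
  fixes f g :: "real^'n \<Rightarrow> complex"
  assumes f: "\<And>x. norm (f x) \<le> C" "continuous_on UNIV f" and g: "integrable lborel g"
  shows "norm (convolve f g y) \<le> C * (LINT t|lborel. norm (g t))"
    and integrable_convolve: "integrable lborel (\<lambda>t. f (y - t) * g t)"
proof -
  have "continuous_on UNIV (\<lambda>t. f (y - t))"
    by (rule continuous_on_compose2[OF f(2)]) (auto intro: continuous_intros)
  then have "(\<lambda>t. f (y - t)) \<in> borel_measurable lborel" by (simp add: borel_measurable_continuous_onI)
  then show i: "integrable lborel (\<lambda>t. f (y - t) * g t)"
    using f(1) by (intro integrable_mult_bounded[OF g, of _ C]) auto
  have "norm (convolve f g y) \<le> (LINT t|lborel. norm (f (y - t) * g t))"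
    unfolding convolve_def by (rule integral_norm_bound)
  also have "\<dots> \<le> (LINT t|lborel. C * norm (g t))"
    by (rule integral_mono) (use integrable_norm[OF i] g f(1) in \<open>auto simp: norm_mult mult_right_mono\<close>)
  finally show "norm (convolve f g y) \<le> C * (LINT t|lborel. norm (g t))" by simp
qed

text \<open>The multiplication formula for h(y - .), whose transform is a modulation of
  \<open>fourier h\<close>. The result involves the kernel through \<kappa> alone, and only where
  \<open>fourier h\<close> is nonzero.\<close>

lemma convolve_inv_fourier:
  fixes h \<kappa> :: "real^'n \<Rightarrow> complex"
  assumes h: "integrable lborel h" and k: "integrable lborel \<kappa>"
  shows "convolve h (inv_fourier \<kappa>) y = (LINT \<xi>|lborel. \<kappa> \<xi> * (fourier h \<xi> * cis (2 * pi * (y \<bullet> \<xi>))))"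
proof -
  have hi: "integrable lborel (\<lambda>t. h (y - t))"
    using lborel_integrable_affine_iff[of "-1" h y] h by simp
  have "inv_fourier (\<lambda>t. h (y - t)) \<xi> = fourier h \<xi> * cis (2 * pi * (y \<bullet> \<xi>))" for \<xi>
  proof -
    have "inv_fourier (\<lambda>t. h (y - t)) \<xi> = (LINT u|lborel. h u * cis (2 * pi * (\<xi> \<bullet> (y - u))))"
      unfolding inv_fourier_def
      using lborel_integral_affine(2)[of "-1" "\<lambda>t. h (y - t) * cis (2 * pi * (\<xi> \<bullet> t))" y] by simp
    also have "\<dots> = (LINT u|lborel. h u * cis (- 2 * pi * (u \<bullet> \<xi>)) * cis (2 * pi * (y \<bullet> \<xi>)))"
    proof (rule Bochner_Integration.integral_cong)
      fix u
      have "2 * pi * (\<xi> \<bullet> (y - u)) = - 2 * pi * (u \<bullet> \<xi>) + 2 * pi * (y \<bullet> \<xi>)"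
        by (simp add: inner_diff_right inner_commute algebra_simps)
      then show "h u * cis (2 * pi * (\<xi> \<bullet> (y - u))) = h u * cis (- 2 * pi * (u \<bullet> \<xi>)) * cis (2 * pi * (y \<bullet> \<xi>))"
        by (simp only: cis_mult[symmetric] mult.assoc)
    qed simp
    finally show ?thesis by (simp add: fourier_def)
  qed
  then show ?thesis
    using fourier_multiplication_formula[OF k hi] by (simp add: convolve_def mult.commute)
qed

lemma tendsto_convolve:
  fixes h :: "nat \<Rightarrow> real^'n \<Rightarrow> complex"
  assumes h: "\<And>n. continuous_on UNIV (h n)" "\<And>n x. norm (h n x) \<le> C" "\<And>x. (\<lambda>n. h n x) \<longlonglongrightarrow> T x"
    and T: "continuous_on UNIV T" and K: "integrable lborel K"
  shows "(\<lambda>n. convolve (h n) K y) \<longlonglongrightarrow> convolve T K y"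
  unfolding convolve_def
proof (rule integral_dominated_convergence[where w="\<lambda>t. C * norm (K t)"])
  show "AE t in lborel. (\<lambda>n. h n (y - t) * K t) \<longlonglongrightarrow> T (y - t) * K t"
    by (intro AE_I2 tendsto_mult h tendsto_const)
  have C: "norm (T x) \<le> C" for x
    by (rule LIMSEQ_le_const2[OF tendsto_norm[OF h(3)]]) (use h(2) in auto)
  show "(\<lambda>t. T (y - t) * K t) \<in> borel_measurable lborel"
    using integrable_convolve[of T C K y] C T K by auto
  show "(\<lambda>t. h n (y - t) * K t) \<in> borel_measurable lborel" for n
    using integrable_convolve[of "h n" C K y] h K by auto
qed (use K h in \<open>auto simp: norm_mult mult_right_mono\<close>)

text \<open>Approximation by integrable functions with the same spectrum. Contracting by \<open>1 - s\<close> makes room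
  for the spectrum of the multiplier \<open>w (s x)\<close>: the sum of \<open>(1 - s)\<close> times the cell and \<open>s\<close> times the
  cell stays in the cell by convexity. This replaces spectral synthesis on the boundary of the cell.\<close>

definition approximants :: "(real^'n \<Rightarrow> complex) \<Rightarrow> (real^'n) set \<Rightarrow> (nat \<Rightarrow> real^'n \<Rightarrow> complex) \<Rightarrow> real \<Rightarrow> bool" where
  "approximants T S h C \<longleftrightarrow> (\<forall>n. continuous_on UNIV (h n) \<and> integrable lborel (h n) \<and> (\<forall>x. norm (h n x) \<le> C) \<and>
    integrable lborel (fourier (h n)) \<and> (\<forall>\<xi>. \<xi> \<notin> S \<longrightarrow> fourier (h n) \<xi> = 0)) \<and> (\<forall>x. (\<lambda>n. h n x) \<longlonglongrightarrow> T x)"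

context bump
begin

lemma bandlimited_approximants_unit:
  fixes T :: "real^'n \<Rightarrow> complex"
  assumes T: "T \<in> bandlimited (mat 1)"
  obtains h C where "approximants T unit_cube h C"
proof -
  have Tc: "continuous_on UNIV T" using T by (simp add: bandlimited_def)
  obtain C where C: "\<And>x. norm (T x) \<le> C" using T unfolding bandlimited_def bounded_iff by auto
  let ?W = "LINT \<xi>|lborel. norm (\<rho> \<xi>)"
  \<comment> \<open>The shift by two keeps \<open>s 0\<close> below 1, so that the contraction by
    \<open>1 - s n\<close> is invertible for every n.\<close>
  define s where "s n = 1 / real (Suc (Suc n))" for n
  have s: "0 < s n" "s n < 1" for n by (auto simp: s_def)
  have s0: "s \<longlonglongrightarrow> 0"
    unfolding s_def[abs_def] by (rule LIMSEQ_Suc[where f="\<lambda>n. 1 / real (Suc n)"], rule LIMSEQ_Suc, rule lim_1_over_n)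
  \<comment> \<open>The conjugate on \<open>w\<close> matches that in \<open>fun_functional\<close>:
    the conjugate of the transform of \<open>h n\<close> then becomes a pairing of \<open>T\<close>
    with a test function.\<close>
  define h where "h n x = T ((1 - s n) *\<^sub>R x) * cnj (w (s n *\<^sub>R x))" for n x
  have hc: "continuous_on UNIV (h n)" for n
    unfolding h_def
    by (intro continuous_intros continuous_on_compose2[OF Tc] continuous_on_compose2[OF w_continuous[of UNIV]]) auto
  have Tm: "(\<lambda>x. T ((1 - s n) *\<^sub>R x)) \<in> borel_measurable borel" for n
    by (intro borel_measurable_continuous_onI continuous_on_compose2[OF Tc]) (auto intro: continuous_intros)
  have hi: "integrable lborel (h n)" for n
    unfolding h_def
  proof (rule integrable_mult_bounded(2)[where B=C])
    have "integrable lborel (\<lambda>x. w (s n *\<^sub>R x))"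
      using lborel_integrable_affine_iff[of "s n" w 0] w_integrable s(1)[of n] by simp
    then show "integrable lborel (\<lambda>x. cnj (w (s n *\<^sub>R x)))" by simp
  qed (use C Tm in auto)
  have hb: "norm (h n x) \<le> C * ?W" for n x
    unfolding h_def norm_mult complex_mod_cnj
    by (intro mult_mono C w_bound) (use C order_trans norm_ge_zero in blast)+
  have supp: "fourier (h n) \<xi> = 0" if \<xi>: "\<xi> \<notin> unit_cube" for n \<xi>
  proof -
    \<comment> \<open>The substitution x = k y undoes the contraction inside \<open>T\<close>. After
      it the modulated \<open>w\<close> has scale \<open>r\<close>, and the test function is a bump
      of scale \<open>r\<close> centred at \<open>t\<close>.\<close>
    define k where "k = 1 / (1 - s n)"
    define r where "r = s n * k"
    define t where "t = k *\<^sub>R \<xi>"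
    have k: "k > 0" "k * (1 - s n) = 1" and r: "r > 0" using s[of n] by (auto simp: k_def r_def)
    let ?f = "\<lambda>\<zeta>. \<rho> (- (1/r) *\<^sub>R t + (1/r) *\<^sub>R \<zeta>)"
    have "fun_support ?f \<subseteq> (\<lambda>u. t + r *\<^sub>R u) ` unit_cube"
    proof (rule fun_support_subset)
      show "closed ((\<lambda>u. t + r *\<^sub>R u) ` unit_cube)"
        by (intro compact_imp_closed compact_continuous_image compact_unit_cube continuous_intros)
      fix \<zeta> assume z: "\<zeta> \<notin> (\<lambda>u. t + r *\<^sub>R u) ` unit_cube"
      have "\<zeta> = t + r *\<^sub>R (- (1/r) *\<^sub>R t + (1/r) *\<^sub>R \<zeta>)" using r by (simp add: scaleR_right_diff_distrib)
      then have "- (1/r) *\<^sub>R t + (1/r) *\<^sub>R \<zeta> \<notin> unit_cube" using z by blast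
      then show "?f \<zeta> = 0" by (rule support)
    qed
    \<comment> \<open>Otherwise \<xi> would be a convex combination of the points
      \<open>t + r *\<^sub>R u\<close> and \<open>- u\<close> of the symmetric cube, with weights
      \<open>1 - s n\<close> and \<open>s n\<close>.\<close>
    moreover have "t + r *\<^sub>R u \<notin> unit_cube" if u: "u \<in> unit_cube" for u
    proof
      assume z: "t + r *\<^sub>R u \<in> unit_cube"
      have "(1 - s n) *\<^sub>R (t + r *\<^sub>R u) + s n *\<^sub>R (- u) \<in> unit_cube"
        by (rule convexD[OF convex_unit_cube z]) (use u s[of n] in \<open>auto simp: unit_cube_def\<close>)
      moreover have "(1 - s n) *\<^sub>R (t + r *\<^sub>R u) + s n *\<^sub>R (- u) = \<xi>"
      proof -
        have "(1 - s n) * k = 1" "(1 - s n) * r = s n" using k by (auto simp: r_def mult_ac)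
        then show ?thesis by (simp add: scaleR_right_distrib t_def)
      qed
      ultimately show False using \<xi> by simp
    qed
    ultimately have disj: "fun_support ?f \<inter> freq_cell (mat 1) = {}" unfolding freq_cell_one by blast
    have "test_function ?f" using test[of "1 / r" "- (1/r) *\<^sub>R t"] r by simp
    then have z: "(LINT y|lborel. inv_fourier ?f y * cnj (T y)) = 0"
      using T disj by (simp add: bandlimited_iff)
    let ?q = "\<lambda>x. cnj (h n x) * cis (2 * pi * (x \<bullet> \<xi>))"
    have q: "?q (k *\<^sub>R y) = cnj (T y) * (w (r *\<^sub>R y) * cis (2 * pi * (t \<bullet> y)))" for y
      using k by (simp add: h_def r_def t_def mult_ac inner_commute)
    have "cnj (fourier (h n) \<xi>) = (LINT x|lborel. cnj (h n x * cis (- 2 * pi * (x \<bullet> \<xi>))))"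
      unfolding fourier_def by (rule Bochner_Integration.integral_cnj[symmetric])
    also have "\<dots> = (LINT x|lborel. ?q x)" by (simp add: cis_cnj)
    also have "\<dots> = \<bar>k\<bar>^CARD('n) *\<^sub>R (LINT y|lborel. ?q (k *\<^sub>R y))"
      using lborel_integral_affine(2)[of k ?q 0] k by simp
    also have "(LINT y|lborel. ?q (k *\<^sub>R y)) = (1 / r)^CARD('n) *\<^sub>R (LINT y|lborel. inv_fourier ?f y * cnj (T y))"
      unfolding q inv_fourier_bump[OF r] using r by (simp add: mult_ac power_one_over)
    also have "\<dots> = 0" using z by simp
    finally show ?thesis by simp
  qed
  have hf: "integrable lborel (fourier (h n))" for n
    using supp by (intro continuous_compact_support_integrable continuous_fourier[OF hi]
        compact_fun_support_subset[OF compact_unit_cube] fun_support_subset[OF closed_unit_cube])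
  have "(\<lambda>n. h n x) \<longlonglongrightarrow> T x" for x
  proof -
    have "(\<lambda>n. (1 - s n) *\<^sub>R x) \<longlonglongrightarrow> (1 - 0) *\<^sub>R x" "(\<lambda>n. s n *\<^sub>R x) \<longlonglongrightarrow> 0 *\<^sub>R x"
      using s0 by (intro tendsto_intros; simp)+
    then have "(\<lambda>n. T ((1 - s n) *\<^sub>R x)) \<longlonglongrightarrow> T ((1 - 0) *\<^sub>R x)" "(\<lambda>n. w (s n *\<^sub>R x)) \<longlonglongrightarrow> w (0 *\<^sub>R x)"
      by (auto intro: continuous_on_tendsto_compose[OF Tc] continuous_on_tendsto_compose[OF w_continuous[of UNIV]])
    then have "(\<lambda>n. h n x) \<longlonglongrightarrow> T ((1 - 0) *\<^sub>R x) * cnj (w (0 *\<^sub>R x))"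
      unfolding h_def by (intro tendsto_intros)
    then show ?thesis by (simp add: w_0)
  qed
  then show thesis using that[of h "C * ?W"] hc hi hb hf supp by (simp add: approximants_def)
qed

text \<open>Composition with \<open>matrix_inv A\<close> moves the spectrum into the unit cube;
  composing the approximants with \<open>A\<close> moves theirs back.\<close>

lemma bandlimited_approximants:
  fixes T :: "real^'n \<Rightarrow> complex"
  assumes T: "T \<in> bandlimited A" and A: "invertible A"
  obtains h C where "approximants T (freq_cell A) h C"
proof -
  have "(\<lambda>x. T (matrix_inv A *v x)) \<in> bandlimited (mat 1)"
    using bandlimited_compose[OF T invertible_matrix_inv[OF A]] by (simp add: matrix_inv_mult[OF A])
  then obtain h C where h: "approximants (\<lambda>x. T (matrix_inv A *v x)) unit_cube h C"
    using bandlimited_approximants_unit by blast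
  let ?h = "\<lambda>n x. h n (A *v x)"
  have i: "integrable lborel (?h n)" for n
    using h fourier_compose[OF A, of "h n"] unfolding approximants_def by metis
  have supp: "fourier (?h n) \<xi> = 0" if "\<xi> \<notin> freq_cell A" for n \<xi>
  proof -
    let ?z = "matrix_inv (transpose A) *v \<xi>"
    have eq: "\<xi> = transpose A *v ?z" using matrix_inv_cancel[OF transpose_invertible[OF A]] by simp
    then have "?z \<notin> unit_cube" using that by blast
    moreover obtain c where "fourier (?h n) (transpose A *v ?z) = c *\<^sub>R fourier (h n) ?z"
      using h fourier_compose[OF A, of "h n"] unfolding approximants_def by metis
    ultimately show ?thesis using h eq by (simp add: approximants_def)
  qed
  have "integrable lborel (fourier (?h n))" for n
    using supp by (intro continuous_compact_support_integrable continuous_fourier[OF i]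
        compact_fun_support_subset[OF compact_freq_cell] fun_support_subset[OF compact_imp_closed[OF compact_freq_cell]])
  moreover have "continuous_on UNIV (?h n)" for n
    using h by (intro continuous_on_compose2[OF _ matrix_vector_mult_linear_continuous_on]) (auto simp: approximants_def)
  moreover have "(\<lambda>n. ?h n x) \<longlonglongrightarrow> T x" for x
  proof -
    have "(\<lambda>n. h n (A *v x)) \<longlonglongrightarrow> T (matrix_inv A *v (A *v x))" using h by (simp add: approximants_def)
    then show ?thesis by (simp only: matrix_inv_cancel[OF A])
  qed
  ultimately have "approximants T (freq_cell A) ?h C"
    using h i supp by (simp add: approximants_def)
  then show thesis by (rule that)
qed

text \<open>For the integrable approximants both convolutions are frequency integrals over the cell,
  where the multipliers agree. Bounded pointwise convergence and integrability of the two kernels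
  transfer the equality to \<open>T\<close>.\<close>

lemma convolve_multiplier_cong:
  fixes T :: "real^'n \<Rightarrow> complex"
  assumes T: "T \<in> bandlimited A" and A: "invertible A"
    and k: "integrable lborel \<kappa>" "integrable lborel (inv_fourier \<kappa>)"
    and k': "integrable lborel \<kappa>'" "integrable lborel (inv_fourier \<kappa>')"
    and eq: "AE \<xi> in lborel. \<xi> \<in> freq_cell A \<longrightarrow> \<kappa> \<xi> = \<kappa>' \<xi>"
  shows "convolve T (inv_fourier \<kappa>) y = convolve T (inv_fourier \<kappa>') y"
proof -
  obtain h C where h: "approximants T (freq_cell A) h C"
    using bandlimited_approximants[OF T A] by blast
  have Tc: "continuous_on UNIV T" using T by (simp add: bandlimited_def)
  have "convolve (h n) (inv_fourier \<kappa>) y = convolve (h n) (inv_fourier \<kappa>') y" for n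
  proof -
    have hi: "integrable lborel (h n)" "integrable lborel (fourier (h n))" using h by (simp_all add: approximants_def)
    have [measurable]: "\<kappa> \<in> borel_measurable borel" "\<kappa>' \<in> borel_measurable borel" "fourier (h n) \<in> borel_measurable borel"
      using k k' hi(2) by auto
    show ?thesis
      unfolding convolve_inv_fourier[OF hi(1) k(1)] convolve_inv_fourier[OF hi(1) k'(1)]
    proof (rule integral_cong_AE)
      show "AE \<xi> in lborel. \<kappa> \<xi> * (fourier (h n) \<xi> * cis (2 * pi * (y \<bullet> \<xi>))) = \<kappa>' \<xi> * (fourier (h n) \<xi> * cis (2 * pi * (y \<bullet> \<xi>)))"
        using eq by eventually_elim (use h in \<open>auto simp: approximants_def\<close>)
    qed simp_all
  qed
  moreover have "(\<lambda>n. convolve (h n) (inv_fourier \<kappa>) y) \<longlonglongrightarrow> convolve T (inv_fourier \<kappa>) y"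
    using h by (intro tendsto_convolve[where C=C] Tc k) (auto simp: approximants_def)
  moreover have "(\<lambda>n. convolve (h n) (inv_fourier \<kappa>') y) \<longlonglongrightarrow> convolve T (inv_fourier \<kappa>') y"
    using h by (intro tendsto_convolve[where C=C] Tc k') (auto simp: approximants_def)
  ultimately show ?thesis using LIMSEQ_unique by simp
qed

lemma fourier_w: "fourier w \<xi> = \<rho> \<xi>"
proof -
  have c: "continuous_on UNIV \<rho>" using test0 smooth_continuous by (auto simp: test_function_def)
  obtain B where B: "\<And>x. norm (\<rho> x) \<le> B"
    using continuous_compact_support_bounded[OF c] test0 by (auto simp: test_function_def)
  show ?thesis
    using fourier_inversion[OF integrable_rho c B w_integrable[unfolded w_def]] by (simp add: w_def)
qed

text \<open>By Fubini the pairing of \<open>g\<close> with the convolution is a superposition,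
  weighted by the conjugate of f(u), of pairings of \<open>g\<close> with translates of
  \<open>w\<close>. Those vanish since \<rho> lives on the cube and \<open>g\<close> off it, so
  boundedness and continuity of \<open>f\<close> are enough.\<close>

lemma convolve_w_bandlimited:
  fixes f :: "real^'n \<Rightarrow> complex"
  assumes f: "continuous_on UNIV f" "\<And>x. norm (f x) \<le> C"
  shows "convolve f w \<in> bandlimited (mat 1)"
  unfolding bandlimited_iff
proof (intro conjI allI impI)
  have fm[measurable]: "f \<in> borel_measurable borel" using f(1) by (rule borel_measurable_continuous_onI)
  have C0: "C \<ge> 0" using f(2)[of 0] norm_ge_zero order_trans by blast
  show "continuous_on UNIV (convolve f w)"
    unfolding continuous_on_sequentially comp_def
  proof (intro allI ballI impI)
    fix u and a :: "real^'n" assume u: "(\<forall>n. u n \<in> UNIV) \<and> u \<longlonglongrightarrow> a"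
    show "(\<lambda>n. convolve f w (u n)) \<longlonglongrightarrow> convolve f w a"
      unfolding convolve_def
    proof (rule integral_dominated_convergence[where w="\<lambda>t. C * norm (w t)"])
      show "AE t in lborel. (\<lambda>n. f (u n - t) * w t) \<longlonglongrightarrow> f (a - t) * w t"
        using u by (intro AE_I2 tendsto_mult tendsto_const continuous_on_tendsto_compose[OF f(1)] tendsto_diff) auto
    qed (use w_integrable f in \<open>auto simp: norm_mult mult_right_mono\<close>)
  qed
  show "bounded (range (convolve f w))"
    unfolding bounded_iff using norm_convolve_le[OF f(2) f(1) w_integrable] by blast
  fix g :: "real^'n \<Rightarrow> complex"
  assume g: "test_function g" "fun_support g \<inter> freq_cell (mat 1) = {}"
  have gi: "integrable lborel g" "integrable lborel (inv_fourier g)"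
    using g(1) test_function_integrable test_function_inv_fourier_integrable by auto
  have [measurable]: "inv_fourier g \<in> borel_measurable borel" using gi by simp
  have shift: "integrable lborel (\<lambda>u. w (x - u))" "(LINT u|lborel. norm (w (x - u))) = (LINT u|lborel. norm (w u))" for x
    using lborel_integrable_affine_iff[of "-1" w x] lborel_integral_affine(2)[of "-1" "\<lambda>u. norm (w u)" x] w_integrable
    by simp_all
  have conv: "convolve f w x = (LINT u|lborel. f u * w (x - u))" for x
    unfolding convolve_def using lborel_integral_affine(2)[of "-1" "\<lambda>t. f (x - t) * w t" x] by simp
  let ?F = "\<lambda>x u. inv_fourier g x * cnj (w (x - u)) * cnj (f u)"
  have inner: "(LINT x|lborel. inv_fourier g x * cnj (w (x - u))) = 0" for u
  proof -
    have wi: "integrable lborel (\<lambda>x. w (x - u))"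
      using lborel_integrable_affine_iff[of 1 w "-u"] w_integrable by (simp add: add.commute[of "-u"])
    have "(LINT x|lborel. inv_fourier g x * cnj (w (x - u))) = (LINT \<xi>|lborel. g \<xi> * inv_fourier (\<lambda>x. cnj (w (x - u))) \<xi>)"
      using wi by (intro fourier_multiplication_formula gi) simp
    also have "\<dots> = (LINT \<xi>|(lborel :: (real^'n) measure). 0)"
    proof (rule Bochner_Integration.integral_cong)
      fix \<xi> :: "real^'n"
      have "inv_fourier (\<lambda>x. cnj (w (x - u))) \<xi> = (LINT x|lborel. cnj (w (x - u) * cis (- 2 * pi * (x \<bullet> \<xi>))))"
        unfolding inv_fourier_def by (simp add: cis_cnj inner_commute)
      also have "\<dots> = cnj (LINT x|lborel. w (x - u) * cis (- 2 * pi * (x \<bullet> \<xi>)))" by (rule Bochner_Integration.integral_cnj)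
      also have "(LINT x|lborel. w (x - u) * cis (- 2 * pi * (x \<bullet> \<xi>))) = (LINT x|lborel. w x * cis (- 2 * pi * (x \<bullet> \<xi>)) * cis (- 2 * pi * (u \<bullet> \<xi>)))"
        using lborel_integral_affine(2)[of 1 "\<lambda>x. w (x - u) * cis (- 2 * pi * (x \<bullet> \<xi>))" u]
        by (simp add: inner_add_left distrib_left mult.assoc cis_mult add.commute)
      also have "\<dots> = \<rho> \<xi> * cis (- 2 * pi * (u \<bullet> \<xi>))" by (simp only: integral_mult_left_zero fourier_w[unfolded fourier_def])
      finally show "g \<xi> * inv_fourier (\<lambda>x. cnj (w (x - u))) \<xi> = 0"
        using g(2) support[of \<xi>] fun_support_zero[of \<xi> g] unfolding freq_cell_one by auto
    qed simp
    finally show ?thesis by simp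
  qed
  have int: "integrable (lborel \<Otimes>\<^sub>M lborel) (\<lambda>(x, u). ?F x u)"
  proof (rule lborel_pair.Fubini_integrable)
    have Fi: "integrable lborel (\<lambda>u. ?F x u)" for x
      using shift(1)[of x] f(2) by (intro integrable_mult_bounded(1)[where B=C] integrable_mult_right) auto
    then show "AE x in lborel. integrable lborel (\<lambda>u. case (x, u) of (x, u) \<Rightarrow> ?F x u)" by simp
    show "integrable lborel (\<lambda>x. LINT u|lborel. norm (case (x, u) of (x, u) \<Rightarrow> ?F x u))"
    proof (rule Bochner_Integration.integrable_bound)
      show "integrable lborel (\<lambda>x. norm (inv_fourier g x) * (C * (LINT u|lborel. norm (w u))))"
        using gi(2) by simp
      show "AE x in lborel. norm (LINT u|lborel. norm (case (x, u) of (x, u) \<Rightarrow> ?F x u)) \<le>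
         norm (norm (inv_fourier g x) * (C * (LINT u|lborel. norm (w u))))"
      proof (rule AE_I2)
        fix x
        have "(LINT u|lborel. norm (?F x u)) \<le> (LINT u|lborel. norm (inv_fourier g x) * (C * norm (w (x - u))))"
          by (rule integral_mono) (use integrable_norm[OF Fi[of x]] shift(1)[of x] f(2) in \<open>auto simp: norm_mult mult_left_mono mult.commute[of C] mult.assoc\<close>)
        also have "\<dots> = norm (inv_fourier g x) * (C * (LINT u|lborel. norm (w u)))"
          by (simp add: shift(2))
        finally show "norm (LINT u|lborel. norm (case (x, u) of (x, u) \<Rightarrow> ?F x u)) \<le>
         norm (norm (inv_fourier g x) * (C * (LINT u|lborel. norm (w u))))"
          using C0 by (simp add: abs_of_nonneg)
      qed
    qed simp
  qed simp
  have "(LINT x|lborel. inv_fourier g x * cnj (convolve f w x)) = (LINT x|lborel. LINT u|lborel. ?F x u)"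
    unfolding conv by (simp add: mult.assoc mult.commute[of "cnj (w _)"] flip: Bochner_Integration.integral_cnj integral_mult_right_zero)
  also have "\<dots> = (LINT u|lborel. LINT x|lborel. ?F x u)"
    by (rule lborel_pair.Fubini_integral[OF int, symmetric])
  also have "\<dots> = 0" by (simp add: inner)
  finally show "(LINT x|lborel. inv_fourier g x * cnj (convolve f w x)) = 0" .
qed

text \<open>Density without a rate: \<open>f\<close> is averaged over x - (A n)^-1 t with a
  band-limited kernel of integral one. The displacement tends to zero only pointwise in t, so
  dominated convergence in t replaces an estimate on the support of the kernel.\<close>

lemma bandlimited_approximation:
  fixes f :: "real^'n \<Rightarrow> complex" and A :: "nat \<Rightarrow> real^'n^'n"
  assumes f: "f \<in> space_C" and A: "\<And>n. invertible (A n)"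
    and lim: "\<And>t. (\<lambda>n. matrix_inv (A n) *v t) \<longlonglongrightarrow> 0" and e: "\<epsilon> > 0"
  shows "\<forall>\<^sub>F n in sequentially. \<exists>g\<in>bandlimited (A n). \<forall>x. norm (f x - g x) \<le> \<epsilon>"
proof -
  have fc: "continuous_on UNIV f" and uc: "uniformly_continuous_on UNIV f"
    using f uniformly_continuous_imp_continuous by (auto simp: space_C_def)
  have [measurable]: "f \<in> borel_measurable borel" using fc by (rule borel_measurable_continuous_onI)
  obtain C where C: "\<And>x. norm (f x) \<le> C" using f unfolding space_C_def bounded_iff by auto
  \<comment> \<open>The integral of \<open>w\<close> is \<open>\<rho> 0\<close>, so this kernel has
    integral one.\<close>
  define k where "k t = w t / \<rho> 0" for t
  have k: "integrable lborel k" unfolding k_def[abs_def] using w_integrable by simp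
  have k1: "(LINT t|lborel. k t) = 1"
    using fourier_w[of 0] at_0 by (simp add: k_def fourier_def)
  let ?N = "LINT t|lborel. norm (k t)"
  define e' where "e' = \<epsilon> / (2 * (?N + 1))"
  have N: "?N \<ge> 0" by simp
  have e': "e' > 0" unfolding e'_def by (intro divide_pos_pos mult_pos_pos add_nonneg_pos N e) simp_all
  have e'N: "e' * ?N < \<epsilon>"
  proof -
    have "e' * (2 * (?N + 1)) = \<epsilon>" unfolding e'_def using add_nonneg_pos[OF N, of 1] by simp
    moreover have "e' * (2 * (?N + 1)) = e' * ?N + e' * ?N + 2 * e'" by (simp add: algebra_simps)
    moreover have "e' * ?N \<ge> 0" using e' N by (intro mult_nonneg_nonneg) auto
    ultimately show ?thesis using e' by linarith
  qed
  obtain d where d: "d > 0" "\<And>x y. dist x y < d \<Longrightarrow> dist (f x) (f y) < e'"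
    using uc e' unfolding uniformly_continuous_on_def by blast
  \<comment> \<open>A majorant of the error integrand that does not depend on x, which makes the
    final estimate uniform: uniform continuity bounds small displacements, the sup bound all
    others.\<close>
  define u where "u n t = (if norm (matrix_inv (A n) *v t) < d then e' else 2 * C) * norm (k t)" for n t
  have [measurable]: "k \<in> borel_measurable borel" using k by simp
  have C0: "C \<ge> 0" using C[of 0] norm_ge_zero order_trans by blast
  have um: "u n \<in> borel_measurable lborel" for n unfolding u_def[abs_def] by measurable
  have ub: "norm (u n t) \<le> (e' + 2 * C) * norm (k t)" for n t
    unfolding u_def norm_mult by (intro mult_mono) (use e' C0 in auto)
  have ui: "integrable lborel (u n)" for n
  proof (rule Bochner_Integration.integrable_bound[OF _ um])
    show "integrable lborel (\<lambda>t. (e' + 2 * C) * norm (k t))" using k by simp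
    show "AE t in lborel. norm (u n t) \<le> norm ((e' + 2 * C) * norm (k t))"
      by (intro AE_I2 order_trans[OF ub]) simp
  qed
  have "(\<lambda>n. LINT t|lborel. u n t) \<longlonglongrightarrow> (LINT t|lborel. e' * norm (k t))"
  proof (rule integral_dominated_convergence[where w="\<lambda>t. (e' + 2 * C) * norm (k t)"])
    show "AE t in lborel. (\<lambda>n. u n t) \<longlonglongrightarrow> e' * norm (k t)"
    proof (rule AE_I2)
      fix t
      have "\<forall>\<^sub>F n in sequentially. norm (matrix_inv (A n) *v t) < d"
        using tendsto_norm[OF lim[of t]] d(1) by (intro order_tendstoD) auto
      then have "\<forall>\<^sub>F n in sequentially. u n t = e' * norm (k t)"
        by (rule eventually_mono) (simp add: u_def)
      then show "(\<lambda>n. u n t) \<longlonglongrightarrow> e' * norm (k t)" by (rule tendsto_eventually)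
    qed
  qed (use um ub k in auto)
  then have "\<forall>\<^sub>F n in sequentially. (LINT t|lborel. u n t) < \<epsilon>"
    using e'N by (intro order_tendstoD) auto
  then show ?thesis
  proof (rule eventually_mono)
    fix n assume n: "(LINT t|lborel. u n t) < \<epsilon>"
    let ?B = "matrix_inv (A n)"
    let ?f = "\<lambda>x. f (?B *v x) / \<rho> 0"
    \<comment> \<open>The average, written as a convolution with \<open>w\<close> in stretched
      coordinates; composing with \<open>A n\<close> turns spectrum in the cube into spectrum in the
      cell of \<open>A n\<close>.\<close>
    let ?g = "\<lambda>x. convolve ?f w (A n *v x)"
    have c: "continuous_on UNIV ?f"
      using at_0 by (intro continuous_intros continuous_on_compose2[OF fc matrix_vector_mult_linear_continuous_on]) auto
    have "convolve ?f w \<in> bandlimited (mat 1)"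
      by (rule convolve_w_bandlimited[OF c, of "C / norm (\<rho> 0)"]) (simp add: norm_divide divide_right_mono C)
    then have g: "?g \<in> bandlimited (A n)"
      using bandlimited_compose[OF _ A[of n]] by fastforce
    have "norm (f x - ?g x) \<le> \<epsilon>" for x
    proof -
      have g': "?g x = (LINT t|lborel. f (x - ?B *v t) * k t)"
        unfolding convolve_def by (simp add: matrix_vector_mult_diff_distrib matrix_inv_cancel[OF A] k_def)
      have i: "integrable lborel (\<lambda>t. f (x - ?B *v t) * k t)"
        by (rule integrable_mult_bounded(2)[OF k _ C]) simp
      have "f x - ?g x = (LINT t|lborel. f x * k t) - (LINT t|lborel. f (x - ?B *v t) * k t)"
        unfolding g' by (simp add: k1)
      also have "\<dots> = (LINT t|lborel. f x * k t - f (x - ?B *v t) * k t)"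
        using i k by simp
      also have "norm \<dots> \<le> (LINT t|lborel. norm (f x * k t - f (x - ?B *v t) * k t))"
        by (rule integral_norm_bound)
      also have "\<dots> \<le> (LINT t|lborel. u n t)"
      proof (rule integral_mono)
        fix t
        have "norm (f x - f (x - ?B *v t)) \<le> (if norm (?B *v t) < d then e' else 2 * C)"
        proof (cases "norm (?B *v t) < d")
          case True
          then show ?thesis using d(2)[of x "x - ?B *v t"] by (simp add: dist_norm)
        next
          case False
          then show ?thesis using norm_triangle_ineq4[of "f x" "f (x - ?B *v t)"] C[of x] C[of "x - ?B *v t"] by simp
        qed
        then show "norm (f x * k t - f (x - ?B *v t) * k t) \<le> u n t"
          unfolding u_def by (simp only: left_diff_distrib[symmetric] norm_mult) (intro mult_right_mono, simp_all)
      qed (use i k ui in auto)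
      finally show ?thesis using n by simp
    qed
    then show "\<exists>g\<in>bandlimited (A n). \<forall>x. norm (f x - g x) \<le> \<epsilon>"
      by (intro bexI[of _ ?g] g allI)
  qed
qed

end

section \<open>Powers of dilation matrices\<close>

lemma recurrence_tendsto_0:
  fixes y :: "nat \<Rightarrow> complex"
  assumes z: "norm z < 1" and lim: "(\<lambda>n. y (Suc n) - z * y n) \<longlonglongrightarrow> 0"
  shows "y \<longlonglongrightarrow> 0"
proof (rule LIMSEQ_I)
  fix e :: real assume e: "e > 0"
  \<comment> \<open>Chosen so that \<open>e / 2\<close> is the fixed point of b = ?d + |z| b; the
    bound below then reproduces itself under the recursion.\<close>
  let ?d = "e / 2 * (1 - norm z)"
  have "?d > 0" using e z by simp
  from LIMSEQ_D[OF lim this] obtain N where N: "\<And>n. n \<ge> N \<Longrightarrow> norm (y (Suc n) - z * y n) < ?d" by auto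
  have bound: "norm (y (N + k)) \<le> norm z ^ k * norm (y N) + e / 2" for k
  proof (induction k)
    case (Suc k)
    have "norm (y (N + Suc k)) \<le> norm (y (Suc (N + k)) - z * y (N + k)) + norm z * norm (y (N + k))"
      using norm_triangle_ineq[of "y (Suc (N + k)) - z * y (N + k)" "z * y (N + k)"] by (simp add: norm_mult)
    also have "\<dots> \<le> ?d + norm z * (norm z ^ k * norm (y N) + e / 2)"
      using N[of "N + k"] Suc by (intro add_mono mult_left_mono) auto
    also have "\<dots> = norm z ^ Suc k * norm (y N) + e / 2" by (simp add: field_simps)
    finally show ?case .
  qed (use e in simp)
  have "(\<lambda>k. norm z ^ k * norm (y N)) \<longlonglongrightarrow> 0 * norm (y N)"
    using z by (intro tendsto_intros LIMSEQ_power_zero) simp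
  then obtain K where K: "\<And>k. k \<ge> K \<Longrightarrow> norm z ^ k * norm (y N) < e / 2"
    using e order_tendstoD(2)[of _ 0 sequentially "e / 2"] unfolding eventually_sequentially by auto
  show "\<exists>no. \<forall>n\<ge>no. norm (y n - 0) < e"
  proof (intro exI allI impI)
    fix n assume n: "n \<ge> N + K"
    then have "norm z ^ (n - N) * norm (y N) < e / 2" by (intro K) simp
    then show "norm (y n - 0) < e" using bound[of "n - N"] n by simp
  qed
qed

text \<open>The polynomial \<open>p\<close> evaluated at the shift operator and applied to the
  sequence \<open>x\<close>.\<close>

definition shift_poly :: "complex poly \<Rightarrow> (nat \<Rightarrow> complex) \<Rightarrow> nat \<Rightarrow> complex" where
  "shift_poly p x n = (\<Sum>k\<le>degree p. coeff p k * x (n + k))"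

lemma shift_poly_bound:
  assumes "degree p \<le> N" shows "shift_poly p x n = (\<Sum>k\<le>N. coeff p k * x (n + k))"
  unfolding shift_poly_def by (rule sum.mono_neutral_left) (use assms in \<open>auto simp: coeff_eq_0\<close>)

lemma shift_poly_linear_factor:
  "shift_poly ([:- z, 1:] * q) x n = shift_poly q x (Suc n) - z * shift_poly q x n"
proof -
  let ?N = "degree q"
  have "degree ([:- z, 1:] * q) \<le> Suc ?N"
    using degree_mult_le[of "[:- z, 1:]" q] by simp
  then have "shift_poly ([:- z, 1:] * q) x n = (\<Sum>k\<le>Suc ?N. (coeff (pCons 0 q) k - z * coeff q k) * x (n + k))"
    by (simp add: shift_poly_bound del: sum.atMost_Suc)
  also have "\<dots> = (\<Sum>k\<le>Suc ?N. coeff (pCons 0 q) k * x (n + k)) - (\<Sum>k\<le>Suc ?N. z * (coeff q k * x (n + k)))"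
    by (simp only: left_diff_distrib sum_subtractf mult.assoc)
  also have "(\<Sum>k\<le>Suc ?N. coeff (pCons 0 q) k * x (n + k)) = shift_poly q x (Suc n)"
    by (simp add: sum.atMost_Suc_shift shift_poly_def del: sum.atMost_Suc)
  also have "(\<Sum>k\<le>Suc ?N. z * (coeff q k * x (n + k))) = z * shift_poly q x n"
    by (simp only: sum_distrib_left[symmetric] shift_poly_bound[of q "Suc ?N"] le_SucI order_refl)
  finally show ?thesis .
qed

text \<open>Linear factors are peeled off one at a time. If \<open>p\<close> is (X - z) q, then the
  sequence \<open>shift_poly q x\<close> satisfies a first-order recurrence with ratio z and a
  perturbation tending to zero, so it tends to zero as well, and the degree has dropped.\<close>

lemma shift_poly_tendsto_0:
  assumes "p \<noteq> 0" "\<And>z. poly p z = 0 \<Longrightarrow> norm z < 1" "shift_poly p x \<longlonglongrightarrow> 0"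
  shows "x \<longlonglongrightarrow> 0"
  using assms
proof (induction "degree p" arbitrary: p rule: less_induct)
  case less
  show ?case
  proof (cases "degree p = 0")
    case True
    then obtain a where a: "p = [:a:]" using degree_eq_zeroE by blast
    have "(\<lambda>n. inverse a * shift_poly p x n) \<longlonglongrightarrow> inverse a * 0"
      by (intro tendsto_intros less.prems(3))
    then show ?thesis using a less.prems(1) by (simp add: shift_poly_def)
  next
    case False
    then obtain z where z: "poly p z = 0"
      using fundamental_theorem_of_algebra[of p] by (auto simp: constant_degree)
    then obtain q where q: "p = [:- z, 1:] * q" by (auto simp: poly_eq_0_iff_dvd)
    have q0: "q \<noteq> 0" using q less.prems(1) by auto
    have "degree q < degree p" using q0 unfolding q by (subst degree_mult_eq) auto
    moreover have "norm r < 1" if "poly q r = 0" for r using less.prems(2)[of r] that unfolding q by simp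
    moreover have "shift_poly q x \<longlonglongrightarrow> 0"
      using less.prems(3) unfolding q shift_poly_linear_factor[abs_def]
      by (rule recurrence_tendsto_0[OF less.prems(2)[OF z]])
    ultimately show ?thesis using less.hyps q0 by blast
  qed
qed

section \<open>Matrix powers and the decay of inverse powers\<close>

lemma matpow_0 [simp]: "matpow A 0 = mat 1"
  and matpow_Suc: "matpow A (Suc n) = A ** matpow A n"
  by (simp_all add: matpow_def)

lemma matpow_add: "matpow A (m + n) = matpow A m ** matpow A n"
  by (induction m) (simp_all add: matpow_Suc matrix_mul_assoc)

lemma matpow_Suc': "matpow A (Suc n) = matpow A n ** A"
  using matpow_add[of A n 1] by (simp add: matpow_Suc)

lemma invertible_matpow: "invertible A \<Longrightarrow> invertible (matpow A n)"
proof (induction n)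
  case 0
  show ?case unfolding invertible_def by (rule exI[of _ "mat 1"]) simp
qed (simp add: matpow_Suc invertible_mult)

lemma matrix_inv_unique:
  fixes A :: "real^'n^'n"
  assumes "A ** B = mat 1" shows "matrix_inv A = B"
proof -
  have "B ** A = mat 1" using assms matrix_left_right_inverse by blast
  then have A: "invertible A" using assms by (auto simp: invertible_def)
  have "matrix_inv A = matrix_inv A ** (A ** B)" by (simp add: assms)
  also have "\<dots> = (matrix_inv A ** A) ** B" by (simp add: matrix_mul_assoc)
  also have "matrix_inv A ** A = mat 1"
    by (simp add: matrix_eq matrix_inv_cancel[OF A] flip: matrix_vector_mul_assoc)
  finally show ?thesis by simp
qed

lemma matrix_inv_matpow:
  fixes A :: "real^'n^'n"
  assumes A: "invertible A"
  shows "matrix_inv (matpow A n) = matpow (matrix_inv A) n"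
proof (rule matrix_inv_unique)
  have AB: "A ** matrix_inv A = mat 1"
    by (simp add: matrix_eq matrix_inv_cancel[OF A] flip: matrix_vector_mul_assoc)
  show "matpow A n ** matpow (matrix_inv A) n = mat 1"
  proof (induction n)
    case (Suc n)
    have "matpow A (Suc n) ** matpow (matrix_inv A) (Suc n) = matpow A n ** (A ** matrix_inv A) ** matpow (matrix_inv A) n"
      by (simp only: matpow_Suc' [of A] matpow_Suc[of "matrix_inv A"] matrix_mul_assoc)
    then show ?case using Suc by (simp add: AB)
  qed simp
qed

abbreviation complex_matrix :: "real^'n^'n \<Rightarrow> complex^'n^'n" where
  "complex_matrix \<equiv> map_matrix complex_of_real"

lemma complex_matrix_mult_vec: "(complex_matrix A *v v) $ i = (\<Sum>j\<in>UNIV. complex_of_real (A $ i $ j) * v $ j)"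
  by (simp add: matrix_vector_mult_def map_matrix_def)

lemma complex_matrix_mult: "complex_matrix (A ** B) = complex_matrix A ** complex_matrix B"
  by (simp add: vec_eq_iff matrix_matrix_mult_def map_matrix_def)

lemma complex_matrix_mat: "complex_matrix (mat 1) = mat 1"
  by (simp add: vec_eq_iff mat_def map_matrix_def)

text \<open>A kernel vector would make 0 an eigenvalue, and 0 has modulus below one.\<close>

lemma dilation_invertible:
  assumes "dilation_matrix A" shows "invertible A"
proof (rule ccontr)
  assume "\<not> invertible A"
  then obtain v where v: "v \<noteq> 0" "A *v v = 0"
    using matrix_left_invertible_ker matrix_left_right_inverse unfolding invertible_def by metis
  let ?v = "\<chi> i. complex_of_real (v $ i)"
  have "(complex_matrix A *v ?v) $ i = complex_of_real ((A *v v) $ i)" for i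
    by (simp add: complex_matrix_mult_vec) (simp add: matrix_vector_mult_def)
  then have "complex_matrix A *v ?v = 0 *s ?v" using v by (simp add: vec_eq_iff)
  moreover have "?v \<noteq> 0" using v by (auto simp: vec_eq_iff)
  ultimately have "complex_eigenvalue A 0" unfolding complex_eigenvalue_def by blast
  then show False using assms by (auto simp: dilation_matrix_def)
qed

text \<open>There is one vector more than the dimension. Linear dependence is a notion for sets, so
  a repeated vector is treated separately: there the coefficients 1 and -1 do.\<close>

lemma annihilating_coefficients:
  fixes r :: "nat \<Rightarrow> 'a::euclidean_space"
  obtains c :: "nat \<Rightarrow> real" and N j where "j \<le> N" "c j \<noteq> 0" "(\<Sum>k\<le>N. c k *\<^sub>R r k) = 0"
proof (cases "inj_on r {..DIM('a)}")
  case True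
  let ?N = "DIM('a)"
  have "card (r ` {..?N}) > ?N" using card_image[OF True] by simp
  then have "dependent (r ` {..?N})" using independent_bound by (metis not_le)
  then obtain u v where u: "v \<in> r ` {..?N}" "u v \<noteq> 0" "(\<Sum>v\<in>r ` {..?N}. u v *\<^sub>R v) = 0"
    unfolding dependent_finite[OF finite_imageI[OF finite_atMost]] by blast
  then obtain j where "j \<le> ?N" "u (r j) \<noteq> 0" by auto
  moreover have "(\<Sum>k\<le>?N. u (r k) *\<^sub>R r k) = 0" using u(3) by (simp add: sum.reindex[OF True])
  ultimately show thesis using that[of j ?N "\<lambda>k. u (r k)"] by simp
next
  case False
  then obtain i j where ij: "i \<le> DIM('a)" "j \<le> DIM('a)" "i \<noteq> j" "r i = r j" by (auto simp: inj_on_def)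
  let ?c = "\<lambda>k. if k = i then 1 else if k = j then - 1 else (0::real)"
  have "(\<Sum>k\<le>DIM('a). ?c k *\<^sub>R r k) = (\<Sum>k\<in>{i, j}. ?c k *\<^sub>R r k)"
    by (rule sum.mono_neutral_right) (use ij in auto)
  also have "\<dots> = 0" using ij by simp
  finally show thesis using that[of i "DIM('a)" ?c] ij by simp
qed

text \<open>The minimal annihilating polynomial of \<open>v\<close> has only eigenvalues as roots, so the orbit satisfies a
  linear recurrence all of whose characteristic roots are smaller than one in modulus.\<close>

lemma dilation_inverse_powers_tendsto_0:
  fixes M :: "real^'n^'n" and v :: "real^'n"
  assumes M: "dilation_matrix M"
  shows "(\<lambda>n. matrix_inv (matpow M n) *v v) \<longlonglongrightarrow> 0"
proof -
  have inv: "invertible M" by (rule dilation_invertible[OF M])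
  let ?B = "matrix_inv M"
  define r where "r n = matpow ?B n *v v" for n
  have r_Suc: "r (Suc n) = ?B *v r n" for n by (simp add: r_def matpow_Suc matrix_vector_mul_assoc)
  define x where "x i n = complex_of_real (r n $ i)" for i n
  \<comment> \<open>With B the inverse of M, \<open>W p n\<close> is the complex vector p(B) B^n
    v.\<close>
  define W where "W p n = (\<chi> i. shift_poly p (x i) n)" for p n
  have x_Suc: "x i (Suc n) = (\<Sum>j\<in>UNIV. complex_of_real (?B $ i $ j) * x j n)" for i n
    by (simp add: x_def r_Suc) (simp add: matrix_vector_mult_def)
  have W_Suc: "W p (Suc n) = complex_matrix ?B *v W p n" for p n
  proof -
    have "(\<Sum>k\<le>degree p. coeff p k * (\<Sum>j\<in>UNIV. complex_of_real (?B $ i $ j) * x j (n + k))) =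
      (\<Sum>j\<in>UNIV. complex_of_real (?B $ i $ j) * (\<Sum>k\<le>degree p. coeff p k * x j (n + k)))" for i
      unfolding sum_distrib_left by (subst sum.swap) (simp add: mult_ac)
    then show ?thesis
      by (simp add: vec_eq_iff W_def complex_matrix_mult_vec shift_poly_def x_Suc)
  qed
  have W0: "W p n = 0" if "W p 0 = 0" for p n
    by (induction n) (simp_all add: that W_Suc matrix_vector_mult_0_right)
  have "\<exists>p. p \<noteq> 0 \<and> W p 0 = 0"
  proof -
    obtain c N j where c: "j \<le> N" "c j \<noteq> 0" "(\<Sum>k\<le>N. c k *\<^sub>R r k) = 0"
      by (rule annihilating_coefficients[of r])
    let ?p = "\<Sum>k\<le>N. monom (complex_of_real (c k)) k"
    have co: "coeff ?p k = (if k \<le> N then complex_of_real (c k) else 0)" for k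
      by (simp add: coeff_sum)
    have "degree ?p \<le> N" by (rule degree_le) (simp add: co)
    then have "shift_poly ?p (x i) 0 = complex_of_real ((\<Sum>k\<le>N. c k *\<^sub>R r k) $ i)" for i
      by (simp add: shift_poly_bound[of _ N] co x_def del: coeff_sum)
    then have "W ?p 0 = 0" by (simp add: W_def c(3) vec_eq_iff)
    moreover have "?p \<noteq> 0" using co[of j] c by (metis coeff_0 of_real_eq_0_iff)
    ultimately show ?thesis by blast
  qed
  \<comment> \<open>Minimality of the degree ensures that removing a root z from \<open>p\<close>
    leaves a factor \<open>q\<close> with \<open>W q 0\<close> nonzero. This vector is an
    eigenvector of B for z, hence one of M for 1/z.\<close>
  then obtain p where p: "p \<noteq> 0" "W p 0 = 0" "\<And>q. q \<noteq> 0 \<Longrightarrow> W q 0 = 0 \<Longrightarrow> degree p \<le> degree q"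
    using ex_has_least_nat[of "\<lambda>p. p \<noteq> 0 \<and> W p 0 = 0" _ degree] by blast
  have root: "norm z < 1" if z: "poly p z = 0" for z
  proof -
    obtain q where q: "p = [:- z, 1:] * q" using z by (auto simp: poly_eq_0_iff_dvd)
    have q0: "q \<noteq> 0" using q p(1) by auto
    have "degree q < degree p" using q0 unfolding q by (subst degree_mult_eq) auto
    then have w0: "W q 0 \<noteq> 0" using p(3)[OF q0] by auto
    have "W p 0 = W q (Suc 0) - z *s W q 0"
      by (simp add: vec_eq_iff W_def q shift_poly_linear_factor del: mult_pCons_left)
    then have eig: "complex_matrix ?B *v W q 0 = z *s W q 0" using p(2) by (simp add: W_Suc)
    have "complex_matrix M ** complex_matrix ?B = mat 1"
    proof -
      have "M ** ?B = mat 1" by (simp add: matrix_eq matrix_inv_cancel[OF inv] flip: matrix_vector_mul_assoc)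
      then show ?thesis by (simp flip: complex_matrix_mult add: complex_matrix_mat)
    qed
    then have "W q 0 = complex_matrix M *v (complex_matrix ?B *v W q 0)"
      by (simp add: matrix_vector_mul_assoc)
    also have "\<dots> = z *s (complex_matrix M *v W q 0)" by (simp add: eig vec.scale)
    finally have *: "W q 0 = z *s (complex_matrix M *v W q 0)" .
    then have z0: "z \<noteq> 0" using w0 by auto
    have "(1 / z) *s W q 0 = (1 / z) *s (z *s (complex_matrix M *v W q 0))" using * by simp
    then have "complex_matrix M *v W q 0 = (1 / z) *s W q 0" using z0 by simp
    then have "complex_eigenvalue M (1 / z)" using w0 unfolding complex_eigenvalue_def by blast
    then have "norm (1 / z) > 1" using M by (simp add: dilation_matrix_def)
    then show ?thesis using z0 by (simp add: norm_divide)
  qed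
  have lim: "x i \<longlonglongrightarrow> 0" for i
  proof (rule shift_poly_tendsto_0[OF p(1) root])
    \<comment> \<open>p(B) v = 0 implies p(B) B^n v = 0 for all n, so every coordinate of the orbit
      satisfies the recurrence exactly.\<close>
    have "shift_poly p (x i) = (\<lambda>n. 0)" using W0[OF p(2)] by (intro ext) (simp add: W_def vec_eq_iff)
    then show "shift_poly p (x i) \<longlonglongrightarrow> 0" by simp
  qed
  have "(\<lambda>n. r n $ i) \<longlonglongrightarrow> 0" for i
    using tendsto_Re[OF lim[of i]] by (simp add: x_def)
  then have "r \<longlonglongrightarrow> 0" by (intro vec_tendstoI) simp
  then show ?thesis by (simp add: r_def[abs_def] matrix_inv_matpow[OF inv])
qed

text \<open>Transposition reverses the product, so a factor on the left of \<open>B\<close> acts on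
  the cube first.\<close>

lemma freq_cell_mono:
  fixes A B :: "real^'n^'n"
  assumes "unit_cube \<subseteq> freq_cell A"
  shows "freq_cell B \<subseteq> freq_cell (A ** B)"
proof -
  have "freq_cell (A ** B) = (*v) (transpose B) ` freq_cell A"
    by (simp add: matrix_transpose_mul image_image matrix_vector_mul_assoc)
  then show ?thesis using assms by auto
qed

text \<open>The inclusion says that the inverse of the transposed matrix maps the cube into \<delta>
  times the cube. In the maximum norm this holds once all column sums of absolute entries of the
  inverse power are below \<delta>, and these finitely many sums tend to zero.\<close>

lemma eventually_unit_cube_subset:
  fixes M :: "real^'n^'n"
  assumes M: "dilation_matrix M" and d: "\<delta> > 0"
  obtains s where "\<And>n. n \<ge> s \<Longrightarrow> unit_cube \<subseteq> freq_cell (\<delta> *\<^sub>R matpow M n)"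
proof -
  have inv: "invertible M" by (rule dilation_invertible[OF M])
  let ?B = "\<lambda>n. matrix_inv (matpow M n)"
  have "(\<lambda>n. \<Sum>i\<in>UNIV. \<bar>?B n $ i $ j\<bar>) \<longlonglongrightarrow> (\<Sum>i\<in>(UNIV::'n set). \<bar>0\<bar>)" for j
  proof (intro tendsto_sum tendsto_rabs)
    fix i
    have "(\<lambda>n. (?B n *v axis j 1) $ i) \<longlonglongrightarrow> 0 $ i"
      by (intro tendsto_vec_nth dilation_inverse_powers_tendsto_0[OF M])
    then show "(\<lambda>n. ?B n $ i $ j) \<longlonglongrightarrow> 0" by (simp add: matrix_vector_mul_component inner_axis)
  qed
  then have "\<forall>\<^sub>F n in sequentially. (\<Sum>i\<in>UNIV. \<bar>?B n $ i $ j\<bar>) < \<delta>" for j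
    using d by (intro order_tendstoD(2)[of _ 0]) auto
  then have "\<forall>\<^sub>F n in sequentially. \<forall>j. (\<Sum>i\<in>UNIV. \<bar>?B n $ i $ j\<bar>) < \<delta>"
    by (rule eventually_all_finite)
  then obtain s where s: "\<And>n j. n \<ge> s \<Longrightarrow> (\<Sum>i\<in>UNIV. \<bar>?B n $ i $ j\<bar>) < \<delta>"
    unfolding eventually_sequentially by blast
  show thesis
  proof (rule that, rule subsetI)
    fix n x assume n: "n \<ge> s" and x: "x \<in> (unit_cube :: (real^'n) set)"
    \<comment> \<open>The preimage of \<open>x\<close> under the transpose of
      \<open>\<delta> *\<^sub>R matpow M n\<close>.\<close>
    let ?y = "(1 / \<delta>) *\<^sub>R (transpose (?B n) *v x)"
    have "\<bar>(transpose (?B n) *v x) $ j\<bar> \<le> \<delta> * (1/2)" for j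
    proof -
      have "\<bar>(transpose (?B n) *v x) $ j\<bar> \<le> (\<Sum>i\<in>UNIV. \<bar>?B n $ i $ j * x $ i\<bar>)"
        by (simp add: matrix_vector_mult_def transpose_def sum_abs)
      also have "\<dots> \<le> (\<Sum>i\<in>UNIV. \<bar>?B n $ i $ j\<bar> * (1/2))"
        unfolding abs_mult using x by (intro sum_mono mult_left_mono) (auto simp: unit_cube_def)
      also have "\<dots> = (\<Sum>i\<in>UNIV. \<bar>?B n $ i $ j\<bar>) * (1/2)" by (simp add: sum_distrib_right)
      also have "\<dots> \<le> \<delta> * (1/2)" using s[OF n, of j] by simp
      finally show ?thesis .
    qed
    then have "\<bar>?y $ j\<bar> \<le> 1/2" for j
      using d by (simp add: abs_mult pos_divide_le_eq mult.commute[of \<delta>])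
    then have y: "?y \<in> unit_cube" by (simp add: unit_cube_def)
    have "transpose (\<delta> *\<^sub>R matpow M n) *v ?y = transpose (matpow M n) *v (transpose (?B n) *v x)"
      using d by (simp add: transpose_scalar matrix_vector_mult_scaleR scaleR_matrix_vector_assoc[symmetric])
    also have "\<dots> = transpose (?B n ** matpow M n) *v x"
      by (simp only: matrix_transpose_mul matrix_vector_mul_assoc)
    also have "?B n ** matpow M n = mat 1"
      by (simp add: matrix_eq matrix_inv_cancel[OF invertible_matpow[OF inv]] flip: matrix_vector_mul_assoc)
    finally have "transpose (\<delta> *\<^sub>R matpow M n) *v ?y = x" by (simp add: transpose_mat)
    then show "x \<in> freq_cell (\<delta> *\<^sub>R matpow M n)" using y by (intro image_eqI[of _ _ ?y]) simp_all
  qed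
qed

section \<open>Fourier coefficients on the unit cube\<close>

lemma int_lattice_simps:
  "0 \<in> int_lattice" "k \<in> int_lattice \<Longrightarrow> l \<in> int_lattice \<Longrightarrow> k + l \<in> int_lattice"
  "k \<in> int_lattice \<Longrightarrow> l \<in> int_lattice \<Longrightarrow> k - l \<in> int_lattice"
  by (simp_all add: int_lattice_def)

lemma countable_int_lattice: "countable (int_lattice :: (real^'n) set)"
proof -
  have "(int_lattice :: (real^'n) set) \<subseteq> (\<lambda>f. \<chi> i. real_of_int (f i)) ` (UNIV :: ('n \<Rightarrow> int) set)"
  proof
    fix k :: "real^'n" assume k: "k \<in> int_lattice"
    have "k = (\<chi> i. real_of_int (\<lfloor>k $ i\<rfloor>))"
      using k by (simp add: int_lattice_def vec_eq_iff of_int_floor_cancel)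
    then show "k \<in> (\<lambda>f. \<chi> i. real_of_int (f i)) ` UNIV"
      by (intro image_eqI[of _ _ "\<lambda>i. \<lfloor>k $ i\<rfloor>"]) simp_all
  qed
  then show ?thesis by (rule countable_subset) (simp add: countable_image)
qed

lemma infinite_int_lattice: "infinite (int_lattice :: (real^'n) set)"
proof
  assume "finite (int_lattice :: (real^'n) set)"
  moreover have "range (\<lambda>n::nat. \<chi> i. real n) \<subseteq> (int_lattice :: (real^'n) set)" by (auto simp: int_lattice_def)
  moreover have "inj (\<lambda>n::nat. \<chi> i. real n :: real^'n)" by (auto simp: inj_on_def vec_eq_iff)
  ultimately show False using finite_subset range_inj_infinite by blast
qed

abbreviation lattice_enum :: "nat \<Rightarrow> real^'n" where
  "lattice_enum \<equiv> from_nat_into int_lattice"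

lemma bij_lattice_enum: "bij_betw lattice_enum UNIV (int_lattice :: (real^'n) set)"
  by (rule bij_betw_from_nat_into[OF countable_int_lattice infinite_int_lattice])

lemma lattice_enum_in: "lattice_enum n \<in> int_lattice"
  using bij_lattice_enum bij_betwE by blast

text \<open>Absolute summability identifies the unordered sum with the series along the enumeration,
  to which the theorems on series apply.\<close>

lemma infsum_int_lattice:
  fixes g :: "real^'n \<Rightarrow> complex"
  assumes "summable (\<lambda>n. norm (g (lattice_enum n)))"
  shows "infsum g int_lattice = (\<Sum>n. g (lattice_enum n))"
proof -
  have "((\<lambda>n. g (lattice_enum n)) has_sum (\<Sum>n. g (lattice_enum n))) UNIV"
    using assms by (intro norm_summable_imp_has_sum summable_sums) (auto dest: summable_norm_cancel)
  then have "infsum (\<lambda>n. g (lattice_enum n)) UNIV = (\<Sum>n. g (lattice_enum n))" by (rule infsumI)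
  then show ?thesis using infsum_reindex_bij_betw[OF bij_lattice_enum, of g] by simp
qed

lemma unit_cube_iff: "x \<in> unit_cube \<longleftrightarrow> (\<forall>i. x $ i \<in> {- 1/2 .. 1/2})"
  unfolding unit_cube_cbox mem_box_cart by simp

section \<open>Uniqueness of Fourier coefficients\<close>

definition cube_integral :: "(real^'n \<Rightarrow> complex) \<Rightarrow> complex" where
  "cube_integral f = (LINT \<xi>|lborel. indicator unit_cube \<xi> *\<^sub>R f \<xi>)"

lemma cube_integrable:
  fixes f :: "real^'n \<Rightarrow> 'b::euclidean_space"
  shows "continuous_on UNIV f \<Longrightarrow> integrable lborel (\<lambda>\<xi>. indicator unit_cube \<xi> *\<^sub>R f \<xi>)"
  by (rule borel_integrable_compact[OF compact_unit_cube]) (rule continuous_on_subset, auto)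

lemma cube_measurable [measurable]: "unit_cube \<in> sets borel"
  by (simp add: closed_unit_cube)

lemma emeasure_unit_cube: "emeasure lborel (unit_cube :: (real^'n) set) = 1"
  by (auto simp: unit_cube_cbox emeasure_lborel_cbox_eq Basis_vec_def inner_axis intro!: prod.neutral)

lemma measure_unit_cube: "measure lborel (unit_cube :: (real^'n) set) = 1"
  by (simp add: measure_def emeasure_unit_cube)

text \<open>The function is continuous on the whole space, not periodic; only its restriction to the
  cube enters the coefficients. The sign in the exponent is immaterial, the lattice being
  symmetric.\<close>

definition coefficient_free :: "(real^'n \<Rightarrow> complex) \<Rightarrow> bool" where
  "coefficient_free f \<longleftrightarrow> continuous_on UNIV f \<and>
    (\<forall>k\<in>int_lattice. cube_integral (\<lambda>\<xi>. f \<xi> * cis (2 * pi * (k \<bullet> \<xi>))) = 0)"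

text \<open>Multiplying by a lattice character shifts the coefficients. Together with additivity
  this makes the class stable under multiplication by trigonometric polynomials.\<close>

lemma coefficient_free_cis:
  assumes f: "coefficient_free f" and k: "k \<in> int_lattice"
  shows "coefficient_free (\<lambda>\<xi>. f \<xi> * (c * cis (2 * pi * (k \<bullet> \<xi>))))"
  unfolding coefficient_free_def
proof (intro conjI ballI)
  show "continuous_on UNIV (\<lambda>\<xi>. f \<xi> * (c * cis (2 * pi * (k \<bullet> \<xi>))))"
    using f by (intro continuous_intros) (auto simp: coefficient_free_def)
  fix l :: "real^'a" assume l: "l \<in> int_lattice"
  have "cube_integral (\<lambda>\<xi>. f \<xi> * (c * cis (2 * pi * (k \<bullet> \<xi>))) * cis (2 * pi * (l \<bullet> \<xi>))) =
    (LINT \<xi>|lborel. c * (indicator unit_cube \<xi> *\<^sub>R (f \<xi> * cis (2 * pi * ((k + l) \<bullet> \<xi>)))))"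
    unfolding cube_integral_def
    by (intro Bochner_Integration.integral_cong) (simp_all add: inner_add_left distrib_left cis_mult[symmetric] mult_ac)
  also have "\<dots> = c * cube_integral (\<lambda>\<xi>. f \<xi> * cis (2 * pi * ((k + l) \<bullet> \<xi>)))"
    unfolding cube_integral_def by (rule integral_mult_right_zero)
  also have "\<dots> = 0"
    using f int_lattice_simps(2)[OF k l] by (simp add: coefficient_free_def)
  finally show "cube_integral (\<lambda>\<xi>. f \<xi> * (c * cis (2 * pi * (k \<bullet> \<xi>))) * cis (2 * pi * (l \<bullet> \<xi>))) = 0" .
qed

lemma coefficient_free_add:
  assumes f: "coefficient_free f" and g: "coefficient_free g"
  shows "coefficient_free (\<lambda>\<xi>. f \<xi> + g \<xi>)"
  unfolding coefficient_free_def
proof (intro conjI ballI)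
  have c: "continuous_on UNIV f" "continuous_on UNIV g" using f g by (auto simp: coefficient_free_def)
  show "continuous_on UNIV (\<lambda>\<xi>. f \<xi> + g \<xi>)" by (intro continuous_intros c)
  fix k :: "real^'a" assume k: "k \<in> int_lattice"
  have "cube_integral (\<lambda>\<xi>. (f \<xi> + g \<xi>) * cis (2 * pi * (k \<bullet> \<xi>))) =
     (LINT \<xi>|lborel. indicator unit_cube \<xi> *\<^sub>R (f \<xi> * cis (2 * pi * (k \<bullet> \<xi>))) + indicator unit_cube \<xi> *\<^sub>R (g \<xi> * cis (2 * pi * (k \<bullet> \<xi>))))"
    unfolding cube_integral_def by (simp add: distrib_right scaleR_right_distrib)
  also have "\<dots> = cube_integral (\<lambda>\<xi>. f \<xi> * cis (2 * pi * (k \<bullet> \<xi>))) + cube_integral (\<lambda>\<xi>. g \<xi> * cis (2 * pi * (k \<bullet> \<xi>)))"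
    unfolding cube_integral_def
    by (rule Bochner_Integration.integral_add) (intro cube_integrable continuous_intros c)+
  also have "\<dots> = 0" using f g k by (simp add: coefficient_free_def)
  finally show "cube_integral (\<lambda>\<xi>. (f \<xi> + g \<xi>) * cis (2 * pi * (k \<bullet> \<xi>))) = 0" .
qed

text \<open>This is the product of cos^2(pi (\<xi>_i - y_i)), a trigonometric polynomial with values
  between 0 and 1 that peaks at \<open>y\<close>.\<close>

definition raised_cosine :: "real^'n \<Rightarrow> real^'n \<Rightarrow> real" where
  "raised_cosine y \<xi> = (\<Prod>i\<in>UNIV. (1 + cos (2 * pi * (\<xi> $ i - y $ i))) / 2)"

lemma coefficient_free_cosine:
  assumes f: "coefficient_free f"
  shows "coefficient_free (\<lambda>\<xi>. f \<xi> * complex_of_real ((1 + cos (2 * pi * (\<xi> $ i - y $ i))) / 2))"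
proof -
  have "complex_of_real ((1 + cos (2 * pi * (\<xi> $ i - y $ i))) / 2) =
    (1/2) * cis (2 * pi * (0 \<bullet> \<xi>)) + (cis (- 2 * pi * y $ i) / 4) * cis (2 * pi * (axis i 1 \<bullet> \<xi>)) +
    (cis (2 * pi * y $ i) / 4) * cis (2 * pi * (axis i (- 1) \<bullet> \<xi>))" for \<xi>
    by (simp add: complex_eq_iff inner_axis' cos_diff right_diff_distrib field_simps)
  then have "(\<lambda>\<xi>. f \<xi> * complex_of_real ((1 + cos (2 * pi * (\<xi> $ i - y $ i))) / 2)) =
    (\<lambda>\<xi>. f \<xi> * ((1/2) * cis (2 * pi * (0 \<bullet> \<xi>))) + f \<xi> * ((cis (- 2 * pi * y $ i) / 4) * cis (2 * pi * (axis i 1 \<bullet> \<xi>))) +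
    f \<xi> * ((cis (2 * pi * y $ i) / 4) * cis (2 * pi * (axis i (- 1) \<bullet> \<xi>))))"
    by (simp only: distrib_left)
  then show ?thesis
    by (simp only:) (intro coefficient_free_add coefficient_free_cis f; auto simp: int_lattice_def axis_def)
qed

lemma coefficient_free_raised_cosine:
  assumes f: "coefficient_free f"
  shows "coefficient_free (\<lambda>\<xi>. f \<xi> * complex_of_real (\<epsilon> + raised_cosine y \<xi>))"
proof -
  have *: "coefficient_free (\<lambda>\<xi>. f \<xi> * complex_of_real (\<Prod>i\<in>I. (1 + cos (2 * pi * (\<xi> $ i - y $ i))) / 2))" if "finite I" for I
    using that
  proof (induction I)
    case empty then show ?case using f by simp
  next
    case (insert i I)
    then show ?case
      using coefficient_free_cosine[OF insert.IH, of i y] by (simp add: mult_ac)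
  qed
  have "coefficient_free (\<lambda>\<xi>. f \<xi> * (complex_of_real \<epsilon> * cis (2 * pi * (0 \<bullet> \<xi>))))"
    by (rule coefficient_free_cis[OF f]) (simp add: int_lattice_simps)
  from coefficient_free_add[OF this *[OF finite, of UNIV]] show ?thesis
    by (simp add: raised_cosine_def distrib_left)
qed

lemma coefficient_free_power:
  assumes f: "coefficient_free f"
  shows "coefficient_free (\<lambda>\<xi>. f \<xi> * complex_of_real ((\<epsilon> + raised_cosine y \<xi>) ^ N))"
proof (induction N)
  case (Suc N)
  then show ?case using coefficient_free_raised_cosine[OF Suc, of \<epsilon> y] by (simp add: mult_ac)
qed (use f in simp)

lemma half_cos_bounds:
  fixes t :: real
  shows "0 \<le> (1 + cos t) / 2" "(1 + cos t) / 2 \<le> 1"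
proof -
  show "0 \<le> (1 + cos t) / 2" using add_left_mono[OF cos_ge_minus_one[of t], of 1] by simp
  show "(1 + cos t) / 2 \<le> 1" using cos_le_one[of t] by simp
qed

lemma raised_cosine_bounds: "0 \<le> raised_cosine y \<xi>" "raised_cosine y \<xi> \<le> 1"
  unfolding raised_cosine_def by (auto intro!: prod_nonneg prod_le_1 half_cos_bounds simp del: divide_le_eq_numeral1)

lemma continuous_raised_cosine: "continuous_on S (raised_cosine y)"
  unfolding raised_cosine_def[abs_def] by (intro continuous_intros) auto

text \<open>A factor equals 1 only at an integer difference of coordinates. For \<open>y\<close> in
  the interior and \<xi> in the cube the differences are below 1 in modulus, so the integer is 0;
  for \<open>y\<close> on a face there would be a second peak on the opposite face.\<close>

lemma raised_cosine_less_1: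
  fixes y \<xi> :: "real^'n"
  assumes "\<xi> \<in> unit_cube" "\<And>i. \<bar>y $ i\<bar> < 1/2" "\<xi> \<noteq> y"
  shows "raised_cosine y \<xi> < 1"
proof -
  obtain i where i: "\<xi> $ i \<noteq> y $ i" using assms(3) by (auto simp: vec_eq_iff)
  let ?q = "\<lambda>i. (1 + cos (2 * pi * (\<xi> $ i - y $ i))) / 2"
  have q: "0 \<le> ?q j" "?q j \<le> 1" for j by (rule half_cos_bounds)+
  have lt: "\<bar>\<xi> $ i - y $ i\<bar> < 1"
    using assms(1) assms(2)[of i] unfolding unit_cube_def by (auto dest!: spec[of _ i])
  have "cos (2 * pi * (\<xi> $ i - y $ i)) \<noteq> 1"
  proof
    assume "cos (2 * pi * (\<xi> $ i - y $ i)) = 1"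
    then obtain n :: int where "2 * pi * (\<xi> $ i - y $ i) = n * 2 * pi" by (auto simp: cos_one_2pi_int)
    then have n: "\<xi> $ i - y $ i = n" by simp
    then have "\<bar>n\<bar> < 1" using lt by (metis of_int_abs of_int_less_1_iff)
    then show False using n i by simp
  qed
  then have "?q i < 1" using cos_le_one[of "2 * pi * (\<xi> $ i - y $ i)"] by (simp add: less_le)
  moreover have "raised_cosine y \<xi> = ?q i * (\<Prod>j\<in>UNIV - {i}. ?q j)"
    unfolding raised_cosine_def by (rule prod.remove) auto
  moreover have "(\<Prod>j\<in>UNIV - {i}. ?q j) \<le> 1" by (intro prod_le_1) (use q in auto)
  ultimately show ?thesis using q(1)[of i] mult_left_mono[of "\<Prod>j\<in>UNIV - {i}. ?q j" 1 "?q i"] by linarith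
qed

text \<open>The powers of \<open>\<epsilon> + raised_cosine y\<close> are positive trigonometric polynomials that blow up at \<open>y\<close> and
  stay bounded on the rest of the cube, so they would detect a nonzero value at \<open>y\<close>.\<close>

lemma coefficient_free_zero:
  fixes f :: "real^'n \<Rightarrow> complex"
  assumes f: "coefficient_free f" and y: "\<And>i. \<bar>y $ i\<bar> < 1/2"
  shows "f y = 0"
proof (rule ccontr)
  assume fy: "f y \<noteq> 0"
  \<comment> \<open>Multiplying by the conjugate of \<open>f y\<close> makes the value at
    \<open>y\<close> the positive number |f y|^2.\<close>
  define g where "g \<xi> = Re (cnj (f y) * f \<xi>)" for \<xi>
  define a where "a = (norm (f y))^2 / 2"
  have fc: "continuous_on UNIV f" using f by (simp add: coefficient_free_def)
  have gc: "continuous_on UNIV g" unfolding g_def by (intro continuous_intros fc)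
  have a: "a > 0" "g y = 2 * a"
    using fy by (auto simp: a_def g_def complex_norm_square[symmetric] mult.commute[of "cnj _"] simp flip: of_real_power)
  have "isCont g y" "isCont (raised_cosine y) y"
    using gc continuous_raised_cosine[of UNIV y] by (simp_all add: continuous_on_eq_continuous_at)
  have ry: "raised_cosine y y = 1" by (simp add: raised_cosine_def)
  have "open (box (\<chi> i. - 1/2) (\<chi> i. 1/2) :: (real^'n) set)" by (rule open_box)
  moreover have "y \<in> box (\<chi> i. - 1/2) (\<chi> i. 1/2)"
  proof -
    have "- 1/2 < y $ i \<and> y $ i < 1/2" for i using y[of i] by linarith
    then show ?thesis by (simp add: mem_box_cart)
  qed
  ultimately obtain r0 where r0: "r0 > 0" "ball y r0 \<subseteq> box (\<chi> i. - 1/2) (\<chi> i. 1/2)"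
    by (meson open_contains_ball)
  obtain r1 where r1: "r1 > 0" "\<And>\<xi>. dist \<xi> y < r1 \<Longrightarrow> dist (g \<xi>) (g y) < a"
    using \<open>isCont g y\<close> a(1) unfolding continuous_at_eps_delta by (metis dist_commute)
  define r where "r = min r0 r1"
  have r: "r > 0" "\<And>\<xi>. \<xi> \<in> ball y r \<Longrightarrow> \<xi> \<in> unit_cube" "\<And>\<xi>. \<xi> \<in> ball y r \<Longrightarrow> g \<xi> \<ge> a"
  proof -
    show "r > 0" using r0 r1 by (simp add: r_def)
    fix \<xi> assume x: "\<xi> \<in> ball y r"
    then have "\<xi> \<in> ball y r0" by (simp add: r_def)
    then show "\<xi> \<in> unit_cube" using r0(2) box_subset_cbox unfolding unit_cube_cbox by blast
    have "dist (g \<xi>) (g y) < a" using x r1(2)[of \<xi>] by (simp add: r_def dist_commute)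
    then show "g \<xi> \<ge> a" using a(2) by (simp add: dist_real_def)
  qed
  let ?K = "unit_cube - ball y r"
  have K: "compact ?K" by (intro compact_diff compact_unit_cube open_ball)
  have "\<exists>\<theta>. \<theta> < 1 \<and> (\<forall>\<xi>\<in>?K. raised_cosine y \<xi> \<le> \<theta>)"
  proof (cases "?K = {}")
    case False
    obtain z where z: "z \<in> ?K" "\<And>\<xi>. \<xi> \<in> ?K \<Longrightarrow> raised_cosine y \<xi> \<le> raised_cosine y z"
      using continuous_attains_sup[OF K False continuous_raised_cosine] by blast
    then have "raised_cosine y z < 1" using r(1) by (intro raised_cosine_less_1 y) auto
    then show ?thesis using z(2) by blast
  next
    case True
    then show ?thesis by (intro exI[of _ 0]) auto
  qed
  then obtain \<theta> where th: "\<theta> < 1" "\<And>\<xi>. \<xi> \<in> ?K \<Longrightarrow> raised_cosine y \<xi> \<le> \<theta>" by blast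
  \<comment> \<open>Small enough to keep \<open>\<epsilon> + raised_cosine y\<close> at most 1 off
    the ball of radius \<open>r\<close>, while at \<open>y\<close> it equals 1 + \<epsilon>.\<close>
  define \<epsilon> where "\<epsilon> = min (1/2) ((1 - \<theta>) / 2)"
  have e: "\<epsilon> > 0" "\<epsilon> \<le> (1 - \<theta>) / 2" using th(1) min.cobounded2[of "1/2" "(1 - \<theta>) / 2"] by (simp add: \<epsilon>_def, simp only: \<epsilon>_def)
  let ?p = "\<lambda>\<xi>. \<epsilon> + raised_cosine y \<xi>"
  have p0: "?p \<xi> \<ge> 0" for \<xi> using e(1) raised_cosine_bounds(1)[of y \<xi>] by simp
  obtain r2 where r2: "r2 > 0" "\<And>\<xi>. dist \<xi> y < r2 \<Longrightarrow> dist (raised_cosine y \<xi>) 1 < \<epsilon> / 2"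
    using \<open>isCont (raised_cosine y) y\<close> e(1) unfolding continuous_at_eps_delta ry by (metis dist_commute half_gt_zero)
  define s where "s = min r r2"
  have s: "s > 0" using r(1) r2(1) by (simp add: s_def)
  obtain b where b: "\<And>\<xi>. \<xi> \<in> unit_cube \<Longrightarrow> \<bar>g \<xi>\<bar> \<le> b"
    using compact_imp_bounded[OF compact_continuous_image[OF continuous_on_subset[OF gc subset_UNIV] compact_unit_cube]]
    unfolding bounded_iff by auto
  have b0: "b \<ge> 0" using b[of 0] by (auto simp: unit_cube_def)
  \<comment> \<open>Three zones: exponential growth on the ball of radius \<open>s\<close>, a
    nonnegative integrand on the rest of the ball of radius \<open>r\<close>, and at least
    \<open>- b\<close> on the rest of the cube.\<close>
  have lower: "a * (1 + \<epsilon> / 2) ^ N * indicator (ball y s) \<xi> - b * indicator unit_cube \<xi> \<le> indicator unit_cube \<xi> *\<^sub>R (g \<xi> * ?p \<xi> ^ N)" for \<xi> N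
  proof (cases "\<xi> \<in> ball y r")
    case True
    have g: "g \<xi> * ?p \<xi> ^ N \<ge> a * ?p \<xi> ^ N" using r(3)[OF True] p0 by (intro mult_right_mono) auto
    show ?thesis
    proof (cases "\<xi> \<in> ball y s")
      case True
      then have "dist (raised_cosine y \<xi>) 1 < \<epsilon> / 2" using r2(2)[of \<xi>] by (simp add: s_def dist_commute)
      then have "1 + \<epsilon> / 2 \<le> ?p \<xi>" unfolding dist_real_def by linarith
      then have "a * (1 + \<epsilon> / 2) ^ N \<le> a * ?p \<xi> ^ N" using a e by (intro mult_left_mono power_mono) auto
      then show ?thesis using g b0 True r(2)[OF \<open>\<xi> \<in> ball y r\<close>] by simp
    next
      case False
      have "0 \<le> a * ?p \<xi> ^ N" using a p0 by (intro mult_nonneg_nonneg) auto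
      then show ?thesis using g b0 False r(2)[OF \<open>\<xi> \<in> ball y r\<close>] by (simp add: indicator_def)
    qed
  next
    case False
    then have ns: "\<xi> \<notin> ball y s" by (auto simp: s_def)
    show ?thesis
    proof (cases "\<xi> \<in> unit_cube")
      case True
      then have "raised_cosine y \<xi> \<le> \<theta>" using False th(2) by blast
      then have "?p \<xi> \<le> 1" using e(2) th(1) by simp
      then have "?p \<xi> ^ N \<le> 1" using p0 by (intro power_le_one) auto
      then have "\<bar>g \<xi> * ?p \<xi> ^ N\<bar> \<le> b * 1"
        unfolding abs_mult using b[OF True] p0 by (intro mult_mono) (auto simp: power_abs[symmetric])
      then show ?thesis using ns True by (simp add: abs_le_iff minus_le_iff)
    qed (use ns in simp)
  qed
  have zero: "(LINT \<xi>|lborel. indicator unit_cube \<xi> *\<^sub>R (g \<xi> * ?p \<xi> ^ N)) = 0" for N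
  proof -
    let ?f = "\<lambda>\<xi>. f \<xi> * complex_of_real (?p \<xi> ^ N)"
    have "coefficient_free ?f" by (rule coefficient_free_power[OF f])
    then have c: "continuous_on UNIV ?f" and "cube_integral (\<lambda>\<xi>. ?f \<xi> * cis (2 * pi * (0 \<bullet> \<xi>))) = 0"
      using int_lattice_simps(1) unfolding coefficient_free_def by blast+
    then have z: "(LINT \<xi>|lborel. indicator unit_cube \<xi> *\<^sub>R ?f \<xi>) = 0" by (simp add: cube_integral_def)
    have "indicator unit_cube \<xi> *\<^sub>R (g \<xi> * ?p \<xi> ^ N) = Re (cnj (f y) * (indicator unit_cube \<xi> *\<^sub>R ?f \<xi>))" for \<xi>
      by (simp add: g_def indicator_def algebra_simps del: of_real_add of_real_power)
    then have "(LINT \<xi>|lborel. indicator unit_cube \<xi> *\<^sub>R (g \<xi> * ?p \<xi> ^ N)) = (LINT \<xi>|lborel. Re (cnj (f y) * (indicator unit_cube \<xi> *\<^sub>R ?f \<xi>)))"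
      by (simp only:)
    also have "\<dots> = Re (LINT \<xi>|lborel. cnj (f y) * (indicator unit_cube \<xi> *\<^sub>R ?f \<xi>))"
      by (rule integral_Re) (intro integrable_mult_right cube_integrable c)
    also have "\<dots> = 0" by (simp only: integral_mult_right_zero z) simp
    finally show ?thesis .
  qed
  have ball: "emeasure lborel (ball y s) < \<infinity>" by (rule emeasure_bounded_finite) simp
  \<comment> \<open>The integral on the larger side is zero for every N, so the exponential growth
    is bounded by \<open>b\<close>: impossible for large N.\<close>
  have bound: "a * (1 + \<epsilon> / 2) ^ N * measure lborel (ball y s) \<le> b" for N
  proof -
    have i: "integrable lborel (\<lambda>\<xi>. a * (1 + \<epsilon> / 2) ^ N * indicator (ball y s) \<xi> :: real)"
      "integrable lborel (\<lambda>\<xi>::real^'n. b * indicator unit_cube \<xi> :: real)"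
      using ball by (auto intro!: integrable_mult_right integrable_real_indicator simp: emeasure_unit_cube)
    have "(LINT \<xi>|lborel. a * (1 + \<epsilon> / 2) ^ N * indicator (ball y s) \<xi> - b * indicator unit_cube \<xi>) \<le>
       (LINT \<xi>|lborel. indicator unit_cube \<xi> *\<^sub>R (g \<xi> * ?p \<xi> ^ N))"
    proof (rule integral_mono[OF _ _ lower])
      show "integrable lborel (\<lambda>\<xi>. a * (1 + \<epsilon> / 2) ^ N * indicator (ball y s) \<xi> - b * indicator unit_cube \<xi>)"
        by (rule Bochner_Integration.integrable_diff[OF i])
      show "integrable lborel (\<lambda>\<xi>. indicator unit_cube \<xi> *\<^sub>R (g \<xi> * ?p \<xi> ^ N))"
        by (intro cube_integrable continuous_intros gc continuous_raised_cosine)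
    qed
    then show ?thesis unfolding zero Bochner_Integration.integral_diff[OF i] by (simp add: measure_unit_cube)
  qed
  have "measure lborel (ball y s) > 0" using s by (simp add: content_ball_pos)
  then have v: "a * measure lborel (ball y s) > 0" using a by simp
  obtain N where "(1 + \<epsilon> / 2) ^ N > b / (a * measure lborel (ball y s))"
    using real_arch_pow[of "1 + \<epsilon> / 2"] e by auto
  then have "a * (1 + \<epsilon> / 2) ^ N * measure lborel (ball y s) > b" using v by (simp add: pos_divide_less_eq mult_ac)
  then show False using bound[of N] by simp
qed

section \<open>Poisson summation and sampling\<close>

lemma cube_integral_cis:
  fixes m :: "real^'n"
  assumes m: "m \<in> int_lattice"
  shows "cube_integral (\<lambda>\<xi>. cis (2 * pi * (m \<bullet> \<xi>))) = (if m = 0 then 1 else 0)"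
proof -
  let ?I = "{- 1/2 .. 1/2 :: real}"
  let ?f = "\<lambda>i t. indicator ?I t *\<^sub>R cis (2 * pi * (m $ i * t))"
  have fi: "integrable lborel (?f i)" for i
    by (rule borel_integrable_compact) (auto intro!: continuous_intros)
  have eq: "indicator unit_cube \<xi> *\<^sub>R cis (2 * pi * (m \<bullet> \<xi>)) = (\<Prod>i\<in>UNIV. ?f i (\<xi> $ i))" for \<xi> :: "real^'n"
  proof (cases "\<xi> \<in> unit_cube")
    case True
    then have "indicator ?I (\<xi> $ i) = (1::real)" for i by (simp add: unit_cube_iff)
    then show ?thesis using True by (simp add: cis_inner)
  next
    case False
    then obtain i where "\<xi> $ i \<notin> ?I" by (auto simp: unit_cube_iff)
    then have "?f i (\<xi> $ i) = 0" by (simp only: indicator_simps scaleR_zero_left not_False_eq_True)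
    then have "(\<Prod>i\<in>UNIV. ?f i (\<xi> $ i)) = 0" by (intro prod_zero bexI[of _ i]) auto
    then show ?thesis using False by simp
  qed
  have one: "(LINT t|lborel. ?f i t) = (if m $ i = 0 then 1 else 0)" for i
  proof (cases "m $ i = 0")
    case True
    then show ?thesis by (simp add: indicator_scaleR_eq_if)
  next
    case False
    obtain n :: int where n: "m $ i = n" using m by (auto simp: int_lattice_def elim: Ints_cases)
    define F where "F t = cis (2 * pi * (m $ i * t)) / (2 * pi * m $ i * \<i>)" for t
    have "(LINT t|lborel. indicator ?I t *\<^sub>R cis (2 * pi * (m $ i * t))) = F (1/2) - F (- 1/2)"
    proof (rule integral_FTC_atLeastAtMost)
      show "(F has_vector_derivative cis (2 * pi * (m $ i * t))) (at t within ?I)" for t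
        unfolding has_vector_derivative_def F_def using False
        by (auto intro!: derivative_eq_intros simp: scaleR_conv_of_real field_simps)
    qed (auto intro!: continuous_intros)
    also have "F (1/2) = F (- 1/2)"
    proof -
      have "cis (pi * n) = cis (- (pi * n) + 2 * pi * n)" by (simp add: algebra_simps)
      also have "\<dots> = cis (- (pi * n)) * cis (2 * pi * n)" by (simp only: cis_mult)
      also have "cis (2 * pi * n) = 1" by (simp add: complex_eq_iff)
      finally show ?thesis by (simp add: F_def n)
    qed
    finally show ?thesis using False by simp
  qed
  have "cube_integral (\<lambda>\<xi>. cis (2 * pi * (m \<bullet> \<xi>))) = (\<Prod>i\<in>UNIV. if m $ i = 0 then 1 else 0)"
    unfolding cube_integral_def eq by (simp only: lborel_integral_prod(2)[OF fi] one)
  also have "\<dots> = (if m = 0 then 1 else 0)"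
  proof (cases "m = 0")
    case False
    then obtain i where "m $ i \<noteq> 0" by (auto simp: vec_eq_iff)
    then have "(\<Prod>i\<in>UNIV. if m $ i = 0 then 1 else 0 :: complex) = 0" by (intro prod_zero) auto
    then show ?thesis using False by simp
  qed simp
  finally show ?thesis .
qed

section \<open>Periodized sums over the lattice\<close>

lemma unit_cube_translate:
  fixes x :: "real^'n"
  obtains k where "k \<in> int_lattice" "x - k \<in> unit_cube"
proof (rule that)
  show "(\<chi> i. real_of_int (round (x $ i))) \<in> int_lattice" by (simp add: int_lattice_def)
  show "x - (\<chi> i. real_of_int (round (x $ i))) \<in> unit_cube"
    using of_int_round_abs_le by (auto simp: unit_cube_def abs_minus_commute)
qed

text \<open>Uniform convergence on the cube gives a finite set \<open>F0\<close> past which every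
  finite sum is within 1 of the limit. The constant \<open>b + 2\<close> pays 1 for comparing the
  sum over \<open>F \<union> F0\<close> with the limit and 1 for comparing the limit with the sum
  over \<open>F0\<close>. A lattice shift moves any x into the cube.\<close>

lemma class_LC_bounded_sums:
  fixes \<phi> :: "real^'n \<Rightarrow> complex"
  assumes "\<phi> \<in> class_LC"
  obtains B where "B \<ge> 0" "\<And>x F. finite F \<Longrightarrow> F \<subseteq> int_lattice \<Longrightarrow> (\<Sum>k\<in>F. norm (\<phi> (x + k))) \<le> B"
proof -
  have c: "continuous_on UNIV \<phi>" using assms by (simp add: class_LC_def)
  obtain s where s: "uniform_limit unit_cube (\<lambda>F x. \<Sum>k\<in>F. norm (\<phi> (x + k))) s (finite_subsets_at_top int_lattice)"
    using assms compact_unit_cube unfolding class_LC_def by blast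
  have "\<forall>\<^sub>F F in finite_subsets_at_top int_lattice. \<forall>x\<in>unit_cube. dist (\<Sum>k\<in>F. norm (\<phi> (x + k))) (s x) < 1"
    by (rule uniform_limitD[OF s]) simp
  then obtain F0 where F0: "finite F0" "F0 \<subseteq> int_lattice"
    "\<And>F x. finite F \<Longrightarrow> F0 \<subseteq> F \<Longrightarrow> F \<subseteq> int_lattice \<Longrightarrow> x \<in> unit_cube \<Longrightarrow> dist (\<Sum>k\<in>F. norm (\<phi> (x + k))) (s x) < 1"
    unfolding eventually_finite_subsets_at_top by metis
  have "continuous_on unit_cube (\<lambda>x. \<Sum>k\<in>F0. norm (\<phi> (x + k)))"
    by (intro continuous_intros continuous_on_compose2[OF c]) auto
  then have "bounded ((\<lambda>x. \<Sum>k\<in>F0. norm (\<phi> (x + k))) ` unit_cube)"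
    by (rule compact_imp_bounded[OF compact_continuous_image[OF _ compact_unit_cube]])
  then obtain b where b: "\<And>x. x \<in> unit_cube \<Longrightarrow> \<bar>\<Sum>k\<in>F0. norm (\<phi> (x + k))\<bar> \<le> b"
    unfolding bounded_iff by auto
  have b0: "b \<ge> 0" using b[of 0] by (auto simp: unit_cube_def)
  have cube: "(\<Sum>k\<in>F. norm (\<phi> (x + k))) \<le> b + 2" if F: "finite F" "F \<subseteq> int_lattice" and x: "x \<in> unit_cube" for F x
  proof -
    have "(\<Sum>k\<in>F. norm (\<phi> (x + k))) \<le> (\<Sum>k\<in>F \<union> F0. norm (\<phi> (x + k)))"
      by (rule sum_mono2) (use F F0 in auto)
    also have "\<dots> \<le> s x + 1" using F0(3)[of "F \<union> F0" x] F F0(1,2) x by (simp add: dist_real_def abs_less_iff)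
    also have "s x \<le> (\<Sum>k\<in>F0. norm (\<phi> (x + k))) + 1" using F0(3)[of F0 x] F0(1,2) x by (simp add: dist_real_def abs_less_iff)
    also have "(\<Sum>k\<in>F0. norm (\<phi> (x + k))) \<le> b" using b[OF x] by simp
    finally show ?thesis by simp
  qed
  show thesis
  proof (rule that)
    fix x :: "real^'n" and F assume F: "finite F" "F \<subseteq> (int_lattice :: (real^'n) set)"
    obtain l where l: "l \<in> int_lattice" "x - l \<in> unit_cube" by (rule unit_cube_translate)
    have "(\<Sum>k\<in>F. norm (\<phi> (x + k))) = (\<Sum>k\<in>(\<lambda>k. k + l) ` F. norm (\<phi> (x - l + k)))"
      by (subst sum.reindex) (auto simp: inj_on_def algebra_simps)
    also have "\<dots> \<le> b + 2" by (rule cube[OF _ _ l(2)]) (use F l int_lattice_simps(2) in auto)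
    finally show "(\<Sum>k\<in>F. norm (\<phi> (x + k))) \<le> b + 2" .
  qed (use b0 in simp)
qed

lemma class_LC_summable:
  fixes \<phi> :: "real^'n \<Rightarrow> complex"
  assumes "\<phi> \<in> class_LC"
  obtains B where "B \<ge> 0" "\<And>x. summable (\<lambda>n. norm (\<phi> (x + lattice_enum n)))"
    "\<And>x. (\<Sum>n. norm (\<phi> (x + lattice_enum n))) \<le> B" "\<And>x. norm (\<phi> x) \<le> B"
proof -
  obtain B where B: "B \<ge> 0" "\<And>x F. finite F \<Longrightarrow> F \<subseteq> int_lattice \<Longrightarrow> (\<Sum>k\<in>F. norm (\<phi> (x + k))) \<le> B"
    using class_LC_bounded_sums[OF assms] by blast
  have le: "(\<Sum>n<N. norm (\<phi> (x + lattice_enum n))) \<le> B" for x N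
  proof -
    have inj: "inj_on (lattice_enum :: nat \<Rightarrow> real^'n) {..<N}"
      using bij_lattice_enum by (meson bij_betw_imp_inj_on inj_on_subset subset_UNIV)
    have "(\<Sum>n<N. norm (\<phi> (x + lattice_enum n))) = (\<Sum>k\<in>lattice_enum ` {..<N}. norm (\<phi> (x + k)))"
      by (simp add: sum.reindex[OF inj])
    also have "\<dots> \<le> B" by (rule B(2)) (auto simp: lattice_enum_in)
    finally show ?thesis .
  qed
  have s: "summable (\<lambda>n. norm (\<phi> (x + lattice_enum n)))" for x
    by (rule summableI_nonneg_bounded[OF _ le]) simp
  show thesis
  proof (rule that[OF B(1) s])
    show "(\<Sum>n. norm (\<phi> (x + lattice_enum n))) \<le> B" for x by (rule suminf_le_const[OF s le])
    show "norm (\<phi> x) \<le> B" for x using B(2)[of "{0}" x] int_lattice_simps(1) by simp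
  qed
qed

text \<open>The lattice translates of the cube cover the space, so the integral of |\<phi>| is at
  most the integral over one cube of the periodized sum, which is bounded by
  \<open>B\<close>.\<close>

lemma class_LC_integrable:
  fixes \<phi> :: "real^'n \<Rightarrow> complex"
  assumes LC: "\<phi> \<in> class_LC"
  shows "integrable lborel \<phi>"
proof -
  obtain B where B: "B \<ge> 0" "\<And>x. summable (\<lambda>n. norm (\<phi> (x + lattice_enum n)))"
    "\<And>x. (\<Sum>n. norm (\<phi> (x + lattice_enum n))) \<le> B"
    using class_LC_summable[OF LC] by metis
  have [measurable]: "\<phi> \<in> borel_measurable borel"
    using LC by (auto simp: class_LC_def intro: borel_measurable_continuous_onI)
  let ?e = "lattice_enum :: nat \<Rightarrow> real^'n"
  \<comment> \<open>An inequality is claimed because the closed translates overlap along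
    faces.\<close>
  have "(\<integral>\<^sup>+x. norm (\<phi> x) \<partial>lborel) \<le> (\<integral>\<^sup>+x. (\<Sum>n. indicator unit_cube (x + - ?e n) * ennreal (norm (\<phi> x))) \<partial>lborel)"
  proof (rule nn_integral_mono)
    fix x :: "real^'n"
    obtain k where k: "k \<in> int_lattice" "x - k \<in> unit_cube" by (rule unit_cube_translate)
    obtain n where n: "k = ?e n" using bij_lattice_enum k(1) by (metis bij_betw_imp_surj_on imageE)
    have "ennreal (norm (\<phi> x)) = (\<Sum>i\<in>{n}. indicator unit_cube (x + - ?e i) * ennreal (norm (\<phi> x)))"
      using k(2) n by simp
    also have "\<dots> \<le> (\<Sum>n. indicator unit_cube (x + - ?e n) * ennreal (norm (\<phi> x)))"
      by (rule sum_le_suminf) auto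
    finally show "ennreal (norm (\<phi> x)) \<le> (\<Sum>n. indicator unit_cube (x + - ?e n) * ennreal (norm (\<phi> x)))" .
  qed
  also have "\<dots> = (\<Sum>n. \<integral>\<^sup>+x. indicator unit_cube (x + - ?e n) * ennreal (norm (\<phi> x)) \<partial>lborel)"
    by (rule nn_integral_suminf) simp
  also have "\<dots> = (\<Sum>n. \<integral>\<^sup>+x. indicator unit_cube x * ennreal (norm (\<phi> (x + ?e n))) \<partial>lborel)"
  proof (rule suminf_cong)
    fix n
    have "(\<integral>\<^sup>+x. indicator unit_cube (x + - ?e n) * ennreal (norm (\<phi> x)) \<partial>lborel) =
      (\<integral>\<^sup>+x. indicator unit_cube (x + ?e n + - ?e n) * ennreal (norm (\<phi> (x + ?e n))) \<partial>lborel)"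
      by (rule nn_integral_translate[symmetric]) simp
    then show "(\<integral>\<^sup>+x. indicator unit_cube (x + - ?e n) * ennreal (norm (\<phi> x)) \<partial>lborel) =
      (\<integral>\<^sup>+x. indicator unit_cube x * ennreal (norm (\<phi> (x + ?e n))) \<partial>lborel)" by simp
  qed
  also have "\<dots> = (\<integral>\<^sup>+x. (\<Sum>n. indicator unit_cube x * ennreal (norm (\<phi> (x + ?e n)))) \<partial>lborel)"
    by (rule nn_integral_suminf[symmetric]) simp
  also have "\<dots> \<le> (\<integral>\<^sup>+x. ennreal B * indicator unit_cube x \<partial>(lborel :: (real^'n) measure))"
  proof (rule nn_integral_mono)
    fix x :: "real^'n"
    have "(\<Sum>n. ennreal (norm (\<phi> (x + ?e n)))) = ennreal (\<Sum>n. norm (\<phi> (x + ?e n)))"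
      by (rule suminf_ennreal2) (use B(2) in auto)
    also have "\<dots> \<le> ennreal B" using B(3) by (rule ennreal_leI)
    finally show "(\<Sum>n. indicator unit_cube x * ennreal (norm (\<phi> (x + ?e n)))) \<le> ennreal B * indicator unit_cube x"
      by (simp add: indicator_def)
  qed
  also have "\<dots> = ennreal B" by (simp add: nn_integral_cmult emeasure_unit_cube)
  finally show ?thesis by (simp add: integrable_iff_bounded less_top[symmetric] top_unique) (metis ennreal_neq_top infinity_ennreal_def le_less_trans less_top)
qed

text \<open>Termwise integration with the majorant |a n| |f x|. It will be used with characters as
  \<open>g n\<close>, once for Fourier coefficients of a series and once for a sampling
  series.\<close>

lemma integral_suminf_dominated:
  fixes a :: "nat \<Rightarrow> complex" and g :: "nat \<Rightarrow> real^'n \<Rightarrow> complex"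
  assumes a: "summable (\<lambda>n. norm (a n))" and f: "integrable lborel f"
    and g: "\<And>n. g n \<in> borel_measurable borel" "\<And>n x. norm (g n x) \<le> 1"
  shows "(\<lambda>n. a n * (LINT x|lborel. f x * g n x)) sums (LINT x|lborel. f x * (\<Sum>n. a n * g n x))"
proof -
  have i: "integrable lborel (\<lambda>x. f x * g n x)" for n
    using g by (intro integrable_mult_bounded(1)[OF f]) auto
  have sx: "summable (\<lambda>n. norm (a n * g n x))" for x
    by (rule summable_comparison_test'[OF a]) (use g(2) in \<open>simp add: norm_mult mult_left_le\<close>)
  have le: "norm (a n * (f x * g n x)) \<le> norm (a n) * norm (f x)" for n x
    using mult_left_mono[OF g(2)[of n x], of "norm (a n) * norm (f x)"] by (simp add: norm_mult mult_ac)
  have "(\<lambda>n. LINT x|lborel. a n * (f x * g n x)) sums (LINT x|lborel. (\<Sum>n. a n * (f x * g n x)))"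
  proof (rule sums_integral)
    show "integrable lborel (\<lambda>x. a n * (f x * g n x))" for n using i by simp
    show "AE x in lborel. summable (\<lambda>n. norm (a n * (f x * g n x)))"
      by (intro AE_I2 summable_comparison_test'[OF summable_mult2[OF a]]) (use le in auto)
    show "summable (\<lambda>n. LINT x|lborel. norm (a n * (f x * g n x)))"
    proof (rule summable_comparison_test'[OF summable_mult2[OF a, of "LINT x|lborel. norm (f x)"]])
      fix n
      have "(LINT x|lborel. norm (a n * (f x * g n x))) \<le> (LINT x|lborel. norm (a n) * norm (f x))"
        by (rule integral_mono) (use i[of n] f le in auto)
      then show "norm (LINT x|lborel. norm (a n * (f x * g n x))) \<le> norm (a n) * (LINT x|lborel. norm (f x))"
        by simp
    qed
  qed
  moreover have "(\<Sum>n. a n * (f x * g n x)) = f x * (\<Sum>n. a n * g n x)" for x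
    using suminf_mult[OF summable_norm_cancel[OF sx[of x]], of "f x"] by (simp add: mult_ac)
  ultimately show ?thesis by simp
qed

text \<open>As the transform of \<open>\<phi>\<close> vanishes off the unit cube, only one translate contributes.\<close>

lemma poisson_summation:
  fixes \<phi> :: "real^'n \<Rightarrow> complex"
  assumes LC: "\<phi> \<in> class_LC" and supp: "fun_support (fourier \<phi>) \<subseteq> unit_cube" and y: "\<And>i. \<bar>y $ i\<bar> < 1/2"
  shows "(\<Sum>n. \<phi> (x + lattice_enum n) * cis (2 * pi * (- lattice_enum n \<bullet> y))) = fourier \<phi> y * cis (2 * pi * (x \<bullet> y))"
proof -
  obtain B where B: "B \<ge> 0" "\<And>x. summable (\<lambda>n. norm (\<phi> (x + lattice_enum n)))" "\<And>x. norm (\<phi> x) \<le> B"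
    using class_LC_summable[OF LC] by metis
  have fc: "continuous_on UNIV \<phi>" using LC by (simp add: class_LC_def)
  have fi: "integrable lborel \<phi>" by (rule class_LC_integrable[OF LC])
  have Fc: "continuous_on UNIV (fourier \<phi>)" by (rule continuous_fourier[OF fi])
  have Fi: "integrable lborel (fourier \<phi>)"
    by (rule continuous_compact_support_integrable[OF Fc compact_fun_support_subset[OF compact_unit_cube supp]])
  let ?e = "lattice_enum :: nat \<Rightarrow> real^'n"
  let ?a = "\<lambda>n. \<phi> (x + ?e n)"
  define \<Phi> where "\<Phi> \<xi> = (\<Sum>n. ?a n * cis (2 * pi * (- ?e n \<bullet> \<xi>)))" for \<xi>
  have "uniform_limit UNIV (\<lambda>N \<xi>. \<Sum>n<N. ?a n * cis (2 * pi * (- ?e n \<bullet> \<xi>))) \<Phi> sequentially"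
    unfolding \<Phi>_def[abs_def] by (rule Weierstrass_m_test[OF _ B(2)[of x]]) (simp add: norm_mult)
  then have \<Phi>c: "continuous_on UNIV \<Phi>"
    by (rule uniform_limit_theorem[rotated]) (auto intro!: always_eventually continuous_intros)
  \<comment> \<open>At \<open>k\<close> both terms have coefficient \<phi>(x + k): the series by
    orthogonality of the characters, the other term by Fourier inversion, as the integral over the
    cube is one over the whole space. Uniqueness of coefficients then replaces any convergence
    theorem.\<close>
  have c: "coefficient_free (\<lambda>\<xi>. \<Phi> \<xi> - fourier \<phi> \<xi> * cis (2 * pi * (x \<bullet> \<xi>)))"
    unfolding coefficient_free_def
  proof (intro conjI ballI)
    show "continuous_on UNIV (\<lambda>\<xi>. \<Phi> \<xi> - fourier \<phi> \<xi> * cis (2 * pi * (x \<bullet> \<xi>)))"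
      by (intro continuous_intros \<Phi>c Fc)
    fix k :: "real^'n" assume k: "k \<in> int_lattice"
    let ?f = "\<lambda>\<xi>. indicator unit_cube \<xi> *\<^sub>R cis (2 * pi * (k \<bullet> \<xi>))"
    have f: "integrable lborel ?f" by (intro cube_integrable continuous_intros)
    have co: "(LINT \<xi>|lborel. ?f \<xi> * cis (2 * pi * (- ?e n \<bullet> \<xi>))) = (if ?e n = k then 1 else 0)" for n
    proof -
      have "(LINT \<xi>|lborel. ?f \<xi> * cis (2 * pi * (- ?e n \<bullet> \<xi>))) = cube_integral (\<lambda>\<xi>. cis (2 * pi * ((k - ?e n) \<bullet> \<xi>)))"
        unfolding cube_integral_def
        by (intro Bochner_Integration.integral_cong) (simp_all add: cis_mult inner_diff_left right_diff_distrib)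
      then show ?thesis
        using cube_integral_cis[OF int_lattice_simps(3)[OF k lattice_enum_in]] by auto
    qed
    have "(\<lambda>n. ?a n * (LINT \<xi>|lborel. ?f \<xi> * cis (2 * pi * (- ?e n \<bullet> \<xi>)))) sums (LINT \<xi>|lborel. ?f \<xi> * \<Phi> \<xi>)"
      unfolding \<Phi>_def by (rule integral_suminf_dominated[OF B(2) f]) simp_all
    then have s: "(\<lambda>n. ?a n * (if ?e n = k then 1 else 0)) sums (LINT \<xi>|lborel. ?f \<xi> * \<Phi> \<xi>)"
      by (simp only: co)
    obtain n0 where n0: "?e n0 = k" using bij_lattice_enum k by (metis bij_betw_imp_surj_on imageE)
    have "inj ?e" using bij_lattice_enum by (rule bij_betw_imp_inj_on)
    then have "?a n * (if ?e n = k then 1 else 0) = (if n = n0 then ?a n else 0)" for n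
      using inj_eq[of ?e n n0] n0 by simp
    then have "(\<lambda>n. if n = n0 then ?a n else 0) sums (LINT \<xi>|lborel. ?f \<xi> * \<Phi> \<xi>)" using s by (simp only:)
    then have "(LINT \<xi>|lborel. ?f \<xi> * \<Phi> \<xi>) = ?a n0" using sums_single by (rule sums_unique2)
    then have 1: "(LINT \<xi>|lborel. ?f \<xi> * \<Phi> \<xi>) = \<phi> (x + k)" by (simp only: n0)
    have eq: "indicator unit_cube \<xi> *\<^sub>R (fourier \<phi> \<xi> * cis (2 * pi * (x \<bullet> \<xi>)) * cis (2 * pi * (k \<bullet> \<xi>))) =
        fourier \<phi> \<xi> * cis (2 * pi * ((x + k) \<bullet> \<xi>))" for \<xi>
    proof (cases "\<xi> \<in> unit_cube")
      case False
      then have "fourier \<phi> \<xi> = 0" using supp by (intro fun_support_zero) blast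
      then show ?thesis by simp
    qed (simp add: mult.assoc cis_mult inner_add_left distrib_left)
    have "cube_integral (\<lambda>\<xi>. fourier \<phi> \<xi> * cis (2 * pi * (x \<bullet> \<xi>)) * cis (2 * pi * (k \<bullet> \<xi>))) = inv_fourier (fourier \<phi>) (x + k)"
      unfolding cube_integral_def inv_fourier_def eq ..
    also have "\<dots> = \<phi> (x + k)" by (rule inv_fourier_fourier[OF fi fc B(3) Fi])
    finally have 2: "cube_integral (\<lambda>\<xi>. fourier \<phi> \<xi> * cis (2 * pi * (x \<bullet> \<xi>)) * cis (2 * pi * (k \<bullet> \<xi>))) = \<phi> (x + k)" .
    have "cube_integral (\<lambda>\<xi>. (\<Phi> \<xi> - fourier \<phi> \<xi> * cis (2 * pi * (x \<bullet> \<xi>))) * cis (2 * pi * (k \<bullet> \<xi>))) =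
      (LINT \<xi>|lborel. indicator unit_cube \<xi> *\<^sub>R (\<Phi> \<xi> * cis (2 * pi * (k \<bullet> \<xi>))) -
         indicator unit_cube \<xi> *\<^sub>R (fourier \<phi> \<xi> * cis (2 * pi * (x \<bullet> \<xi>)) * cis (2 * pi * (k \<bullet> \<xi>))))"
      unfolding cube_integral_def by (simp add: left_diff_distrib scaleR_right_diff_distrib)
    also have "\<dots> = (LINT \<xi>|lborel. indicator unit_cube \<xi> *\<^sub>R (\<Phi> \<xi> * cis (2 * pi * (k \<bullet> \<xi>)))) -
       cube_integral (\<lambda>\<xi>. fourier \<phi> \<xi> * cis (2 * pi * (x \<bullet> \<xi>)) * cis (2 * pi * (k \<bullet> \<xi>)))"
      unfolding cube_integral_def
      by (rule Bochner_Integration.integral_diff) (intro cube_integrable continuous_intros \<Phi>c Fc)+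
    also have "(LINT \<xi>|lborel. indicator unit_cube \<xi> *\<^sub>R (\<Phi> \<xi> * cis (2 * pi * (k \<bullet> \<xi>)))) = (LINT \<xi>|lborel. ?f \<xi> * \<Phi> \<xi>)"
      by (simp add: mult.commute)
    finally show "cube_integral (\<lambda>\<xi>. (\<Phi> \<xi> - fourier \<phi> \<xi> * cis (2 * pi * (x \<bullet> \<xi>))) * cis (2 * pi * (k \<bullet> \<xi>))) = 0"
      using 1 2 by (simp add: mult.commute)
  qed
  show ?thesis using coefficient_free_zero[OF c y] by (simp add: \<Phi>_def)
qed

text \<open>The open and the closed box have the same volume. Poisson summation is available at
  interior frequencies, so under an integral nothing is lost.\<close>

lemma AE_interior_unit_cube:
  "AE \<xi> in (lborel :: (real^'n) measure). \<xi> \<in> unit_cube \<longrightarrow> (\<forall>i. \<bar>\<xi> $ i\<bar> < 1/2)"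
proof -
  let ?b = "box (\<chi> i. - 1/2) (\<chi> i. 1/2) :: (real^'n) set"
  have "emeasure lborel (unit_cube - ?b) = emeasure lborel (unit_cube :: (real^'n) set) - emeasure lborel ?b"
    by (rule emeasure_Diff) (auto simp: unit_cube_cbox emeasure_lborel_box_eq intro: box_subset_cbox[THEN subsetD])
  also have "emeasure lborel ?b = emeasure lborel (unit_cube :: (real^'n) set)"
    by (simp add: unit_cube_cbox emeasure_lborel_box_eq emeasure_lborel_cbox_eq)
  finally have "unit_cube - ?b \<in> null_sets lborel" by (simp add: null_sets_def emeasure_unit_cube)
  then have "AE \<xi> in lborel. \<xi> \<notin> unit_cube - ?b" by (rule AE_not_in)
  then show ?thesis
  proof eventually_elim
    case (elim \<xi>)
    have "\<bar>\<xi> $ i\<bar> < 1/2" if "\<xi> \<in> ?b" for i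
    proof -
      have "- 1/2 < \<xi> $ i \<and> \<xi> $ i < 1/2" using that by (simp add: mem_box_cart)
      then show ?thesis by linarith
    qed
    then show ?case using elim by blast
  qed
qed

context bump
begin

text \<open>The identity is exact for each integrable approximant, where the sampling series may be
  summed under the frequency integral and Fourier inversion applies. It survives in the limit
  because the series have a common summable majorant.\<close>

lemma sampling_reproduces:
  fixes T \<phi> :: "real^'n \<Rightarrow> complex" and A :: "real^'n^'n"
  assumes LC: "\<phi> \<in> class_LC" and supp: "fun_support (fourier \<phi>) \<subseteq> unit_cube"
    and T: "T \<in> bandlimited A" and A: "invertible A" "freq_cell A \<subseteq> unit_cube"
    and k: "integrable lborel \<kappa>" "integrable lborel (inv_fourier \<kappa>)"
    and eq: "AE \<xi> in lborel. \<xi> \<in> freq_cell A \<longrightarrow> fourier \<phi> \<xi> * \<kappa> \<xi> = 1"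
  shows "(\<Sum>n. convolve T (inv_fourier \<kappa>) (- lattice_enum n) * \<phi> (x + lattice_enum n)) = T x"
proof -
  obtain B where B: "B \<ge> 0" "\<And>x. summable (\<lambda>n. norm (\<phi> (x + lattice_enum n)))" "\<And>x. norm (\<phi> x) \<le> B"
    using class_LC_summable[OF LC] by metis
  obtain h C where h: "approximants T (freq_cell A) h C"
    using bandlimited_approximants[OF T A(1)] by blast
  let ?e = "lattice_enum :: nat \<Rightarrow> real^'n"
  let ?a = "\<lambda>n. \<phi> (x + ?e n)"
  have rep: "(\<Sum>n. convolve (h m) (inv_fourier \<kappa>) (- ?e n) * ?a n) = h m x" for m
  proof -
    have hm: "integrable lborel (h m)" "continuous_on UNIV (h m)" "\<And>x. norm (h m x) \<le> C"
      "integrable lborel (fourier (h m))" "\<And>\<xi>. \<xi> \<notin> freq_cell A \<Longrightarrow> fourier (h m) \<xi> = 0"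
      using h by (simp_all add: approximants_def)
    let ?F = "fourier (h m)"
    have [measurable]: "?F \<in> borel_measurable borel" "\<kappa> \<in> borel_measurable borel" using hm k by auto
    have kF: "integrable lborel (\<lambda>\<xi>. \<kappa> \<xi> * ?F \<xi>)"
    proof (rule integrable_mult_bounded(1)[OF k(1)])
      show "norm (?F \<xi>) \<le> (LINT \<xi>|lborel. norm (h m \<xi>))" for \<xi>
        unfolding fourier_eq_inv by (rule norm_inv_fourier_le)
    qed simp
    have conv: "convolve (h m) (inv_fourier \<kappa>) (- ?e n) = (LINT \<xi>|lborel. \<kappa> \<xi> * ?F \<xi> * cis (2 * pi * (- ?e n \<bullet> \<xi>)))" for n
      by (simp only: convolve_inv_fourier[OF hm(1) k(1)] mult.assoc)
    have "(\<lambda>n. ?a n * convolve (h m) (inv_fourier \<kappa>) (- ?e n)) sums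
       (LINT \<xi>|lborel. \<kappa> \<xi> * ?F \<xi> * (\<Sum>n. ?a n * cis (2 * pi * (- ?e n \<bullet> \<xi>))))"
      unfolding conv by (rule integral_suminf_dominated[OF B(2) kF]) simp_all
    then have "(\<Sum>n. convolve (h m) (inv_fourier \<kappa>) (- ?e n) * ?a n) =
      (LINT \<xi>|lborel. \<kappa> \<xi> * ?F \<xi> * (\<Sum>n. ?a n * cis (2 * pi * (- ?e n \<bullet> \<xi>))))"
      by (simp add: sums_iff mult.commute)
    also have "\<dots> = (LINT \<xi>|lborel. ?F \<xi> * cis (2 * pi * (x \<bullet> \<xi>)))"
    proof (rule integral_cong_AE)
      show "AE \<xi> in lborel. \<kappa> \<xi> * ?F \<xi> * (\<Sum>n. ?a n * cis (2 * pi * (- ?e n \<bullet> \<xi>))) = ?F \<xi> * cis (2 * pi * (x \<bullet> \<xi>))"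
        using eq AE_interior_unit_cube
      proof eventually_elim
        case (elim \<xi>)
        show ?case
        proof (cases "\<xi> \<in> freq_cell A")
          case True
          then have y: "\<And>i. \<bar>\<xi> $ i\<bar> < 1/2" and one: "fourier \<phi> \<xi> * \<kappa> \<xi> = 1" using elim A(2) by auto
          have "\<kappa> \<xi> * ?F \<xi> * (fourier \<phi> \<xi> * c) = (fourier \<phi> \<xi> * \<kappa> \<xi>) * (?F \<xi> * c)" for c
            by (simp add: mult_ac)
          then show ?thesis by (simp only: poisson_summation[OF LC supp y] one mult_1_left)
        qed (simp add: hm(5))
      qed
    qed simp_all
    also have "\<dots> = inv_fourier ?F x" by (simp add: inv_fourier_def)
    also have "\<dots> = h m x" by (rule inv_fourier_fourier[OF hm(1-4)])
    finally show ?thesis .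
  qed
  let ?N = "LINT t|lborel. norm (inv_fourier \<kappa> t)"
  have Tc: "continuous_on UNIV T" using T by (simp add: bandlimited_def)
  have lim: "((\<lambda>m. convolve (h m) (inv_fourier \<kappa>) (- ?e n) * ?a n) \<longlongrightarrow> convolve T (inv_fourier \<kappa>) (- ?e n) * ?a n) sequentially" for n
    using h by (intro tendsto_mult_right tendsto_convolve[where C=C] Tc k) (auto simp: approximants_def)
  \<comment> \<open>The majorant for Tannery's theorem: the samples are bounded uniformly in m and
    n, and the values of \<phi> along the lattice are absolutely summable.\<close>
  have le: "norm (convolve (h m) (inv_fourier \<kappa>) (- ?e n) * ?a n) \<le> C * ?N * norm (?a n)" for m n
    unfolding norm_mult using h by (intro mult_right_mono norm_convolve_le k) (auto simp: approximants_def)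
  have bound: "\<forall>\<^sub>F (n, m) in sequentially \<times>\<^sub>F sequentially. norm (convolve (h m) (inv_fourier \<kappa>) (- ?e n) * ?a n) \<le> C * ?N * norm (?a n)"
    by (intro always_eventually allI) (simp only: le split_beta)
  have "(\<lambda>m. \<Sum>n. convolve (h m) (inv_fourier \<kappa>) (- ?e n) * ?a n) \<longlonglongrightarrow> (\<Sum>n. convolve T (inv_fourier \<kappa>) (- ?e n) * ?a n)"
    using tannerys_theorem[OF lim bound summable_mult[OF B(2)]] by simp
  then have "(\<lambda>m. h m x) \<longlonglongrightarrow> (\<Sum>n. convolve T (inv_fourier \<kappa>) (- ?e n) * ?a n)" by (simp only: rep)
  moreover have "(\<lambda>m. h m x) \<longlonglongrightarrow> T x" using h by (simp add: approximants_def)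
  ultimately show ?thesis by (rule LIMSEQ_unique)
qed

end

section \<open>Quasi-projection operators\<close>

lemma sup_norm_le_iff: "r \<ge> 0 \<Longrightarrow> sup_norm g \<le> ennreal r \<longleftrightarrow> (\<forall>x. norm (g x) \<le> r)"
  by (simp add: sup_norm_def SUP_le_iff)

lemma freq_cell_scaleR_subset:
  fixes A :: "real^'n^'n"
  assumes "0 < \<delta>" "\<delta> \<le> 1"
  shows "freq_cell (\<delta> *\<^sub>R A) \<subseteq> freq_cell A"
proof
  fix \<xi> assume "\<xi> \<in> freq_cell (\<delta> *\<^sub>R A)"
  then obtain y where y: "y \<in> unit_cube" "\<xi> = transpose (\<delta> *\<^sub>R A) *v y" by blast
  have "\<xi> = transpose A *v (\<delta> *\<^sub>R y)"
    unfolding y(2) by (simp add: transpose_scalar matrix_vector_mult_scaleR scaleR_matrix_vector_assoc)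
  moreover have "\<delta> *\<^sub>R y \<in> unit_cube"
  proof -
    have "\<bar>\<delta> * y $ i\<bar> \<le> 1 * (1/2)" for i
      unfolding abs_mult by (intro mult_mono) (use y(1) assms in \<open>auto simp: unit_cube_def\<close>)
    then show ?thesis by (simp add: unit_cube_def)
  qed
  ultimately show "\<xi> \<in> freq_cell A" by blast
qed

lemma bandlimited_mono: "freq_cell A \<subseteq> freq_cell B \<Longrightarrow> bandlimited A \<subseteq> bandlimited B"
  unfolding bandlimited_def by blast

lemma best_approx_mono: "freq_cell A \<subseteq> freq_cell B \<Longrightarrow> best_approx B f \<le> best_approx A f"
  unfolding best_approx_def by (intro INF_superset_mono bandlimited_mono) auto

text \<open>A real version for summation and limits. On \<open>space_C\<close> nothing is lost,
  since the zero function keeps the best approximation finite.\<close>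

definition approx_error :: "real^'n^'n \<Rightarrow> (real^'n \<Rightarrow> complex) \<Rightarrow> real" where
  "approx_error A f = enn2real (best_approx A f)"

lemma approx_error_nonneg: "0 \<le> approx_error A f"
  by (simp add: approx_error_def)

locale quasi_projection = bump \<rho> for \<rho> :: "real^'n \<Rightarrow> complex" +
  fixes \<eta> :: "real^'n \<Rightarrow> real" and M :: "real^'n^'n" and \<alpha> :: "real^'n^'n \<Rightarrow> real" and \<psi> :: "'n functional"
  assumes cut: "cutoff \<eta>" and dil: "dilation_matrix M" and class_A: "\<alpha> \<in> class_A M"
    and class_S: "\<psi> \<in> class_S \<eta> \<alpha> M"
begin

section \<open>Best approximation by band-limited functions\<close>

lemma invM: "invertible M"
  by (rule dilation_invertible[OF dil])

lemma inv_scaled: "\<delta> > 0 \<Longrightarrow> invertible (\<delta> *\<^sub>R matpow M n)"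
  using scalar_invertible[of \<delta> "matpow M n"] invertible_matpow[OF invM] by simp

lemma zero_bandlimited: "(\<lambda>x::real^'n. 0) \<in> bandlimited A"
  unfolding bandlimited_iff by (auto intro: boundedI[of _ 0])

lemma best_approx_finite:
  fixes f :: "real^'n \<Rightarrow> complex"
  assumes "f \<in> space_C" shows "best_approx A f = ennreal (approx_error A f)"
proof -
  obtain C where C: "\<And>x. norm (f x) \<le> C" using assms unfolding space_C_def bounded_iff by auto
  have "C \<ge> 0" using C[of 0] norm_ge_zero order_trans by blast
  have "best_approx A f \<le> sup_norm (\<lambda>x. f x - 0)"
    unfolding best_approx_def by (rule INF_lower2[OF zero_bandlimited order_refl])
  also have "\<dots> \<le> ennreal C" using C \<open>C \<ge> 0\<close> by (simp add: sup_norm_le_iff)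
  also have "\<dots> < top" by simp
  finally show ?thesis by (simp add: approx_error_def)
qed

lemma approx_error_le:
  fixes f :: "real^'n \<Rightarrow> complex"
  assumes "f \<in> space_C" "g \<in> bandlimited A" "\<And>x. norm (f x - g x) \<le> r"
  shows "approx_error A f \<le> r"
proof -
  have r: "r \<ge> 0" using assms(3)[of 0] norm_ge_zero order_trans by blast
  have "best_approx A f \<le> sup_norm (\<lambda>x. f x - g x)"
    unfolding best_approx_def by (rule INF_lower[OF assms(2)])
  also have "\<dots> \<le> ennreal r" using assms(3) r by (simp add: sup_norm_le_iff)
  finally show ?thesis using r by (simp add: best_approx_finite[OF assms(1)] ennreal_le_iff)
qed

lemma approx_error_mono:
  fixes f :: "real^'n \<Rightarrow> complex"
  assumes "f \<in> space_C" "freq_cell A \<subseteq> freq_cell B"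
  shows "approx_error B f \<le> approx_error A f"
  using best_approx_mono[OF assms(2), of f] assms(1)
  by (simp add: best_approx_finite ennreal_le_iff approx_error_nonneg)

text \<open>The factor 2 leaves room above a positive infimum. If the infimum is zero,
  \<open>f\<close> is a uniform limit of band-limited functions, hence band-limited, and
  approximates itself.\<close>

lemma approximant_exists:
  fixes f :: "real^'n \<Rightarrow> complex"
  assumes f: "f \<in> space_C"
  shows "\<exists>T\<in>bandlimited A. \<forall>x. norm (f x - T x) \<le> 2 * approx_error A f"
proof -
  have less: "\<exists>T\<in>bandlimited A. \<forall>x. norm (f x - T x) \<le> r" if "approx_error A f < r" for r
  proof -
    have r: "r \<ge> 0" using that approx_error_nonneg[of A f] by simp
    have "best_approx A f < ennreal r"
      using that by (simp add: best_approx_finite[OF f] ennreal_less_iff approx_error_nonneg)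
    then obtain T where T: "T \<in> bandlimited A" "sup_norm (\<lambda>x. f x - T x) < ennreal r"
      unfolding best_approx_def INF_less_iff by blast
    then have "\<forall>x. norm (f x - T x) \<le> r"
      using iffD1[OF sup_norm_le_iff[OF r] less_imp_le[OF T(2)]] by blast
    then show ?thesis using T(1) by blast
  qed
  show ?thesis
  proof (cases "approx_error A f = 0")
    case True
    have "continuous_on UNIV f" "bounded (range f)"
      using f uniformly_continuous_imp_continuous by (auto simp: space_C_def)
    then have "f \<in> bandlimited A" by (rule bandlimited_closed) (rule less, simp add: True)
    then show ?thesis using True by (intro bexI[of _ f]) auto
  next
    case False
    then show ?thesis using less[of "2 * approx_error A f"] approx_error_nonneg[of A f] by simp
  qed
qed

section \<open>Multipliers of the mollified functional\<close>

definition \<kappa> :: "nat \<Rightarrow> real^'n \<Rightarrow> complex" where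
  "\<kappa> \<mu> \<xi> = complex_of_real (cutoff_mat \<eta> (matpow M \<mu>) \<xi>) * cnj (fourier_fun \<psi> \<xi>)"

lemma mollified_eq: "mollified \<eta> (matpow M \<mu>) \<psi> = inv_fourier (\<kappa> \<mu>)"
  by (simp add: mollified_def \<kappa>_def[abs_def])

lemma fourier_fun: "has_fourier_fun \<psi> (fourier_fun \<psi>)"
proof -
  have "\<exists>h. has_fourier_fun \<psi> h" using class_S by (simp add: class_S_def)
  then show ?thesis unfolding fourier_fun_def by (rule someI_ex)
qed

lemma cutoff_mat_one:
  assumes "\<xi> \<in> freq_cell (matpow M \<mu>)" shows "cutoff_mat \<eta> (matpow M \<mu>) \<xi> = 1"
proof -
  obtain y where y: "y \<in> unit_cube" "\<xi> = transpose (matpow M \<mu>) *v y" using assms by blast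
  then have "cutoff_mat \<eta> (matpow M \<mu>) \<xi> = \<eta> y"
    unfolding cutoff_mat_def
    by (simp only: matrix_inv_cancel(2)[OF transpose_invertible[OF invertible_matpow[OF invM]]])
  then show ?thesis using cut y(1) by (simp add: cutoff_def)
qed

text \<open>The cut-off confines the multiplier to a compact set, on which the locally bounded
  transform of \<psi> is bounded.\<close>

lemma \<kappa>_integrable: "integrable lborel (\<kappa> \<mu>)"
proof -
  let ?A = "transpose (matpow M \<mu>)" and ?H = "fourier_fun \<psi>"
  let ?K = "(*v) ?A ` (*\<^sub>R) 2 ` unit_cube"
  have A: "invertible ?A" by (rule transpose_invertible[OF invertible_matpow[OF invM]])
  have K: "compact ?K"
    by (intro compact_continuous_image compact_unit_cube matrix_vector_mult_linear_continuous_on continuous_intros)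
  have [measurable]: "?H \<in> borel_measurable borel" using fourier_fun by (simp add: has_fourier_fun_def)
  have bd: "bounded (?H ` ?K)" using fourier_fun K unfolding has_fourier_fun_def by blast
  have c\<eta>: "continuous_on UNIV \<eta>" using cut smooth_continuous by (auto simp: cutoff_def)
  then have cc: "continuous_on UNIV (cutoff_mat \<eta> (matpow M \<mu>))"
    unfolding cutoff_mat_def[abs_def]
    by (intro continuous_on_compose2[OF c\<eta> matrix_vector_mult_linear_continuous_on]) simp
  have [measurable]: "cutoff_mat \<eta> (matpow M \<mu>) \<in> borel_measurable borel"
    using cc by (rule borel_measurable_continuous_onI)
  have [measurable]: "?K \<in> sets borel" using K by (simp add: borel_compact)
  have z: "\<kappa> \<mu> \<xi> = 0" if "\<xi> \<notin> ?K" for \<xi>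
  proof -
    have "\<xi> = ?A *v (matrix_inv ?A *v \<xi>)" by (simp add: matrix_inv_cancel[OF A])
    then have "matrix_inv ?A *v \<xi> \<notin> (*\<^sub>R) 2 ` unit_cube" using that by blast
    then show ?thesis using cut by (simp add: \<kappa>_def cutoff_mat_def cutoff_def)
  qed
  obtain B1 where B1: "\<And>\<xi>. \<xi> \<in> ?K \<Longrightarrow> norm (?H \<xi>) \<le> B1" using bd unfolding bounded_iff by auto
  have "bounded (cutoff_mat \<eta> (matpow M \<mu>) ` ?K)"
    by (rule compact_imp_bounded[OF compact_continuous_image[OF continuous_on_subset[OF cc] K]]) simp
  then obtain B2 where B2: "\<And>\<xi>. \<xi> \<in> ?K \<Longrightarrow> norm (cutoff_mat \<eta> (matpow M \<mu>) \<xi>) \<le> B2" unfolding bounded_iff by blast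
  show ?thesis
  proof (rule Bochner_Integration.integrable_bound)
    show "integrable lborel (\<lambda>\<xi>. B2 * B1 * indicator ?K \<xi> :: real)"
      using emeasure_compact_finite[OF K] by (intro integrable_mult_right integrable_real_indicator) auto
    show "\<kappa> \<mu> \<in> borel_measurable lborel" unfolding \<kappa>_def[abs_def] by simp
    show "AE \<xi> in lborel. norm (\<kappa> \<mu> \<xi>) \<le> norm (B2 * B1 * indicator ?K \<xi> :: real)"
    proof (rule AE_I2)
      fix \<xi> show "norm (\<kappa> \<mu> \<xi>) \<le> norm (B2 * B1 * indicator ?K \<xi> :: real)"
      proof (cases "\<xi> \<in> ?K")
        case True
        have "norm (\<kappa> \<mu> \<xi>) \<le> B2 * B1"
          unfolding \<kappa>_def norm_mult complex_mod_cnj norm_of_real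
          by (intro mult_mono) (use B1[OF True] B2[OF True] norm_ge_zero order_trans in \<open>auto simp: real_norm_def\<close>)
        also have "\<dots> \<le> norm (B2 * B1 * indicator ?K \<xi> :: real)" using True by simp
        finally show ?thesis .
      qed (simp add: z)
    qed
  qed
qed

lemma mollified_bound:
  obtains c where "c > 0" "\<And>\<mu>. integrable lborel (inv_fourier (\<kappa> \<mu>))"
    "\<And>\<mu>. (LINT x|lborel. norm (inv_fourier (\<kappa> \<mu>) x)) \<le> c * \<alpha> (matpow M \<mu>)"
proof -
  obtain c where "\<forall>\<mu>. integrable lborel (mollified \<eta> (matpow M \<mu>) \<psi>) \<and>
      (LINT x|lborel. norm (mollified \<eta> (matpow M \<mu>) \<psi> x)) \<le> c * \<alpha> (matpow M \<mu>)"
    using class_S unfolding class_S_def by blast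
  then have c: "integrable lborel (inv_fourier (\<kappa> \<mu>))"
    "(LINT x|lborel. norm (inv_fourier (\<kappa> \<mu>) x)) \<le> c * \<alpha> (matpow M \<mu>)" for \<mu>
    by (simp_all add: mollified_eq)
  have "c * \<alpha> A \<le> max c 1 * \<alpha> A" for A
    using class_A by (intro mult_right_mono) (auto simp: class_A_def less_imp_le)
  then show thesis using that[of "max c 1"] c(1) order_trans[OF c(2)] by (simp add: less_max_iff_disj)
qed

lemma \<alpha>_pos: "\<alpha> A > 0"
  using class_A by (simp add: class_A_def)

lemma \<alpha>_growth:
  obtains c where "c \<ge> 1" "\<And>\<mu> s. \<alpha> (matpow M (\<mu> + s)) \<le> c ^ s * \<alpha> (matpow M \<mu>)"
proof -
  obtain c0 where c0: "\<And>\<mu>. \<alpha> (matpow M (\<mu> + 1)) \<le> c0 * \<alpha> (matpow M \<mu>)"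
    using class_A unfolding class_A_def by blast
  \<comment> \<open>The maximum with 1 makes the powers of the growth constant increase with the
    exponent, so that gaps of different length can be charged to one power.\<close>
  let ?c = "max c0 1"
  have step: "\<alpha> (matpow M (Suc \<mu>)) \<le> ?c * \<alpha> (matpow M \<mu>)" for \<mu>
  proof -
    have "c0 * \<alpha> (matpow M \<mu>) \<le> ?c * \<alpha> (matpow M \<mu>)"
      by (intro mult_right_mono less_imp_le[OF \<alpha>_pos]) simp
    then show ?thesis using c0[of \<mu>] by simp
  qed
  have "\<alpha> (matpow M (\<mu> + s)) \<le> ?c ^ s * \<alpha> (matpow M \<mu>)" for \<mu> s
  proof (induction s)
    case (Suc s)
    have "\<alpha> (matpow M (\<mu> + Suc s)) \<le> ?c * \<alpha> (matpow M (\<mu> + s))" using step[of "\<mu> + s"] by simp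
    also have "\<dots> \<le> ?c * (?c ^ s * \<alpha> (matpow M \<mu>))" using Suc by (intro mult_left_mono) auto
    finally show ?case by (simp add: mult.assoc)
  qed simp
  then show thesis using that[of ?c] by simp
qed

text \<open>M^n is M^(n-\<mu>) times M^\<mu>, so the inclusion reduces to that of the unit cube in
  the cell of M^(n-\<mu>). The gap therefore does not depend on \<mu>.\<close>

lemma nested_cells:
  obtains \<nu>0 where "\<And>\<mu> n. n \<ge> \<mu> + \<nu>0 \<Longrightarrow> freq_cell (matpow M \<mu>) \<subseteq> freq_cell (matpow M n)"
proof -
  obtain s where s: "\<And>n. n \<ge> s \<Longrightarrow> unit_cube \<subseteq> freq_cell (1 *\<^sub>R matpow M n)"
    using eventually_unit_cube_subset[OF dil, of 1] by auto
  show thesis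
  proof (rule that)
    fix \<mu> n assume n: "n \<ge> \<mu> + s"
    then have "freq_cell (matpow M \<mu>) \<subseteq> freq_cell (matpow M (n - \<mu>) ** matpow M \<mu>)"
      using s[of "n - \<mu>"] by (intro freq_cell_mono) simp
    then show "freq_cell (matpow M \<mu>) \<subseteq> freq_cell (matpow M n)"
      using n by (simp flip: matpow_add)
  qed
qed

text \<open>Passing from the scale \<delta> to a smaller \<delta>' costs a fixed number of
  dilations. This is how errors at different admissible scales become comparable.\<close>

lemma shifted_cells:
  assumes "0 < \<delta>" "\<delta> \<le> 1" "0 < \<delta>'"
  obtains s where "\<And>\<mu>. freq_cell (\<delta> *\<^sub>R matpow M \<mu>) \<subseteq> freq_cell (\<delta>' *\<^sub>R matpow M (\<mu> + s))"
proof -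
  obtain s where "\<And>n. n \<ge> s \<Longrightarrow> unit_cube \<subseteq> freq_cell (\<delta>' *\<^sub>R matpow M n)"
    by (rule eventually_unit_cube_subset[OF dil assms(3)], rule that)
  then have s: "unit_cube \<subseteq> freq_cell (\<delta>' *\<^sub>R matpow M s)" by simp
  have "freq_cell (\<delta> *\<^sub>R matpow M \<mu>) \<subseteq> freq_cell (\<delta>' *\<^sub>R matpow M (\<mu> + s))" for \<mu>
  proof -
    have "\<delta>' *\<^sub>R matpow M (\<mu> + s) = (\<delta>' *\<^sub>R matpow M s) ** matpow M \<mu>"
      by (simp only: add.commute[of \<mu> s] matpow_add scalar_matrix_assoc)
    then show ?thesis
      using freq_cell_scaleR_subset[OF assms(1,2), of "matpow M \<mu>"] freq_cell_mono[OF s, of "matpow M \<mu>"] by simp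
  qed
  then show thesis by (rule that)
qed

text \<open>On the smaller cell both cut-offs equal 1, so the two multipliers coincide on the band
  of \<open>T\<close>.\<close>

lemma convolve_kernel_cong:
  assumes T: "T \<in> bandlimited (\<delta> *\<^sub>R matpow M \<mu>)" and d: "0 < \<delta>" "\<delta> \<le> 1"
    and sub: "freq_cell (matpow M \<mu>) \<subseteq> freq_cell (matpow M n)"
  shows "convolve T (inv_fourier (\<kappa> \<mu>)) y = convolve T (inv_fourier (\<kappa> n)) y"
proof -
  obtain c where c: "\<And>\<mu>. integrable lborel (inv_fourier (\<kappa> \<mu>))" by (rule mollified_bound, rule that)
  have "\<kappa> \<mu> \<xi> = \<kappa> n \<xi>" if "\<xi> \<in> freq_cell (\<delta> *\<^sub>R matpow M \<mu>)" for \<xi>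
  proof -
    have "\<xi> \<in> freq_cell (matpow M \<mu>)" using that freq_cell_scaleR_subset[OF d] by blast
    moreover from this have "\<xi> \<in> freq_cell (matpow M n)" using sub by blast
    ultimately show ?thesis by (simp only: \<kappa>_def cutoff_mat_one)
  qed
  then show ?thesis
    by (intro convolve_multiplier_cong[OF T inv_scaled[OF d(1)] \<kappa>_integrable c \<kappa>_integrable c]) simp
qed

lemma convolve_diff_bound:
  assumes T: "T \<in> bandlimited A" and T': "T' \<in> bandlimited A'" and b: "\<And>x. norm (T x - T' x) \<le> r"
    and c: "\<And>\<mu>. integrable lborel (inv_fourier (\<kappa> \<mu>))"
      "\<And>\<mu>. (LINT x|lborel. norm (inv_fourier (\<kappa> \<mu>) x)) \<le> c * \<alpha> (matpow M \<mu>)"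
  shows "norm (convolve T (inv_fourier (\<kappa> n)) y - convolve T' (inv_fourier (\<kappa> n)) y) \<le> c * \<alpha> (matpow M n) * r"
proof -
  have i: "integrable lborel (\<lambda>t. U (y - t) * inv_fourier (\<kappa> n) t)" if U: "U \<in> bandlimited A''" for U A''
  proof -
    obtain C where C: "\<And>x. norm (U x) \<le> C" using U unfolding bandlimited_def bounded_iff by auto
    show ?thesis by (rule integrable_convolve[OF C _ c(1)]) (use U in \<open>simp add: bandlimited_def\<close>)
  qed
  have r: "r \<ge> 0" using b[of 0] norm_ge_zero order_trans by blast
  have "convolve T (inv_fourier (\<kappa> n)) y - convolve T' (inv_fourier (\<kappa> n)) y = convolve (\<lambda>x. T x - T' x) (inv_fourier (\<kappa> n)) y"
    unfolding convolve_def using i[OF T] i[OF T'] by (simp add: left_diff_distrib)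
  also have "norm \<dots> \<le> r * (LINT x|lborel. norm (inv_fourier (\<kappa> n) x))"
    using T T' by (intro norm_convolve_le b c continuous_intros) (auto simp: bandlimited_def)
  also have "\<dots> \<le> r * (c * \<alpha> (matpow M n))" using c(2) r by (rule mult_left_mono)
  finally show ?thesis by (simp add: mult_ac)
qed

section \<open>Near-best approximants and the pairing\<close>

lemma near_bestD:
  assumes f: "f \<in> space_C" and n: "near_best M f \<delta> T"
  obtains C where "C \<ge> 0" "\<And>\<mu>. T \<mu> \<in> bandlimited (\<delta> *\<^sub>R matpow M \<mu>)"
    "\<And>\<mu> x. norm (f x - T \<mu> x) \<le> C * approx_error (\<delta> *\<^sub>R matpow M \<mu>) f"
proof -
  obtain c where c: "\<And>\<mu>. sup_norm (\<lambda>x. f x - T \<mu> x) \<le> ennreal c * best_approx (\<delta> *\<^sub>R matpow M \<mu>) f"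
    using n unfolding near_best_def by blast
  have e: "ennreal c * best_approx (\<delta> *\<^sub>R matpow M \<mu>) f = ennreal (max c 0 * approx_error (\<delta> *\<^sub>R matpow M \<mu>) f)" for \<mu>
    by (simp add: best_approx_finite[OF f] ennreal_mult approx_error_nonneg max_def ennreal_neg)
  show thesis
  proof (rule that[of "max c 0"])
    show "norm (f x - T \<mu> x) \<le> max c 0 * approx_error (\<delta> *\<^sub>R matpow M \<mu>) f" for \<mu> x
      using c[of \<mu>] unfolding e by (subst (asm) sup_norm_le_iff) (auto intro: mult_nonneg_nonneg approx_error_nonneg)
  qed (use n in \<open>auto simp: near_best_def\<close>)
qed

lemma near_bestI:
  assumes f: "f \<in> space_C" and T: "\<And>\<mu>. T \<mu> \<in> bandlimited (\<delta> *\<^sub>R matpow M \<mu>)"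
    and b: "\<And>\<mu> x. norm (f x - T \<mu> x) \<le> 2 * approx_error (\<delta> *\<^sub>R matpow M \<mu>) f"
  shows "near_best M f \<delta> T"
  unfolding near_best_def
proof (intro conjI allI T exI[of _ 2])
  fix \<mu>
  have "sup_norm (\<lambda>x. f x - T \<mu> x) \<le> ennreal (2 * approx_error (\<delta> *\<^sub>R matpow M \<mu>) f)"
    using b by (subst sup_norm_le_iff) (auto simp: approx_error_nonneg)
  then show "sup_norm (\<lambda>x. f x - T \<mu> x) \<le> ennreal 2 * best_approx (\<delta> *\<^sub>R matpow M \<mu>) f"
    by (simp add: best_approx_finite[OF f] ennreal_mult approx_error_nonneg)
qed

text \<open>At each \<mu> two near-best sequences are convolved with the same kernel, of norm at
  most a constant times \<alpha>(M^\<mu>). By \<open>small\<close> the difference tends to zero, so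
  all admissible sequences share the limit. The sequence \<open>T0\<close> is itself admissible,
  which gives uniqueness.\<close>

lemma pairing0_eqI:
  assumes f: "f \<in> space_C"
    and small: "\<And>\<delta>. 0 < \<delta> \<Longrightarrow> \<delta> \<le> 1 \<Longrightarrow> (\<lambda>\<mu>. \<alpha> (matpow M \<mu>) * approx_error (\<delta> *\<^sub>R matpow M \<mu>) f) \<longlonglongrightarrow> 0"
    and d0: "0 < \<delta>0" "\<delta>0 \<le> 1" and T0: "near_best M f \<delta>0 T0"
    and L: "(\<lambda>\<mu>. convolve (T0 \<mu>) (inv_fourier (\<kappa> \<mu>)) (- k)) \<longlonglongrightarrow> L"
  shows "pairing0 \<eta> M f \<psi> k = L"
  unfolding pairing0_def mollified_eq
proof (rule the_equality)
  show "\<forall>\<delta> T. 0 < \<delta> \<and> \<delta> \<le> 1 \<and> near_best M f \<delta> T \<longrightarrow> (\<lambda>\<mu>. convolve (T \<mu>) (inv_fourier (\<kappa> \<mu>)) (- k)) \<longlonglongrightarrow> L"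
  proof (intro allI impI, elim conjE)
    fix \<delta> T assume d: "0 < \<delta>" "\<delta> \<le> 1" and T: "near_best M f \<delta> T"
    obtain c where c: "c > 0" "\<And>\<mu>. integrable lborel (inv_fourier (\<kappa> \<mu>))"
      "\<And>\<mu>. (LINT x|lborel. norm (inv_fourier (\<kappa> \<mu>) x)) \<le> c * \<alpha> (matpow M \<mu>)"
      by (rule mollified_bound, rule that)
    obtain C where "C \<ge> 0" and C: "\<And>\<mu>. T \<mu> \<in> bandlimited (\<delta> *\<^sub>R matpow M \<mu>)"
      "\<And>\<mu> x. norm (f x - T \<mu> x) \<le> C * approx_error (\<delta> *\<^sub>R matpow M \<mu>) f"
      by (rule near_bestD[OF f T], rule that)
    obtain C0 where "C0 \<ge> 0" and C0: "\<And>\<mu>. T0 \<mu> \<in> bandlimited (\<delta>0 *\<^sub>R matpow M \<mu>)"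
      "\<And>\<mu> x. norm (f x - T0 \<mu> x) \<le> C0 * approx_error (\<delta>0 *\<^sub>R matpow M \<mu>) f"
      by (rule near_bestD[OF f T0], rule that)
    let ?q = "\<lambda>T \<mu>. convolve (T \<mu>) (inv_fourier (\<kappa> \<mu>)) (- k)"
    let ?b = "\<lambda>\<mu>. C * approx_error (\<delta> *\<^sub>R matpow M \<mu>) f + C0 * approx_error (\<delta>0 *\<^sub>R matpow M \<mu>) f"
    have le: "norm (?q T \<mu> - ?q T0 \<mu>) \<le> c * \<alpha> (matpow M \<mu>) * ?b \<mu>" for \<mu>
    proof (rule convolve_diff_bound[OF C(1) C0(1) _ c(2,3)])
      fix x
      have "norm (T \<mu> x - T0 \<mu> x) \<le> norm (f x - T0 \<mu> x) + norm (f x - T \<mu> x)"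
        using norm_triangle_ineq4[of "f x - T0 \<mu> x" "f x - T \<mu> x"] by simp
      then show "norm (T \<mu> x - T0 \<mu> x) \<le> ?b \<mu>" using C(2)[of x \<mu>] C0(2)[of x \<mu>] by simp
    qed
    have lim: "(\<lambda>\<mu>. c * \<alpha> (matpow M \<mu>) * ?b \<mu>) \<longlonglongrightarrow> 0"
    proof -
      have "(\<lambda>\<mu>. c * (C * (\<alpha> (matpow M \<mu>) * approx_error (\<delta> *\<^sub>R matpow M \<mu>) f) +
           C0 * (\<alpha> (matpow M \<mu>) * approx_error (\<delta>0 *\<^sub>R matpow M \<mu>) f))) \<longlonglongrightarrow> c * (C * 0 + C0 * 0)"
        by (rule tendsto_mult_left[OF tendsto_add[OF tendsto_mult_left[OF small[OF d]] tendsto_mult_left[OF small[OF d0]]]])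
      moreover have "c * (C * (x * y) + C0 * (x * z)) = c * x * (C * y + C0 * z)" for x y z
        by (simp add: algebra_simps)
      ultimately show ?thesis by (simp only: mult_zero_right add_0_left)
    qed
    have "(\<lambda>\<mu>. ?q T \<mu> - ?q T0 \<mu>) \<longlonglongrightarrow> 0"
      by (rule Lim_null_comparison[OF always_eventually[OF allI[OF le]] lim])
    from tendsto_add[OF this L] show "?q T \<longlonglongrightarrow> L" by simp
  qed
  fix L' assume "\<forall>\<delta> T. 0 < \<delta> \<and> \<delta> \<le> 1 \<and> near_best M f \<delta> T \<longrightarrow> (\<lambda>\<mu>. convolve (T \<mu>) (inv_fourier (\<kappa> \<mu>)) (- k)) \<longlonglongrightarrow> L'"
  then have "(\<lambda>\<mu>. convolve (T0 \<mu>) (inv_fourier (\<kappa> \<mu>)) (- k)) \<longlonglongrightarrow> L'" using d0 T0 by blast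
  then show "L' = L" using L by (rule LIMSEQ_unique)
qed

text \<open>On \<open>T \<mu>\<close> the kernel of level \<mu> may be replaced by that of level n.
  Both terms then carry the same kernel, and linearity leaves the distance between the two
  approximants.\<close>

lemma functional_step_bound:
  assumes f: "f \<in> space_C" and d: "0 < \<delta>" "\<delta> \<le> 1"
    and T: "\<And>\<mu>. T \<mu> \<in> bandlimited (\<delta> *\<^sub>R matpow M \<mu>)"
      "\<And>\<mu> x. norm (f x - T \<mu> x) \<le> 2 * approx_error (\<delta> *\<^sub>R matpow M \<mu>) f"
    and c: "\<And>\<mu>. integrable lborel (inv_fourier (\<kappa> \<mu>))"
      "\<And>\<mu>. (LINT x|lborel. norm (inv_fourier (\<kappa> \<mu>) x)) \<le> c * \<alpha> (matpow M \<mu>)"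
    and n: "freq_cell (matpow M \<mu>) \<subseteq> freq_cell (matpow M n)"
  shows "norm (convolve (T n) (inv_fourier (\<kappa> n)) y - convolve (T \<mu>) (inv_fourier (\<kappa> \<mu>)) y) \<le>
    2 * c * \<alpha> (matpow M n) * (approx_error (\<delta> *\<^sub>R matpow M n) f + approx_error (\<delta> *\<^sub>R matpow M \<mu>) f)"
proof -
  have "norm (T n x - T \<mu> x) \<le> 2 * (approx_error (\<delta> *\<^sub>R matpow M n) f + approx_error (\<delta> *\<^sub>R matpow M \<mu>) f)" for x
  proof -
    have "norm (T n x - T \<mu> x) \<le> norm (f x - T \<mu> x) + norm (f x - T n x)"
      using norm_triangle_ineq4[of "f x - T \<mu> x" "f x - T n x"] by simp
    then show ?thesis using T(2)[of x n] T(2)[of x \<mu>] by simp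
  qed
  from convolve_diff_bound[OF T(1) T(1) this c, of n y] show ?thesis
    by (simp only: convolve_kernel_cong[OF T(1) d n] mult_ac)
qed

text \<open>Telescoping along \<mu>, with increments dominated by a summable sequence. The
  quantifiers over \<open>f\<close>, \<open>T\<close>, \<open>S\<close> and \<open>k\<close> stand
  inside the obtained formula because \<open>R\<close> must not depend on them.\<close>

lemma functional_bound_besov:
  assumes d: "0 < \<delta>" "\<delta> \<le> 1"
  obtains R where "R \<ge> 0" "\<forall>f T S k. f \<in> space_C \<longrightarrow>
      (\<forall>N. (\<Sum>\<mu><N. \<alpha> (matpow M \<mu>) * approx_error (\<delta> *\<^sub>R matpow M \<mu>) f) \<le> S) \<longrightarrow>
      (\<forall>\<mu>. T \<mu> \<in> bandlimited (\<delta> *\<^sub>R matpow M \<mu>)) \<longrightarrow>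
      (\<forall>\<mu> x. norm (f x - T \<mu> x) \<le> 2 * approx_error (\<delta> *\<^sub>R matpow M \<mu>) f) \<longrightarrow>
      norm (pairing0 \<eta> M f \<psi> k - convolve (T 0) (inv_fourier (\<kappa> 0)) (- k)) \<le> R * S"
proof -
  obtain c where c: "c > 0" "\<And>\<mu>. integrable lborel (inv_fourier (\<kappa> \<mu>))"
    "\<And>\<mu>. (LINT x|lborel. norm (inv_fourier (\<kappa> \<mu>) x)) \<le> c * \<alpha> (matpow M \<mu>)"
    by (rule mollified_bound, rule that)
  obtain g where g: "g \<ge> 1" "\<And>\<mu> s. \<alpha> (matpow M (\<mu> + s)) \<le> g ^ s * \<alpha> (matpow M \<mu>)"
    by (rule \<alpha>_growth, rule that)
  obtain \<nu>0 where \<nu>0: "\<And>\<mu> n. n \<ge> \<mu> + \<nu>0 \<Longrightarrow> freq_cell (matpow M \<mu>) \<subseteq> freq_cell (matpow M n)"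
    by (rule nested_cells, rule that)
  \<comment> \<open>The price for replacing \<alpha> at level \<mu> + \<nu>0 + 1 by its value at
    level \<mu> or \<mu> + 1.\<close>
  define G where "G = g ^ Suc \<nu>0"
  have G: "G \<ge> 1" "g ^ \<nu>0 \<le> G"
    unfolding G_def using g(1) by (intro one_le_power power_increasing; simp)+
  show thesis
  proof (rule that[of "8 * c * G"], goal_cases)
    case 1
    show ?case using c(1) G(1) by simp
  next
    case 2
    show ?case
    proof (intro allI impI)
      fix f T S k assume f: "f \<in> space_C"
        and S': "\<forall>N. (\<Sum>\<mu><N. \<alpha> (matpow M \<mu>) * approx_error (\<delta> *\<^sub>R matpow M \<mu>) f) \<le> S"
        and T': "\<forall>\<mu>. T \<mu> \<in> bandlimited (\<delta> *\<^sub>R matpow M \<mu>)"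
          "\<forall>\<mu> x. norm (f x - T \<mu> x) \<le> 2 * approx_error (\<delta> *\<^sub>R matpow M \<mu>) f"
      note S = S'[rule_format] and T = T'[rule_format]
      define e where "e \<mu> = approx_error (\<delta> *\<^sub>R matpow M \<mu>) f" for \<mu>
      define a where "a \<mu> = \<alpha> (matpow M \<mu>) * e \<mu>" for \<mu>
      define q where "q \<mu> = convolve (T \<mu>) (inv_fourier (\<kappa> \<mu>)) (- k)" for \<mu>
      have e0: "e \<mu> \<ge> 0" for \<mu> by (simp add: e_def approx_error_nonneg)
      have a0: "a \<mu> \<ge> 0" for \<mu> using e0 \<alpha>_pos by (simp add: a_def less_imp_le)
      have Sa: "(\<Sum>\<mu><N. a \<mu>) \<le> S" for N using S by (simp add: a_def e_def)
      have sa: "summable a" by (rule summableI_nonneg_bounded[OF a0 Sa])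
      have sumS: "suminf a \<le> S" by (rule suminf_le_const[OF sa Sa])
      \<comment> \<open>Terms of a convergent series tend to zero, which settles the scale \<delta>.
        Another scale is reached by a shift of \<open>s\<close> levels, at the cost of the factor
        \<open>g ^ s\<close>.\<close>
      have small: "(\<lambda>\<mu>. \<alpha> (matpow M \<mu>) * approx_error (\<delta>' *\<^sub>R matpow M \<mu>) f) \<longlonglongrightarrow> 0" if d': "0 < \<delta>'" "\<delta>' \<le> 1" for \<delta>'
      proof -
        obtain s where s: "\<And>\<mu>. freq_cell (\<delta> *\<^sub>R matpow M \<mu>) \<subseteq> freq_cell (\<delta>' *\<^sub>R matpow M (\<mu> + s))"
          by (rule shifted_cells[OF d d'(1)], rule that)
        have le: "norm (\<alpha> (matpow M (\<mu> + s)) * approx_error (\<delta>' *\<^sub>R matpow M (\<mu> + s)) f) \<le> g ^ s * a \<mu>" for \<mu>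
        proof -
          have "\<alpha> (matpow M (\<mu> + s)) * approx_error (\<delta>' *\<^sub>R matpow M (\<mu> + s)) f \<le> (g ^ s * \<alpha> (matpow M \<mu>)) * e \<mu>"
            unfolding e_def
          proof (rule mult_mono[OF g(2) approx_error_mono[OF f s]])
            show "0 \<le> g ^ s * \<alpha> (matpow M \<mu>)" using g(1) \<alpha>_pos[of "matpow M \<mu>"] by simp
          qed (rule approx_error_nonneg)
          moreover have "0 \<le> \<alpha> (matpow M (\<mu> + s)) * approx_error (\<delta>' *\<^sub>R matpow M (\<mu> + s)) f"
            by (rule mult_nonneg_nonneg[OF less_imp_le[OF \<alpha>_pos] approx_error_nonneg])
          ultimately show ?thesis by (simp only: real_norm_def abs_of_nonneg a_def mult.assoc)
        qed
        have "(\<lambda>\<mu>. g ^ s * a \<mu>) \<longlonglongrightarrow> 0"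
          using tendsto_mult_left[OF summable_LIMSEQ_zero[OF sa], of "g ^ s"] by (simp only: mult_zero_right)
        then have "(\<lambda>\<mu>. \<alpha> (matpow M (\<mu> + s)) * approx_error (\<delta>' *\<^sub>R matpow M (\<mu> + s)) f) \<longlonglongrightarrow> 0"
          by (rule Lim_null_comparison[OF always_eventually[OF allI[OF le]]])
        then show ?thesis by (rule LIMSEQ_offset)
      qed
      define b where "b \<mu> = 2 * c * G * (2 * a (\<mu> + Suc \<nu>0) + a \<mu> + a (Suc \<mu>))" for \<mu>
      have step: "norm (q (Suc \<mu>) - q \<mu>) \<le> b \<mu>" for \<mu>
      proof -
        \<comment> \<open>Consecutive levels are compared through a third one, since the cell of
          level \<mu> need not lie in that of level \<mu> + 1. A gap of \<nu>0 + 1 from \<mu> is a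
          gap of \<nu>0 from \<mu> + 1, enough for both comparisons.\<close>
        let ?n = "\<mu> + Suc \<nu>0"
        have "norm (q (Suc \<mu>) - q \<mu>) \<le> norm (q ?n - q \<mu>) + norm (q ?n - q (Suc \<mu>))"
          using norm_triangle_ineq4[of "q ?n - q \<mu>" "q ?n - q (Suc \<mu>)"] by simp
        also have "\<dots> \<le> 2 * c * \<alpha> (matpow M ?n) * (e ?n + e \<mu>) + 2 * c * \<alpha> (matpow M ?n) * (e ?n + e (Suc \<mu>))"
          unfolding q_def e_def
          by (rule add_mono; rule functional_step_bound[OF f d T c(2,3)], rule \<nu>0, simp)
        also have "\<dots> = 2 * c * (2 * a ?n + \<alpha> (matpow M ?n) * e \<mu> + \<alpha> (matpow M ?n) * e (Suc \<mu>))"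
          by (simp add: a_def algebra_simps)
        also have "\<dots> \<le> 2 * c * (G * (2 * a ?n) + G * a \<mu> + G * a (Suc \<mu>))"
        proof (intro mult_left_mono add_mono)
          show "2 * a ?n \<le> G * (2 * a ?n)" using G(1) a0[of ?n] by (simp add: mult_le_cancel_right1)
          show "\<alpha> (matpow M ?n) * e \<mu> \<le> G * a \<mu>"
            using mult_right_mono[OF g(2)[of \<mu> "Suc \<nu>0"] e0[of \<mu>]] by (simp add: G_def a_def mult_ac)
          have "\<alpha> (matpow M ?n) * e (Suc \<mu>) \<le> (g ^ \<nu>0 * \<alpha> (matpow M (Suc \<mu>))) * e (Suc \<mu>)"
            using mult_right_mono[OF g(2)[of "Suc \<mu>" \<nu>0] e0[of "Suc \<mu>"]] by simp
          also have "\<dots> \<le> G * a (Suc \<mu>)"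
            using mult_right_mono[OF G(2) a0[of "Suc \<mu>"]] by (simp add: a_def mult_ac)
          finally show "\<alpha> (matpow M ?n) * e (Suc \<mu>) \<le> G * a (Suc \<mu>)" .
        qed (use c in auto)
        also have "\<dots> = b \<mu>" by (simp add: b_def algebra_simps)
        finally show ?thesis .
      qed
      have s1: "summable (\<lambda>\<mu>. a (\<mu> + m))" "(\<Sum>\<mu>. a (\<mu> + m)) \<le> S" for m
      proof -
        show "summable (\<lambda>\<mu>. a (\<mu> + m))" by (rule summable_ignore_initial_segment[OF sa])
        have "0 \<le> (\<Sum>\<mu><m. a \<mu>)" by (intro sum_nonneg a0)
        then show "(\<Sum>\<mu>. a (\<mu> + m)) \<le> S"
          using suminf_split_initial_segment[OF sa, of m] sumS by linarith
      qed
      have "(\<lambda>\<mu>. 2 * c * G * (2 * a (\<mu> + Suc \<nu>0) + a (\<mu> + 0) + a (\<mu> + 1))) sums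
        (2 * c * G * (2 * (\<Sum>\<mu>. a (\<mu> + Suc \<nu>0)) + (\<Sum>\<mu>. a (\<mu> + 0)) + (\<Sum>\<mu>. a (\<mu> + 1))))"
        by (intro sums_mult sums_add summable_sums s1(1))
      then have bs: "b sums (2 * c * G * (2 * (\<Sum>\<mu>. a (\<mu> + Suc \<nu>0)) + (\<Sum>\<mu>. a (\<mu> + 0)) + (\<Sum>\<mu>. a (\<mu> + 1))))"
        by (simp add: b_def[abs_def])
      \<comment> \<open>Four shifted copies of the series, each at most \<open>S\<close>: together
        with the factor 2 they make the constant \<open>8 * c * G\<close>.\<close>
      have "suminf b \<le> 2 * c * G * (2 * S + S + S)"
        unfolding sums_unique[OF bs, symmetric]
      proof (rule mult_left_mono)
        show "2 * (\<Sum>\<mu>. a (\<mu> + Suc \<nu>0)) + (\<Sum>\<mu>. a (\<mu> + 0)) + (\<Sum>\<mu>. a (\<mu> + 1)) \<le> 2 * S + S + S"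
          using s1(2)[of "Suc \<nu>0"] s1(2)[of 0] s1(2)[of 1] by linarith
        show "0 \<le> 2 * c * G" using c(1) G(1) by simp
      qed
      then have bS: "suminf b \<le> 8 * c * G * S" by simp
      have sn: "summable (\<lambda>\<mu>. norm (q (Suc \<mu>) - q \<mu>))"
        by (rule summable_comparison_test'[OF sums_summable[OF bs], of 0]) (simp add: step)
      let ?L = "q 0 + (\<Sum>\<mu>. q (Suc \<mu>) - q \<mu>)"
      have "(\<lambda>N. q 0 + (\<Sum>\<mu><N. q (Suc \<mu>) - q \<mu>)) \<longlonglongrightarrow> ?L"
        by (rule tendsto_add[OF tendsto_const summable_LIMSEQ[OF summable_norm_cancel[OF sn]]])
      moreover have "q 0 + (\<Sum>\<mu><N. q (Suc \<mu>) - q \<mu>) = q N" for N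
        by (simp add: sum_lessThan_telescope)
      ultimately have "(\<lambda>N. q N) \<longlonglongrightarrow> ?L" by (simp only:)
      then have lim: "(\<lambda>\<mu>. convolve (T \<mu>) (inv_fourier (\<kappa> \<mu>)) (- k)) \<longlonglongrightarrow> ?L" by (simp only: q_def)
      have "pairing0 \<eta> M f \<psi> k = ?L"
        by (rule pairing0_eqI[OF f _ d near_bestI[OF f T] lim]) (rule small)
      then have "norm (pairing0 \<eta> M f \<psi> k - q 0) = norm (\<Sum>\<mu>. q (Suc \<mu>) - q \<mu>)" by (simp only: add_diff_cancel_left')
      also have "\<dots> \<le> (\<Sum>\<mu>. norm (q (Suc \<mu>) - q \<mu>))" by (rule summable_norm[OF sn])
      also have "\<dots> \<le> suminf b" by (rule suminf_le[OF step sn sums_summable[OF bs]])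
      also note bS
      finally show "norm (pairing0 \<eta> M f \<psi> k - convolve (T 0) (inv_fourier (\<kappa> 0)) (- k)) \<le> 8 * c * G * S"
        by (simp only: q_def)
    qed
  qed
qed

text \<open>Band-limited functions with growing cells are dense in C, because the inverse powers of
  M tend to zero. With a constant weight this takes the place of summability of the errors.\<close>

lemma approx_error_tendsto_0:
  assumes f: "f \<in> space_C" and d: "\<delta> > 0"
  shows "(\<lambda>\<mu>. approx_error (\<delta> *\<^sub>R matpow M \<mu>) f) \<longlonglongrightarrow> 0"
proof (rule LIMSEQ_I)
  fix r :: real assume r: "r > 0"
  have inv: "matrix_inv (\<delta> *\<^sub>R matpow M n) = (1 / \<delta>) *\<^sub>R matrix_inv (matpow M n)" for n
  proof (rule matrix_inv_unique)
    have "(\<delta> *\<^sub>R matpow M n) ** ((1 / \<delta>) *\<^sub>R matrix_inv (matpow M n)) = (\<delta> * (1 / \<delta>)) *\<^sub>R (matpow M n ** matrix_inv (matpow M n))"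
      by (simp only: scalar_matrix_assoc[symmetric] matrix_scalar_ac scaleR_scaleR mult.commute)
    then show "(\<delta> *\<^sub>R matpow M n) ** ((1 / \<delta>) *\<^sub>R matrix_inv (matpow M n)) = mat 1"
      using d by (simp add: matrix_inv_mult[OF invertible_matpow[OF invM]])
  qed
  have "(\<lambda>n. matrix_inv (\<delta> *\<^sub>R matpow M n) *v t) \<longlonglongrightarrow> 0" for t
    using tendsto_scaleR[OF tendsto_const[of "1 / \<delta>"] dilation_inverse_powers_tendsto_0[OF dil, of t]]
    by (simp add: inv scaleR_matrix_vector_assoc)
  then have "\<forall>\<^sub>F n in sequentially. \<exists>g\<in>bandlimited (\<delta> *\<^sub>R matpow M n). \<forall>x. norm (f x - g x) \<le> r / 2"
    using r by (intro bandlimited_approximation f inv_scaled d) auto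
  then have "\<forall>\<^sub>F n in sequentially. norm (approx_error (\<delta> *\<^sub>R matpow M n) f - 0) < r"
  proof (rule eventually_mono)
    fix n assume "\<exists>g\<in>bandlimited (\<delta> *\<^sub>R matpow M n). \<forall>x. norm (f x - g x) \<le> r / 2"
    then obtain g where g: "g \<in> bandlimited (\<delta> *\<^sub>R matpow M n)" "\<And>x. norm (f x - g x) \<le> r / 2" by auto
    have "approx_error (\<delta> *\<^sub>R matpow M n) f \<le> r / 2" by (rule approx_error_le[OF f g])
    then show "norm (approx_error (\<delta> *\<^sub>R matpow M n) f - 0) < r"
      using r approx_error_nonneg[of "\<delta> *\<^sub>R matpow M n" f] by simp
  qed
  then show "\<exists>no. \<forall>n\<ge>no. norm (approx_error (\<delta> *\<^sub>R matpow M n) f - 0) < r"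
    by (simp only: eventually_sequentially)
qed

text \<open>The kernel norms stay bounded, so the direct comparison of levels \<mu> and n costs a
  multiple of the two errors, however large the gap. As errors tend to zero the functionals form a
  Cauchy sequence, and comparing level 0 with level n in the limit leaves the error of level 0
  alone.\<close>

lemma functional_bound_const:
  assumes d: "0 < \<delta>" "\<delta> \<le> 1" and const: "\<And>A. \<alpha> A = a"
  obtains R where "R \<ge> 0" "\<forall>f T k. f \<in> space_C \<longrightarrow>
      (\<forall>\<mu>. T \<mu> \<in> bandlimited (\<delta> *\<^sub>R matpow M \<mu>)) \<longrightarrow>
      (\<forall>\<mu> x. norm (f x - T \<mu> x) \<le> 2 * approx_error (\<delta> *\<^sub>R matpow M \<mu>) f) \<longrightarrow>
      norm (pairing0 \<eta> M f \<psi> k - convolve (T 0) (inv_fourier (\<kappa> 0)) (- k)) \<le> R * approx_error (\<delta> *\<^sub>R matpow M 0) f"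
proof -
  obtain c where c: "c > 0" "\<And>\<mu>. integrable lborel (inv_fourier (\<kappa> \<mu>))"
    "\<And>\<mu>. (LINT x|lborel. norm (inv_fourier (\<kappa> \<mu>) x)) \<le> c * \<alpha> (matpow M \<mu>)"
    by (rule mollified_bound, rule that)
  obtain \<nu>0 where \<nu>0: "\<And>\<mu> n. n \<ge> \<mu> + \<nu>0 \<Longrightarrow> freq_cell (matpow M \<mu>) \<subseteq> freq_cell (matpow M n)"
    by (rule nested_cells, rule that)
  have a: "a > 0" using \<alpha>_pos const by metis
  define D where "D = 2 * c * a"
  have D: "D > 0" using a c(1) by (simp add: D_def)
  show thesis
  proof (rule that[of D], goal_cases)
    case 1
    show ?case using D by simp
  next
    case 2
    show ?case
    proof (intro allI impI)
      fix f T k assume f: "f \<in> space_C"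
        and T': "\<forall>\<mu>. T \<mu> \<in> bandlimited (\<delta> *\<^sub>R matpow M \<mu>)"
          "\<forall>\<mu> x. norm (f x - T \<mu> x) \<le> 2 * approx_error (\<delta> *\<^sub>R matpow M \<mu>) f"
      note T = T'[rule_format]
      define e where "e \<mu> = approx_error (\<delta> *\<^sub>R matpow M \<mu>) f" for \<mu>
      define q where "q \<mu> = convolve (T \<mu>) (inv_fourier (\<kappa> \<mu>)) (- k)" for \<mu>
      have e: "e \<longlonglongrightarrow> 0" unfolding e_def[abs_def] by (rule approx_error_tendsto_0[OF f d(1)])
      have step: "norm (q n - q \<mu>) \<le> D * (e n + e \<mu>)" if n: "n \<ge> \<mu> + \<nu>0" for \<mu> n
        using functional_step_bound[OF f d T c(2,3) \<nu>0[OF n], of "- k"] unfolding q_def e_def D_def const .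
      have "Cauchy q"
      proof (rule metric_CauchyI)
        fix r :: real assume r: "r > 0"
        have "r / (4 * D) > 0" using r D by simp
        from order_tendstoD(2)[OF e this] obtain N where N: "\<And>n. n \<ge> N \<Longrightarrow> e n < r / (4 * D)"
          unfolding eventually_sequentially by blast
        \<comment> \<open>Indices close to each other cannot be compared directly because of the gap
          \<nu>0; both are compared with the common earlier index \<open>N\<close>.\<close>
        have half: "norm (q n - q N) < r / 2" if n: "n \<ge> N + \<nu>0" for n
        proof -
          have "e n < r / (4 * D)" "e N < r / (4 * D)" using N[of n] N[of N] n by simp_all
          then have "e n + e N < r / (2 * D)" by simp
          then have "D * (e n + e N) < D * (r / (2 * D))" using D by (rule mult_strict_left_mono)
          also have "D * (r / (2 * D)) = r / 2" using D by simp
          finally show ?thesis using step[OF n] by linarith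
        qed
        show "\<exists>M. \<forall>m\<ge>M. \<forall>n\<ge>M. dist (q m) (q n) < r"
        proof (intro exI allI impI)
          fix m n assume "m \<ge> N + \<nu>0" "n \<ge> N + \<nu>0"
          then show "dist (q m) (q n) < r"
            using half[of m] half[of n] norm_triangle_ineq4[of "q m - q N" "q n - q N"] by (simp add: dist_norm)
        qed
      qed
      then obtain L where L: "q \<longlonglongrightarrow> L" using Cauchy_convergent convergentD by blast
      have small: "(\<lambda>\<mu>. \<alpha> (matpow M \<mu>) * approx_error (\<delta>' *\<^sub>R matpow M \<mu>) f) \<longlonglongrightarrow> 0" if d': "0 < \<delta>'" "\<delta>' \<le> 1" for \<delta>'
        unfolding const using tendsto_mult_left[OF approx_error_tendsto_0[OF f d'(1)], of a] by (simp only: mult_zero_right)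
      have p: "pairing0 \<eta> M f \<psi> k = L"
        by (rule pairing0_eqI[OF f _ d near_bestI[OF f T] L[unfolded q_def[abs_def]]]) (rule small)
      \<comment> \<open>Letting n tend to infinity in \<open>step\<close> with \<mu> = 0: the error
        at level n disappears.\<close>
      have "(\<lambda>n. norm (q n - q 0)) \<longlonglongrightarrow> norm (L - q 0)"
        by (rule tendsto_norm[OF tendsto_diff[OF L tendsto_const]])
      moreover have "(\<lambda>n. D * (e n + e 0)) \<longlonglongrightarrow> D * (0 + e 0)"
        by (rule tendsto_mult_left[OF tendsto_add[OF e tendsto_const]])
      ultimately have "norm (L - q 0) \<le> D * (0 + e 0)"
        by (rule LIMSEQ_le) (use step[of 0] in auto)
      then show "norm (pairing0 \<eta> M f \<psi> k - convolve (T 0) (inv_fourier (\<kappa> 0)) (- k)) \<le> D * approx_error (\<delta> *\<^sub>R matpow M 0) f"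
        unfolding p q_def e_def by (simp only: add_0_left)
    qed
  qed
qed

section \<open>The error of the operator at level zero\<close>

lemma freq_cell_scaled_unit: "freq_cell (\<delta> *\<^sub>R matpow M 0) = (*\<^sub>R) \<delta> ` unit_cube"
  by (simp add: transpose_scalar transpose_mat scaleR_matrix_vector_assoc[symmetric])

text \<open>Since the operator reproduces \<open>T\<close>, the error is f - T minus a series whose
  coefficients are differences of functionals. These are at most \<open>r\<close>, and the absolute
  values of \<phi> along the lattice add up to at most \<open>B\<close>.\<close>

lemma sampling_error:
  fixes f \<phi> :: "real^'n \<Rightarrow> complex"
  assumes d: "0 < \<delta>" "\<delta> \<le> 1" and LC: "\<phi> \<in> class_LC" and supp: "fun_support (fourier \<phi>) \<subseteq> unit_cube"
    and compat: "strictly_compatible \<phi> \<psi> \<delta>"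
    and B: "\<And>x. summable (\<lambda>n. norm (\<phi> (x + lattice_enum n)))" "\<And>x. (\<Sum>n. norm (\<phi> (x + lattice_enum n))) \<le> B"
    and T: "T \<in> bandlimited (\<delta> *\<^sub>R matpow M 0)" "\<And>x. norm (f x - T x) \<le> t"
    and r: "\<And>k. norm (pairing0 \<eta> M f \<psi> k - convolve T (inv_fourier (\<kappa> 0)) (- k)) \<le> r"
  shows "norm (f x - (\<Sum>\<^sub>\<infinity>k\<in>int_lattice. pairing0 \<eta> M f \<psi> k * \<phi> (x + k))) \<le> t + r * B"
proof -
  let ?e = "lattice_enum :: nat \<Rightarrow> real^'n"
  obtain c where c: "c > 0" "\<And>\<mu>. integrable lborel (inv_fourier (\<kappa> \<mu>))"
    "\<And>\<mu>. (LINT x|lborel. norm (inv_fourier (\<kappa> \<mu>) x)) \<le> c * \<alpha> (matpow M \<mu>)"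
    by (rule mollified_bound, rule that)
  \<comment> \<open>The cut-off equals 1 on the scaled cube, so the multiplier there is the
    conjugate of the transform of \<psi>; conjugating strict compatibility gives the claim.\<close>
  have AE: "AE \<xi> in lborel. \<xi> \<in> freq_cell (\<delta> *\<^sub>R matpow M 0) \<longrightarrow> fourier \<phi> \<xi> * \<kappa> 0 \<xi> = 1"
    using compat unfolding strictly_compatible_def freq_cell_scaled_unit
  proof eventually_elim
    case (elim \<xi>)
    show ?case
    proof
      assume x: "\<xi> \<in> (*\<^sub>R) \<delta> ` unit_cube"
      then have "\<xi> \<in> freq_cell (matpow M 0)"
        using freq_cell_scaleR_subset[OF d, of "matpow M 0"] unfolding freq_cell_scaled_unit by blast
      then have "\<kappa> 0 \<xi> = cnj (fourier_fun \<psi> \<xi>)" by (simp only: \<kappa>_def cutoff_mat_one of_real_1 mult_1_left)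
      then have "fourier \<phi> \<xi> * \<kappa> 0 \<xi> = cnj (cnj (fourier \<phi> \<xi>) * fourier_fun \<psi> \<xi>)" by simp
      then show "fourier \<phi> \<xi> * \<kappa> 0 \<xi> = 1" using elim x by simp
    qed
  qed
  have sub: "freq_cell (\<delta> *\<^sub>R matpow M 0) \<subseteq> unit_cube"
    using freq_cell_scaleR_subset[OF d, of "mat 1"] unfolding matpow_0 freq_cell_one .
  have rep: "(\<Sum>n. convolve T (inv_fourier (\<kappa> 0)) (- ?e n) * \<phi> (x + ?e n)) = T x"
    by (rule sampling_reproduces[OF LC supp T(1) inv_scaled[OF d(1)] sub \<kappa>_integrable c(2) AE])
  let ?p = "\<lambda>n. pairing0 \<eta> M f \<psi> (?e n)"
  let ?c = "\<lambda>n. convolve T (inv_fourier (\<kappa> 0)) (- ?e n)"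
  let ?\<phi> = "\<lambda>n. \<phi> (x + ?e n)"
  obtain C where C: "\<And>x. norm (T x) \<le> C" using T(1) unfolding bandlimited_def bounded_iff by auto
  let ?N = "C * (LINT t|lborel. norm (inv_fourier (\<kappa> 0) t))"
  have cb: "norm (?c n) \<le> ?N" for n
    by (rule norm_convolve_le[OF C _ c(2)]) (use T(1) in \<open>simp add: bandlimited_def\<close>)
  have r0: "r \<ge> 0" by (rule order_trans[OF norm_ge_zero r[of 0]])
  have dsum: "summable (\<lambda>n. norm ((?p n - ?c n) * ?\<phi> n))"
    by (rule summable_comparison_test'[OF summable_mult[OF B(1)[of x], of r], of 0])
      (simp add: norm_mult mult_right_mono r)
  have csum: "summable (\<lambda>n. norm (?c n * ?\<phi> n))"
    by (rule summable_comparison_test'[OF summable_mult[OF B(1)[of x], of ?N], of 0])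
      (simp add: norm_mult mult_right_mono cb)
  have eq: "?p n * ?\<phi> n = (?p n - ?c n) * ?\<phi> n + ?c n * ?\<phi> n" for n by (simp add: left_diff_distrib)
  have psum: "summable (\<lambda>n. norm (?p n * ?\<phi> n))"
  proof (rule summable_comparison_test'[OF summable_add[OF dsum csum], of 0])
    show "norm (norm (?p n * ?\<phi> n)) \<le> norm ((?p n - ?c n) * ?\<phi> n) + norm (?c n * ?\<phi> n)" for n
      unfolding eq real_norm_def abs_norm_cancel by (rule norm_triangle_ineq)
  qed
  have "(\<Sum>\<^sub>\<infinity>k\<in>int_lattice. pairing0 \<eta> M f \<psi> k * \<phi> (x + k)) = (\<Sum>n. ?p n * ?\<phi> n)"
    using infsum_int_lattice[of "\<lambda>k. pairing0 \<eta> M f \<psi> k * \<phi> (x + k)"] psum by blast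
  also have "\<dots> = (\<Sum>n. (?p n - ?c n) * ?\<phi> n + ?c n * ?\<phi> n)" by (simp only: eq[symmetric])
  also have "\<dots> = (\<Sum>n. (?p n - ?c n) * ?\<phi> n) + T x"
    unfolding rep[symmetric] by (rule suminf_add[symmetric]) (rule summable_norm_cancel[OF dsum], rule summable_norm_cancel[OF csum])
  finally have "f x - (\<Sum>\<^sub>\<infinity>k\<in>int_lattice. pairing0 \<eta> M f \<psi> k * \<phi> (x + k)) = (f x - T x) - (\<Sum>n. (?p n - ?c n) * ?\<phi> n)"
    by (simp only: diff_diff_eq add.commute)
  then have "norm (f x - (\<Sum>\<^sub>\<infinity>k\<in>int_lattice. pairing0 \<eta> M f \<psi> k * \<phi> (x + k))) =
      norm ((f x - T x) - (\<Sum>n. (?p n - ?c n) * ?\<phi> n))" by (rule arg_cong)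
  also have "\<dots> \<le> norm (f x - T x) + norm (\<Sum>n. (?p n - ?c n) * ?\<phi> n)" by (rule norm_triangle_ineq4)
  also have "\<dots> \<le> t + r * B"
  proof (rule add_mono[OF T(2)])
    have le: "norm ((?p n - ?c n) * ?\<phi> n) \<le> r * norm (?\<phi> n)" for n
      unfolding norm_mult by (rule mult_right_mono[OF r[of "?e n"] norm_ge_zero])
    have rs: "summable (\<lambda>n. r * norm (?\<phi> n))" by (rule summable_mult[OF B(1)[of x]])
    have "norm (\<Sum>n. (?p n - ?c n) * ?\<phi> n) \<le> (\<Sum>n. norm ((?p n - ?c n) * ?\<phi> n))" by (rule summable_norm[OF dsum])
    also have "\<dots> \<le> (\<Sum>n. r * norm (?\<phi> n))" by (rule suminf_le[OF le dsum rs])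
    also have "\<dots> = r * (\<Sum>n. norm (?\<phi> n))" by (rule suminf_mult[OF B(1)[of x]])
    also have "\<dots> \<le> r * B" by (rule mult_left_mono[OF B(2)[of x] r0])
    finally show "norm (\<Sum>n. (?p n - ?c n) * ?\<phi> n) \<le> r * B" .
  qed
  finally show ?thesis .
qed

section \<open>Dilation to level zero\<close>

definition rescale :: "nat \<Rightarrow> (real^'n \<Rightarrow> complex) \<Rightarrow> real^'n \<Rightarrow> complex" where
  "rescale j f x = f (matrix_inv (matpow M j) *v x)"

text \<open>The normalizing powers of |det M| in the pairing and in the dilated \<phi> cancel, so
  level j of the operator is level 0 applied to the rescaled function.\<close>

lemma quasi_proj_eq:
  "quasi_proj \<eta> M j f \<phi> \<psi> x = (\<Sum>\<^sub>\<infinity>k\<in>int_lattice. pairing0 \<eta> M (rescale j f) \<psi> k * \<phi> (matpow M j *v x + k))"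
  unfolding quasi_proj_def
proof (rule infsum_cong)
  fix k :: "real^'n"
  have "det M \<noteq> 0" using invM invertible_det_nz by blast
  then have "\<bar>det M\<bar> powr (- (real j / 2)) * \<bar>det M\<bar> powr (real j / 2) = 1"
    by (simp add: powr_minus)
  then have "complex_of_real (\<bar>det M\<bar> powr (- (real j / 2))) * complex_of_real (\<bar>det M\<bar> powr (real j / 2)) = 1"
    by (simp only: of_real_mult[symmetric] of_real_1)
  moreover have "(u * p) * (v * z) = (u * v) * (p * z)" for u p v z :: complex by (simp only: mult_ac)
  ultimately show "pairing \<eta> M f \<psi> j k * dil_shift M \<phi> j k x = pairing0 \<eta> M (rescale j f) \<psi> k * \<phi> (matpow M j *v x + k)"
    unfolding pairing_def dil_shift_def rescale_def[abs_def] by (simp only: mult_1_left)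
qed

lemma rescale_space_C:
  assumes f: "f \<in> space_C" shows "rescale j f \<in> space_C"
proof -
  have "uniformly_continuous_on UNIV (\<lambda>x. matrix_inv (matpow M j) *v x)"
    by (rule bounded_linear.uniformly_continuous_on[OF matrix_vector_mul_bounded_linear]) (simp add: uniformly_continuous_on_id)
  then have "uniformly_continuous_on UNIV (\<lambda>x. f (matrix_inv (matpow M j) *v x))"
  proof (rule uniformly_continuous_on_compose[unfolded o_def])
    show "uniformly_continuous_on (range (\<lambda>x. matrix_inv (matpow M j) *v x)) f"
      using f unfolding space_C_def uniformly_continuous_on_def by (simp, meson)
  qed
  moreover have "bounded (range (\<lambda>x. f (matrix_inv (matpow M j) *v x)))"
    by (rule bounded_subset[of "range f"]) (use f in \<open>auto simp: space_C_def\<close>)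
  ultimately show ?thesis by (simp add: space_C_def rescale_def[abs_def])
qed

text \<open>Every competitor for \<open>f\<close> becomes one for the rescaled function at the same
  distance: composition with the inverse of M^j removes the factor M^j from the band.\<close>

lemma best_approx_rescale:
  "best_approx (\<delta> *\<^sub>R matpow M \<mu>) (rescale j f) \<le> best_approx (\<delta> *\<^sub>R matpow M (\<mu> + j)) f"
  unfolding best_approx_def[of "\<delta> *\<^sub>R matpow M (\<mu> + j)"]
proof (rule INF_greatest)
  let ?B = "matpow M j"
  fix g assume g: "g \<in> bandlimited (\<delta> *\<^sub>R matpow M (\<mu> + j))"
  have B: "invertible ?B" by (rule invertible_matpow[OF invM])
  have "(\<delta> *\<^sub>R matpow M (\<mu> + j)) ** matrix_inv ?B = \<delta> *\<^sub>R (matpow M \<mu> ** (?B ** matrix_inv ?B))"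
    by (simp only: matpow_add scalar_matrix_assoc[symmetric] matrix_mul_assoc)
  then have eq: "(\<delta> *\<^sub>R matpow M (\<mu> + j)) ** matrix_inv ?B = \<delta> *\<^sub>R matpow M \<mu>"
    by (simp add: matrix_inv_mult[OF B])
  have "(\<lambda>x. g (matrix_inv ?B *v x)) \<in> bandlimited (\<delta> *\<^sub>R matpow M \<mu>)"
    using bandlimited_compose[OF g invertible_matrix_inv[OF B]] unfolding eq .
  then have "best_approx (\<delta> *\<^sub>R matpow M \<mu>) (rescale j f) \<le> sup_norm (\<lambda>x. rescale j f x - g (matrix_inv ?B *v x))"
    unfolding best_approx_def by (rule INF_lower2) (rule order_refl)
  also have "\<dots> \<le> sup_norm (\<lambda>x. f x - g x)"
    unfolding sup_norm_def rescale_def by (rule SUP_least) (rule SUP_upper2[OF UNIV_I], rule order_refl)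
  finally show "best_approx (\<delta> *\<^sub>R matpow M \<mu>) (rescale j f) \<le> sup_norm (\<lambda>x. f x - g x)" .
qed

lemma rescale_cancel: "rescale j f (matpow M j *v x) = f x"
  by (simp add: rescale_def matrix_inv_cancel[OF invertible_matpow[OF invM]])

lemma approximants_exist:
  assumes "f \<in> space_C"
  obtains T where "\<And>\<mu>. T \<mu> \<in> bandlimited (\<delta> *\<^sub>R matpow M \<mu>)"
    "\<And>\<mu> x. norm (f x - T \<mu> x) \<le> 2 * approx_error (\<delta> *\<^sub>R matpow M \<mu>) f"
proof -
  have "\<forall>\<mu>. \<exists>T. T \<in> bandlimited (\<delta> *\<^sub>R matpow M \<mu>) \<and> (\<forall>x. norm (f x - T x) \<le> 2 * approx_error (\<delta> *\<^sub>R matpow M \<mu>) f)"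
    using approximant_exists[OF assms] by blast
  then obtain T where "\<forall>\<mu>. T \<mu> \<in> bandlimited (\<delta> *\<^sub>R matpow M \<mu>) \<and> (\<forall>x. norm (f x - T \<mu> x) \<le> 2 * approx_error (\<delta> *\<^sub>R matpow M \<mu>) f)"
    by (rule choice[THEN exE])
  then show thesis by (intro that[of T]) auto
qed

lemma besov_estimate:
  fixes \<phi> :: "real^'n \<Rightarrow> complex"
  assumes d: "0 < \<delta>" "\<delta> \<le> 1" and LC: "\<phi> \<in> class_LC" and supp: "fun_support (fourier \<phi>) \<subseteq> unit_cube"
    and compat: "strictly_compatible \<phi> \<psi> \<delta>"
  shows "\<exists>c::real. \<forall>f\<in>space_C. \<forall>j. sup_norm (\<lambda>x. f x - quasi_proj \<eta> M j f \<phi> \<psi> x)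
    \<le> ennreal c * (\<Sum>\<^sub>\<infinity>\<nu>\<in>{j..}. ennreal (\<alpha> (matpow M (\<nu> - j))) * best_approx (\<delta> *\<^sub>R matpow M \<nu>) f)"
proof -
  obtain B where B: "B \<ge> 0" "\<And>x. summable (\<lambda>n. norm (\<phi> (x + lattice_enum n)))"
    "\<And>x. (\<Sum>n. norm (\<phi> (x + lattice_enum n))) \<le> B" "\<And>x. norm (\<phi> x) \<le> B"
    by (rule class_LC_summable[OF LC], rule that)
  obtain R where R: "R \<ge> 0" "\<forall>f T S k. f \<in> space_C \<longrightarrow>
      (\<forall>N. (\<Sum>\<mu><N. \<alpha> (matpow M \<mu>) * approx_error (\<delta> *\<^sub>R matpow M \<mu>) f) \<le> S) \<longrightarrow>
      (\<forall>\<mu>. T \<mu> \<in> bandlimited (\<delta> *\<^sub>R matpow M \<mu>)) \<longrightarrow>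
      (\<forall>\<mu> x. norm (f x - T \<mu> x) \<le> 2 * approx_error (\<delta> *\<^sub>R matpow M \<mu>) f) \<longrightarrow>
      norm (pairing0 \<eta> M f \<psi> k - convolve (T 0) (inv_fourier (\<kappa> 0)) (- k)) \<le> R * S"
    by (rule functional_bound_besov[OF d], rule that)
  define \<alpha>0 where "\<alpha>0 = \<alpha> (matpow M 0)"
  have \<alpha>0: "\<alpha>0 > 0" unfolding \<alpha>0_def by (rule \<alpha>_pos)
  \<comment> \<open>The approximant of level 0 contributes twice the first error, and division by
    \<alpha>0 charges this to the first term of the weighted sum; \<open>R * B\<close> is the
    contribution of the functionals.\<close>
  define c where "c = 2 / \<alpha>0 + R * B"
  have c: "c > 0" unfolding c_def using \<alpha>0 R(1) B(1) by (intro add_pos_nonneg mult_nonneg_nonneg) auto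
  show ?thesis
  proof (intro exI[of _ c] ballI allI)
    fix f :: "real^'n \<Rightarrow> complex" and j assume f: "f \<in> space_C"
    let ?s = "\<lambda>\<nu>. ennreal (\<alpha> (matpow M (\<nu> - j))) * best_approx (\<delta> *\<^sub>R matpow M \<nu>) f"
    define \<Sigma> where "\<Sigma> = (\<Sum>\<^sub>\<infinity>\<nu>\<in>{j..}. ?s \<nu>)"
    show "sup_norm (\<lambda>x. f x - quasi_proj \<eta> M j f \<phi> \<psi> x) \<le> ennreal c * (\<Sum>\<^sub>\<infinity>\<nu>\<in>{j..}. ?s \<nu>)"
      unfolding \<Sigma>_def[symmetric]
    proof (cases "\<Sigma> = top")
      \<comment> \<open>As \<open>c\<close> is positive, the right-hand side is infinite and the
        bound trivial.\<close>
      case True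
      then show "sup_norm (\<lambda>x. f x - quasi_proj \<eta> M j f \<phi> \<psi> x) \<le> ennreal c * \<Sigma>"
        using c by (simp add: ennreal_mult_top)
    next
      case False
      then obtain S where S: "S \<ge> 0" "\<Sigma> = ennreal S" by (cases \<Sigma>) auto
      let ?g = "rescale j f"
      let ?e = "\<lambda>\<mu>. approx_error (\<delta> *\<^sub>R matpow M \<mu>) ?g"
      have g: "?g \<in> space_C" by (rule rescale_space_C[OF f])
      have sum: "(\<Sum>\<mu><N. \<alpha> (matpow M \<mu>) * ?e \<mu>) \<le> S" for N
      proof -
        have "ennreal (\<Sum>\<mu><N. \<alpha> (matpow M \<mu>) * ?e \<mu>) = (\<Sum>\<mu><N. ennreal (\<alpha> (matpow M \<mu>)) * best_approx (\<delta> *\<^sub>R matpow M \<mu>) ?g)"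
          by (subst sum_ennreal[symmetric])
            (simp_all add: best_approx_finite[OF g] ennreal_mult approx_error_nonneg less_imp_le[OF \<alpha>_pos])
        also have "\<dots> \<le> (\<Sum>\<mu><N. ?s (\<mu> + j))"
          by (rule sum_mono) (simp only: add_diff_cancel_right', rule mult_left_mono[OF best_approx_rescale zero_le])
        also have "\<dots> = sum ?s ((\<lambda>\<mu>. \<mu> + j) ` {..<N})" by (subst sum.reindex) (auto simp: inj_on_def)
        \<comment> \<open>A sum of nonnegative terms over an infinite set is the supremum of its
          finite partial sums.\<close>
        also have "\<dots> \<le> \<Sigma>"
          unfolding \<Sigma>_def nonneg_infsum_complete[OF zero_le] by (rule SUP_upper) auto
        finally show ?thesis using S by (simp add: ennreal_le_iff)
      qed
      have "\<alpha>0 * ?e 0 \<le> S" using sum[of 1] by (simp add: \<alpha>0_def)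
      then have e0: "?e 0 \<le> S / \<alpha>0" using \<alpha>0 by (simp add: pos_le_divide_eq mult.commute)
      obtain T where T: "\<And>\<mu>. T \<mu> \<in> bandlimited (\<delta> *\<^sub>R matpow M \<mu>)"
        "\<And>\<mu> x. norm (?g x - T \<mu> x) \<le> 2 * ?e \<mu>"
        by (rule approximants_exist[OF g], rule that)
      have "norm (f x - quasi_proj \<eta> M j f \<phi> \<psi> x) \<le> c * S" for x
      proof -
        have "norm (?g (matpow M j *v x) - quasi_proj \<eta> M j f \<phi> \<psi> x) \<le> 2 * ?e 0 + R * S * B"
          unfolding quasi_proj_eq
          by (rule sampling_error[OF d LC supp compat B(2,3) T(1) T(2) R(2)[rule_format, OF g sum T]])
        also have "\<dots> \<le> 2 * (S / \<alpha>0) + R * S * B" using e0 by simp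
        also have "\<dots> = c * S" by (simp add: c_def distrib_right)
        finally show ?thesis by (simp only: rescale_cancel)
      qed
      then have "sup_norm (\<lambda>x. f x - quasi_proj \<eta> M j f \<phi> \<psi> x) \<le> ennreal (c * S)"
        using c S(1) by (subst sup_norm_le_iff) auto
      then show "sup_norm (\<lambda>x. f x - quasi_proj \<eta> M j f \<phi> \<psi> x) \<le> ennreal c * \<Sigma>"
        using c S by (simp add: ennreal_mult)
    qed
  qed
qed

lemma const_estimate:
  fixes \<phi> :: "real^'n \<Rightarrow> complex"
  assumes d: "0 < \<delta>" "\<delta> \<le> 1" and LC: "\<phi> \<in> class_LC" and supp: "fun_support (fourier \<phi>) \<subseteq> unit_cube"
    and compat: "strictly_compatible \<phi> \<psi> \<delta>" and const: "\<And>A. \<alpha> A = a"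
  shows "\<exists>c::real. \<forall>f\<in>space_C. \<forall>j. sup_norm (\<lambda>x. f x - quasi_proj \<eta> M j f \<phi> \<psi> x)
    \<le> ennreal c * best_approx (\<delta> *\<^sub>R matpow M j) f"
proof -
  obtain B where B: "B \<ge> 0" "\<And>x. summable (\<lambda>n. norm (\<phi> (x + lattice_enum n)))"
    "\<And>x. (\<Sum>n. norm (\<phi> (x + lattice_enum n))) \<le> B" "\<And>x. norm (\<phi> x) \<le> B"
    by (rule class_LC_summable[OF LC], rule that)
  obtain R where R: "R \<ge> 0" "\<forall>f T k. f \<in> space_C \<longrightarrow>
      (\<forall>\<mu>. T \<mu> \<in> bandlimited (\<delta> *\<^sub>R matpow M \<mu>)) \<longrightarrow>
      (\<forall>\<mu> x. norm (f x - T \<mu> x) \<le> 2 * approx_error (\<delta> *\<^sub>R matpow M \<mu>) f) \<longrightarrow>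
      norm (pairing0 \<eta> M f \<psi> k - convolve (T 0) (inv_fourier (\<kappa> 0)) (- k)) \<le> R * approx_error (\<delta> *\<^sub>R matpow M 0) f"
    by (rule functional_bound_const[OF d const], rule that)
  \<comment> \<open>Here both contributions are multiples of the same error of level 0: 2 from the
    approximant, \<open>R * B\<close> from the functionals.\<close>
  define c where "c = 2 + R * B"
  have c: "c > 0" unfolding c_def using R(1) B(1) by (intro add_pos_nonneg mult_nonneg_nonneg) auto
  show ?thesis
  proof (intro exI[of _ c] ballI allI)
    fix f :: "real^'n \<Rightarrow> complex" and j assume f: "f \<in> space_C"
    let ?g = "rescale j f"
    let ?e = "\<lambda>\<mu>. approx_error (\<delta> *\<^sub>R matpow M \<mu>) ?g"
    have g: "?g \<in> space_C" by (rule rescale_space_C[OF f])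
    obtain T where T: "\<And>\<mu>. T \<mu> \<in> bandlimited (\<delta> *\<^sub>R matpow M \<mu>)"
      "\<And>\<mu> x. norm (?g x - T \<mu> x) \<le> 2 * ?e \<mu>"
      by (rule approximants_exist[OF g], rule that)
    have "norm (f x - quasi_proj \<eta> M j f \<phi> \<psi> x) \<le> c * ?e 0" for x
    proof -
      have "norm (?g (matpow M j *v x) - quasi_proj \<eta> M j f \<phi> \<psi> x) \<le> 2 * ?e 0 + R * ?e 0 * B"
        unfolding quasi_proj_eq
        by (rule sampling_error[OF d LC supp compat B(2,3) T(1) T(2) R(2)[rule_format, OF g T]])
      also have "\<dots> = c * ?e 0" by (simp add: c_def distrib_right)
      finally show ?thesis by (simp only: rescale_cancel)
    qed
    then have "sup_norm (\<lambda>x. f x - quasi_proj \<eta> M j f \<phi> \<psi> x) \<le> ennreal (c * ?e 0)"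
      by (subst sup_norm_le_iff) (simp_all add: mult_nonneg_nonneg less_imp_le[OF c] approx_error_nonneg)
    also have "\<dots> = ennreal c * best_approx (\<delta> *\<^sub>R matpow M 0) ?g"
      using c by (simp only: best_approx_finite[OF g] ennreal_mult[OF less_imp_le approx_error_nonneg])
    also have "\<dots> \<le> ennreal c * best_approx (\<delta> *\<^sub>R matpow M (0 + j)) f"
      by (rule mult_left_mono[OF best_approx_rescale zero_le])
    finally show "sup_norm (\<lambda>x. f x - quasi_proj \<eta> M j f \<phi> \<psi> x) \<le> ennreal c * best_approx (\<delta> *\<^sub>R matpow M j) f"
      by (simp only: add_0_left)
  qed
qed

end

theorem theorem16:
  fixes M :: "real^'n^'n" and \<delta> :: real and \<alpha> :: "real^'n^'n \<Rightarrow> real"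
    and \<eta> :: "real^'n \<Rightarrow> real"
    and \<phi> :: "real^'n \<Rightarrow> complex" and \<psi> :: "'n functional"
  assumes "cutoff \<eta>"
    and "0 < \<delta>" and "\<delta> \<le> 1"
    and "dilation_matrix M"
    and "\<alpha> \<in> class_A M"
    and "\<psi> \<in> class_S \<eta> \<alpha> M"
    and "\<phi> \<in> class_LC"
    and "fun_support (fourier \<phi>) \<subseteq> unit_cube"
    and "strictly_compatible \<phi> \<psi> \<delta>"
  shows "(\<exists>c::real. \<forall>f\<in>besov \<alpha> M. \<forall>j.
            sup_norm (\<lambda>x. f x - quasi_proj \<eta> M j f \<phi> \<psi> x)
              \<le> ennreal c * (\<Sum>\<^sub>\<infinity>\<nu>\<in>{j..}. ennreal (\<alpha> (matpow M (\<nu> - j))) *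
                                   best_approx (\<delta> *\<^sub>R matpow M \<nu>) f))
       \<and> (\<psi> \<in> class_S_const \<eta> M \<longrightarrow>
          (\<exists>c::real. \<forall>f\<in>space_C. \<forall>j.
            sup_norm (\<lambda>x. f x - quasi_proj \<eta> M j f \<phi> \<psi> x)
              \<le> ennreal c * best_approx (\<delta> *\<^sub>R matpow M j) f))"
proof (intro conjI impI)
  obtain \<rho> :: "real^'n \<Rightarrow> complex" where \<rho>:
    "\<And>a b. a \<noteq> 0 \<Longrightarrow> test_function (\<lambda>x. \<rho> (b + a *\<^sub>R x))"
    "\<And>x. x \<notin> unit_cube \<Longrightarrow> \<rho> x = 0" "(LINT x|lborel. \<rho> x) = 1" "\<rho> 0 \<noteq> 0"
    by (rule cutoff_bump[OF assms(1)], rule that)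
  have bump: "bump \<rho>" by unfold_locales (use \<rho> in auto)
  have "quasi_projection \<rho> \<eta> M \<alpha> \<psi>"
    by (intro quasi_projection.intro quasi_projection_axioms.intro bump assms)
  from quasi_projection.besov_estimate[OF this assms(2,3,7-9)]
  show "\<exists>c::real. \<forall>f\<in>besov \<alpha> M. \<forall>j. sup_norm (\<lambda>x. f x - quasi_proj \<eta> M j f \<phi> \<psi> x)
      \<le> ennreal c * (\<Sum>\<^sub>\<infinity>\<nu>\<in>{j..}. ennreal (\<alpha> (matpow M (\<nu> - j))) * best_approx (\<delta> *\<^sub>R matpow M \<nu>) f)"
    unfolding besov_def by blast
  assume "\<psi> \<in> class_S_const \<eta> M"
  then obtain a where a: "a > 0" "\<psi> \<in> class_S \<eta> (\<lambda>A. a) M" by (auto simp: class_S_const_def)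
  \<comment> \<open>The operator does not mention the weight, so the whole setting can be
    instantiated anew with a constant weight, whose growth constant is 1, without changing
    \<open>quasi_proj\<close>.\<close>
  have "(\<lambda>A. a) \<in> class_A M" using a(1) by (auto simp: class_A_def intro: exI[of _ 1])
  then have "quasi_projection \<rho> \<eta> M (\<lambda>A. a) \<psi>"
    by (intro quasi_projection.intro quasi_projection_axioms.intro bump assms a)
  from quasi_projection.const_estimate[OF this assms(2,3,7-9)]
  show "\<exists>c::real. \<forall>f\<in>space_C. \<forall>j. sup_norm (\<lambda>x. f x - quasi_proj \<eta> M j f \<phi> \<psi> x)
      \<le> ennreal c * best_approx (\<delta> *\<^sub>R matpow M j) f"
    by blast
qed

end
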